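(* Consider a Generalized Navier-Stokes system with kernels $M_{kjl}$, $k,j,l\in\{1,2,3\}$, and let $\psi_\gamma$, $\gamma\in\Gamma$, be the random initial data (depending on the parameter $K$) constructed in the context. For $K$ large enough, $$P\left[\gamma:\ \psi_\gamma \text{ generates a regular global solution of the Generalized Navier-Stokes system}\right]\ \ge\ 1-\exp(-K).$$
   Context: **Generalized Navier-Stokes system.** Let $M_{kjl}:\mathbb{R}^3\to\mathbb{C}$ ($k,j,l\in\{1,2,3\}$) be (measurable) functions with $|M_{kjl}(\xi)|\le|\xi|$ for all $\xi$. The system with initial datum $\psi=(\psi^1,\psi^2,\psi^3)$ is, in Fourier variables, for $l=1,2,3$, $$\hat u^l(\xi,t)=\hat\psi^l(\xi)e^{-|\xi|^2t}+\int_0^t e^{-|\xi|^2(t-s)}\int_{\mathbb{R}^3}\sum_{k,j=1}^3M_{kjl}(\xi)\,\hat u^k(q,s)\,\hat u^j(\xi-q,s)\,d^3q\,ds .$$ Let $\mathcal{PM}^2$ be the Banach space of $v\in\mathcal{S}'(\mathbb{R}^3)$ with $\hat v\in L^1_{\mathrm{loc}}(\mathbb{R}^3)$ and $\|v\|_2=\operatorname{ess\,sup}_{\xi}|\xi|^2|\hat v(\xi)|<\infty$. A solution on $[0,T]$ is a function $u=(u^1,u^2,u^3):[0,T]\to(\mathcal{PM}^2)^3$ with each component weakly continuous (each $\hat u^i(\xi,t)$ is continuous in $t$) and such that the equation $\hat u^l(\xi,t)=\hat\psi^l(\xi)e^{-|\xi|^2t}+\int_0^t e^{-|\xi|^2(t-s)}\int_{\mathbb{R}^3}\sum_{k,j=1}^3M_{kjl}(\xi)\,\hat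 u^k(q,s)\,\hat u^j(\xi-q,s)\,d^3q\,ds$ holds for $l=1,2,3$. "$\psi$ generates a regular global solution" means that there is a solution with initial datum $\psi$ defined for all $t\ge 0$ which is smooth for $t>0$. **Random initial data.** Fix $\kappa>0$ and put $$\mathcal{H}_\kappa=\{\xi\in\mathbb{R}^3:|\xi_3|\ge\kappa\},\qquad \mathbb{H}_{\ge0}=\{\xi\in\mathbb{R}^3:\xi_3\ge0\},\qquad R_{1,2}=[-2,2)^3\setminus[-1,1)^3 .$$ For a positive integer $K$ (with $\log\log K>0$, and such that the following partitions exist), divide $R_{1,2}\cap\mathcal{H}_\kappa\cap\mathbb{H}_{\ge0}$ into $K$ disjoint congruent cubes (products of three half-open intervals $[h,h')$), each of volume $O(1/K)$, called blocks and enumerated $H_s$, $s=1,\dots,K$. Divide each block $H_s$ into $K^2$ disjoint congruent cubes $W_{s,p}\subset H_s$, $p=1,\dots,K^2$, each of volume $O(1/K^3)$, called subblocks. Extend the partition to $R_{1,2}\cap\mathcal{H}_\kappa$ by adding the blocks $-H_s$ and subblocks $-W_{s,p}$, where $-A=\{-a:a\in A\}$. Let $(\Gamma,\mathcal{G},P)$ be a probability space and $r^j_{s,p}:\Gamma\to\{-1,1\}$ ($j=1,2$; $s=1,\dots,K$; $p=1,\dots,K^2$) independent random variables, each equal to $1$ or $-1$ with probability $\frac12$. Fix complex numbers $\Theta^j_{K,s,p}$ with $|\Theta^j_{K,s,p}|=(\log\log K)^{1/4}$. For $\gamma\in\Gamma$ define $\psi_\gamma=(\psi^1_\gamma,\psi^2_\gamma,\psi^3_\gamma)\in(L^2(\mathbb{R}^3))^3$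 by its Fourier transform: for $j=1,2$, - $\hat\psi^j_\gamma(\xi)=r^j_{s,p}(\gamma)\,\Theta^j_{K,s,p}/|\xi|^2$ if $\xi\in W_{s,p}$; - $\hat\psi^j_\gamma(\xi)=\overline{\hat\psi^j_\gamma(-\xi)}$ if $-\xi\in W_{s,p}$; - $\hat\psi^j_\gamma(\xi)=0$ otherwise; and $\hat\psi^3_\gamma(\xi)=-\frac1{\xi_3}\left(\xi_1\hat\psi^1_\gamma(\xi)+\xi_2\hat\psi^2_\gamma(\xi)\right)$ if $\xi\in R_{1,2}\cap\mathcal{H}_\kappa$, and $\hat\psi^3_\gamma(\xi)=0$ otherwise. *)

theory Defs
  imports "HOL-Probability.Probability"
begin

section \<open>Smooth functions and tempered distributions\<close>

primrec iter_deriv ::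
    "'a list \<Rightarrow> ('a::real_normed_vector \<Rightarrow> 'b::real_normed_vector) \<Rightarrow> 'a \<Rightarrow> 'b" where
  "iter_deriv [] f = f"
| "iter_deriv (v # vs) f = (\<lambda>x. frechet_derivative (iter_deriv vs f) (at x) v)"

text \<open>Meant for open \<open>S\<close>: all iterated partial derivatives exist and are (Frechet)
  differentiable, hence continuous, on \<open>S\<close>.\<close>

definition smooth_on ::
    "'a::euclidean_space set \<Rightarrow> ('a \<Rightarrow> 'b::real_normed_vector) \<Rightarrow> bool" where
  "smooth_on S f \<longleftrightarrow>
     (\<forall>vs. set vs \<subseteq> Basis \<longrightarrow> (\<forall>x\<in>S. iter_deriv vs f differentiable (at x)))"

definition schwartz :: "('a::euclidean_space \<Rightarrow> complex) set" where
  "schwartz = {\<phi>. smooth_on UNIV \<phi> \<and>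
     (\<forall>N vs. set vs \<subseteq> Basis \<longrightarrow>
        bounded (range (\<lambda>x. complex_of_real ((1 + norm x) ^ N) * iter_deriv vs \<phi> x)))}"

definition test_functions :: "('a::euclidean_space \<Rightarrow> complex) set" where
  "test_functions =
     {\<phi>. smooth_on UNIV \<phi> \<and> (\<exists>C. compact C \<and> (\<forall>x. x \<notin> C \<longrightarrow> \<phi> x = 0))}"

definition schwartz_seminorm :: "nat \<Rightarrow> ('a::euclidean_space \<Rightarrow> complex) \<Rightarrow> real" where
  "schwartz_seminorm N \<phi> =
     (\<Sum>vs | set vs \<subseteq> Basis \<and> length vs \<le> N.
        SUP x. (1 + norm x) ^ N * norm (iter_deriv vs \<phi> x))"

text \<open>A distribution is a functional on all functions of which only the values on
  \<^const>\<open>schwartz\<close> are relevant.\<close>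

type_synonym 'a distribution = "('a \<Rightarrow> complex) \<Rightarrow> complex"

definition tempered :: "'a::euclidean_space distribution \<Rightarrow> bool" where
  "tempered v \<longleftrightarrow>
     (\<forall>\<phi>\<in>schwartz. \<forall>\<eta>\<in>schwartz. v (\<lambda>x. \<phi> x + \<eta> x) = v \<phi> + v \<eta>) \<and>
     (\<forall>\<phi>\<in>schwartz. \<forall>c. v (\<lambda>x. c * \<phi> x) = c * v \<phi>) \<and>
     (\<exists>C N. \<forall>\<phi>\<in>schwartz. norm (v \<phi>) \<le> C * schwartz_seminorm N \<phi>)"

definition locally_integrable :: "('a::euclidean_space \<Rightarrow> complex) \<Rightarrow> bool" where
  "locally_integrable g \<longleftrightarrow> (\<forall>C. compact C \<longrightarrow> set_integrable lebesgue C g)"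

definition inverse_fourier :: "(real^3 \<Rightarrow> complex) \<Rightarrow> real^3 \<Rightarrow> complex" where
  "inverse_fourier \<phi> \<xi> =
     complex_of_real (1 / (2 * pi) ^ 3) * (LINT x|lebesgue. cis (x \<bullet> \<xi>) * \<phi> x)"

text \<open>\<open>v\<close> has the locally integrable function \<open>g\<close> as its Fourier transform, that is, \<open>v\<close> is the
  inverse Fourier transform of the distribution \<open>g\<close>, the inverse Fourier transform being extended
  to tempered distributions by duality. The transform is normalized as
  \<open>\<integral> f x exp (- \<i> x \<bullet> \<xi>) dx\<close>; another constant only rescales \<open>v\<close>.\<close>

definition has_fourier_transform :: "(real^3) distribution \<Rightarrow> (real^3 \<Rightarrow> complex) \<Rightarrow> bool" where
  "has_fourier_transform v g \<longleftrightarrow> locally_integrable g \<and>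
     (\<forall>\<phi>\<in>schwartz. v \<phi> = (LINT \<xi>|lebesgue. g \<xi> * inverse_fourier \<phi> \<xi>))"

definition PM2 :: "(real^3) distribution set" where
  "PM2 = {v. tempered v \<and>
     (\<exists>g. has_fourier_transform v g \<and>
          esssup lebesgue (\<lambda>\<xi>. ennreal ((norm \<xi>)\<^sup>2 * norm (g \<xi>))) < \<infinity>)}"

section \<open>The generalized Navier-Stokes system\<close>

type_synonym kernels = "3 \<Rightarrow> 3 \<Rightarrow> 3 \<Rightarrow> real^3 \<Rightarrow> complex"

definition gns_integrand ::
    "kernels \<Rightarrow> (3 \<Rightarrow> real \<Rightarrow> real^3 \<Rightarrow> complex) \<Rightarrow> 3 \<Rightarrow> real^3 \<Rightarrow> real \<Rightarrow> real^3 \<Rightarrow> complex" where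
  "gns_integrand M uh l \<xi> s q =
     (\<Sum>k\<in>UNIV. \<Sum>j\<in>UNIV. M k j l \<xi> * uh k s q * uh j s (\<xi> - q))"

text \<open>The equation at \<open>(\<xi>, t)\<close>. Both integrals are required to converge, so that the default value
  of a divergent Bochner integral is never used.\<close>

definition gns_equation ::
    "kernels \<Rightarrow> (3 \<Rightarrow> real^3 \<Rightarrow> complex) \<Rightarrow> (3 \<Rightarrow> real \<Rightarrow> real^3 \<Rightarrow> complex)
       \<Rightarrow> 3 \<Rightarrow> real^3 \<Rightarrow> real \<Rightarrow> bool" where
  "gns_equation M \<psi> uh l \<xi> t \<longleftrightarrow>
     (\<forall>s\<in>{0..t}. integrable lebesgue (gns_integrand M uh l \<xi> s)) \<and>
     set_integrable lebesgue {0..t}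
       (\<lambda>s. complex_of_real (exp (- (norm \<xi>)\<^sup>2 * (t - s))) *
            (LINT q|lebesgue. gns_integrand M uh l \<xi> s q)) \<and>
     uh l t \<xi> = \<psi> l \<xi> * complex_of_real (exp (- (norm \<xi>)\<^sup>2 * t)) +
       (LINT s:{0..t}|lebesgue. complex_of_real (exp (- (norm \<xi>)\<^sup>2 * (t - s))) *
            (LINT q|lebesgue. gns_integrand M uh l \<xi> s q))"

text \<open>\<open>u\<close> is a solution on the time interval \<open>I\<close>, either \<open>{0..T}\<close> or \<open>{0..}\<close>; \<open>\<psi>\<close> is the Fourier
  transform of the initial datum. Since the Fourier transform of \<open>u l t\<close> is only determined up to null sets, continuity
  in \<open>t\<close> refers to a choice \<open>uh\<close> of representatives and the equation holds for almost every \<open>\<xi>\<close>.\<close>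

definition gns_solution ::
    "kernels \<Rightarrow> (3 \<Rightarrow> real^3 \<Rightarrow> complex) \<Rightarrow> real set \<Rightarrow> (3 \<Rightarrow> real \<Rightarrow> (real^3) distribution)
       \<Rightarrow> bool" where
  "gns_solution M \<psi> I u \<longleftrightarrow>
     (\<forall>l. \<forall>t\<in>I. u l t \<in> PM2) \<and>
     (\<exists>uh. (\<forall>l. \<forall>t\<in>I. has_fourier_transform (u l t) (uh l t)) \<and>
          (\<forall>l \<xi>. continuous_on I (\<lambda>t. uh l t \<xi>)) \<and>
          (\<forall>l. AE \<xi> in lebesgue. \<forall>t\<in>I. gns_equation M \<psi> uh l \<xi> t))"

text \<open>For \<open>t > 0\<close> the distribution \<open>v t\<close> is the function \<open>f (\<cdot>, t)\<close>, where \<open>f\<close> is smooth in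
  space and time jointly.\<close>

definition smooth_for_positive_times :: "(real \<Rightarrow> (real^3) distribution) \<Rightarrow> bool" where
  "smooth_for_positive_times v \<longleftrightarrow>
     (\<exists>f :: (real^3) \<times> real \<Rightarrow> complex. smooth_on (UNIV \<times> {0<..}) f \<and>
        (\<forall>t>0. \<forall>\<phi>\<in>test_functions. v t \<phi> = (LINT x|lebesgue. f (x, t) * \<phi> x)))"

definition generates_regular_global_solution ::
    "kernels \<Rightarrow> (3 \<Rightarrow> real^3 \<Rightarrow> complex) \<Rightarrow> bool" where
  "generates_regular_global_solution M \<psi> \<longleftrightarrow>
     (\<exists>u. gns_solution M \<psi> {0..} u \<and> (\<forall>l. smooth_for_positive_times (u l)))"

section \<open>The random initial data\<close>

definition R12 :: "(real^3) set" where
  "R12 = {\<xi>. \<forall>i. \<xi> $ i \<in> {-2..<2}} - {\<xi>. \<forall>i. \<xi> $ i \<in> {-1..<1}}"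

definition slab_complement :: "real \<Rightarrow> (real^3) set" where
  "slab_complement \<kappa> = {\<xi>. \<bar>\<xi> $ 3\<bar> \<ge> \<kappa>}"

definition upper_half :: "(real^3) set" where
  "upper_half = {\<xi>. \<xi> $ 3 \<ge> 0}"

definition half_open_cube :: "real^3 \<Rightarrow> real \<Rightarrow> (real^3) set" where
  "half_open_cube a h = {\<xi>. \<forall>i. \<xi> $ i \<in> {a $ i..<a $ i + h}}"

text \<open>The common side length \<open>h\<close> expresses that the cubes are congruent.\<close>

definition congruent_cube_partition :: "nat \<Rightarrow> (nat \<Rightarrow> (real^3) set) \<Rightarrow> (real^3) set \<Rightarrow> bool" where
  "congruent_cube_partition n A S \<longleftrightarrow>
     (\<exists>h>0. \<forall>s\<in>{1..n}. \<exists>a. A s = half_open_cube a h) \<and>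
     disjoint_family_on A {1..n} \<and> (\<Union>s\<in>{1..n}. A s) = S"

text \<open>The volume of a block is at most \<open>28 / K\<close> and that of a subblock at most \<open>28 / K ^ 3\<close>: the
  blocks have equal volumes and their union has volume at most \<open>28\<close>. Hence no separate
  assumption on volumes is needed.\<close>

locale gns_random_data = prob_space P for P :: "'g measure" +
  fixes \<kappa> :: real and K :: nat
    and H :: "nat \<Rightarrow> (real^3) set" and W :: "nat \<Rightarrow> nat \<Rightarrow> (real^3) set"
    and \<Theta> :: "3 \<Rightarrow> nat \<Rightarrow> nat \<Rightarrow> complex"
    and r :: "3 \<Rightarrow> nat \<Rightarrow> nat \<Rightarrow> 'g \<Rightarrow> real"
  assumes K_pos: "K > 0" and lnln_pos: "ln (ln (real K)) > 0"
    and blocks: "congruent_cube_partition K H (R12 \<inter> slab_complement \<kappa> \<inter> upper_half)"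
    and subblocks: "\<And>s. s \<in> {1..K} \<Longrightarrow> congruent_cube_partition (K^2) (W s) (H s)"
    and Theta: "\<And>j s p. j \<in> {1, 2} \<Longrightarrow> s \<in> {1..K} \<Longrightarrow> p \<in> {1..K^2} \<Longrightarrow>
          norm (\<Theta> j s p) = ln (ln (real K)) powr (1/4)"
    and signs: "\<And>j s p \<gamma>. j \<in> {1, 2} \<Longrightarrow> s \<in> {1..K} \<Longrightarrow> p \<in> {1..K^2} \<Longrightarrow>
          \<gamma> \<in> space P \<Longrightarrow> r j s p \<gamma> \<in> {-1, 1}"
    and indep: "indep_vars (\<lambda>_. borel) (\<lambda>(j, s, p). r j s p) ({1, 2} \<times> {1..K} \<times> {1..K^2})"
    and fair: "\<And>j s p \<epsilon>. j \<in> {1, 2} \<Longrightarrow> s \<in> {1..K} \<Longrightarrow> p \<in> {1..K^2} \<Longrightarrow>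
          \<epsilon> \<in> {-1, 1} \<Longrightarrow> prob {\<gamma> \<in> space P. r j s p \<gamma> = \<epsilon>} = 1/2"

text \<open>In \<open>psi_hat\<close>, \<open>\<rho> j s p\<close> is the sign \<open>r j s p \<gamma>\<close>, so that \<open>psi_hat\<close> is the Fourier transform
  of \<open>\<psi>\<^sub>\<gamma>\<close>. For \<open>\<kappa> > 0\<close> the sets \<open>W s p\<close> and their reflections are pairwise disjoint, so at most
  one term contributes at each \<open>\<xi>\<close> in \<open>upper_part \<xi> + cnj (upper_part (-\<xi>))\<close>.\<close>

definition upper_part ::
    "nat \<Rightarrow> (nat \<Rightarrow> nat \<Rightarrow> (real^3) set) \<Rightarrow> (3 \<Rightarrow> nat \<Rightarrow> nat \<Rightarrow> complex)
       \<Rightarrow> (3 \<Rightarrow> nat \<Rightarrow> nat \<Rightarrow> real) \<Rightarrow> 3 \<Rightarrow> real^3 \<Rightarrow> complex" where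
  "upper_part K W \<Theta> \<rho> j \<xi> =
     (\<Sum>s\<in>{1..K}. \<Sum>p\<in>{1..K^2}.
        if \<xi> \<in> W s p
        then complex_of_real (\<rho> j s p) * \<Theta> j s p / complex_of_real ((norm \<xi>)\<^sup>2) else 0)"

definition psi_hat12 ::
    "nat \<Rightarrow> (nat \<Rightarrow> nat \<Rightarrow> (real^3) set) \<Rightarrow> (3 \<Rightarrow> nat \<Rightarrow> nat \<Rightarrow> complex)
       \<Rightarrow> (3 \<Rightarrow> nat \<Rightarrow> nat \<Rightarrow> real) \<Rightarrow> 3 \<Rightarrow> real^3 \<Rightarrow> complex" where
  "psi_hat12 K W \<Theta> \<rho> j \<xi> = upper_part K W \<Theta> \<rho> j \<xi> + cnj (upper_part K W \<Theta> \<rho> j (- \<xi>))"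

definition psi_hat ::
    "real \<Rightarrow> nat \<Rightarrow> (nat \<Rightarrow> nat \<Rightarrow> (real^3) set) \<Rightarrow> (3 \<Rightarrow> nat \<Rightarrow> nat \<Rightarrow> complex)
       \<Rightarrow> (3 \<Rightarrow> nat \<Rightarrow> nat \<Rightarrow> real) \<Rightarrow> 3 \<Rightarrow> real^3 \<Rightarrow> complex" where
  "psi_hat \<kappa> K W \<Theta> \<rho> l \<xi> =
     (if l = 3 then
        if \<xi> \<in> R12 \<inter> slab_complement \<kappa>
        then - (1 / complex_of_real (\<xi> $ 3)) *
               (complex_of_real (\<xi> $ 1) * psi_hat12 K W \<Theta> \<rho> 1 \<xi> +
                complex_of_real (\<xi> $ 2) * psi_hat12 K W \<Theta> \<rho> 2 \<xi>)
        else 0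
      else psi_hat12 K W \<Theta> \<rho> l \<xi>)"

end

theory Submission
  imports Defs "HOL-Real_Asymp.Real_Asymp"
begin

text \<open>
Write \<open>v\<close> for the heat flow of the datum and \<open>B\<close> for the bilinear Duhamel term, so that the system
reads \<open>u = v + B(u, u)\<close> in Fourier variables. The flow \<open>v\<close> is large, of size
\<open>A = O((ln (ln K)) powr (1/4))\<close>, but it lives at frequencies between 1 and 4 and therefore decays
like \<open>exp (-t)\<close>. The randomness serves only to make the first iterate \<open>f = B(v, v)\<close> small.

For fixed \<open>\<xi>\<close> and \<open>s\<close> the convolution of \<open>v(s)\<close> with itself is a quadratic
polynomial in the \<open>2 K^3\<close> signs. A single sign governs a subblock of volume \<open>O(1/K^3)\<close>, so flipping it
changes the polynomial by \<open>O(A^2/K^3)\<close> (\<open>chaos_diff\<close>). Its mean is \<open>O(A^2/K^3)\<close> as well, unless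
all components of \<open>\<xi>\<close> are below \<open>4/K\<close>, because a product of values of the datum at two points that do not
share a subblock up to reflection has mean zero (\<open>chaos_mean\<close>). Bounded differences give
sub-Gaussian exponential moments, and integrating these over \<open>\<xi>\<close> and \<open>s\<close> bounds the \<open>L\<^sup>1\<close> norm in
\<open>(s, \<xi>)\<close> by \<open>O(A^4/sqrt K)\<close>, outside an event of probability \<open>exp (-K)\<close> (\<open>chaos_L1_small\<close>). Working in
\<open>L\<^sup>1\<close> avoids every supremum over \<open>\<xi>\<close>. It suffices since \<open>f\<close> enters the next iterates only through
potentials \<open>\<integral> F q / |\<xi> - q| dq\<close>, which are small when \<open>F\<close> is bounded, of bounded support and small in
\<open>L\<^sup>1\<close> (\<open>ball_potential\<close>).

Once \<open>f\<close> is small, the argument is deterministic. Fields \<open>z\<close> are measured by the supremum of \<open>|z(\<xi>, t)| / (\<omega>(t) k(\<xi>))\<close> with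
\<open>k(\<xi>) = exp (-|\<xi>|) / (|\<xi>| (1 + |\<xi>|)^4)\<close> and \<open>\<omega>(t) = exp (lam (1 - exp (-t)))\<close>. The convolution of \<open>k\<close>
with itself is at most a constant times \<open>|\<xi>| k(\<xi>)\<close>, so \<open>B\<close> is bounded for the envelope \<open>k\<close>
(\<open>bilin_le_envelope\<close>). The decay of \<open>v\<close> against the growth of \<open>\<omega>\<close> gives \<open>z \<mapsto> B(v, z)\<close> the norm
\<open>O(A / sqrt lam)\<close> (\<open>bilin_heat_le\<close>), which is small for \<open>lam\<close> of order \<open>A^2\<close>. Hence \<open>v + f\<close> solves the
equation up to a small error, and Picard iteration from it converges for all times (\<open>picard\<close>,
\<open>global_field\<close>). The price is a factor \<open>exp lam = exp (O(sqrt (ln (ln K))))\<close>, which the power of \<open>K\<close>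
gained from the randomness absorbs (\<open>smallness_eventually\<close>).

The solution is regular because the envelope decays exponentially, uniformly in time,
so that all its moments are finite. Time derivatives are again built from the solution by multipliers, sums and
convolutions (\<open>symbol_deriv\<close>), and differentiating under the Fourier integral yields joint smoothness
(\<open>physical_smooth\<close>).

The equation is only asked for almost every \<open>\<xi>\<close>, so the kernels may be taken Borel measurable
(\<open>borel_kernel_version\<close>). The event of the theorem depends on finitely many signs, so it is measurable and
its probability is a proportion of sign patterns (\<open>pattern_event_prob\<close>).
\<close>

section \<open>Weights, potentials and convolutions\<close>

lemma
  fixes f :: "'a \<Rightarrow> 'b::{banach, second_countable_topology}"
  assumes D: "integrable N D" and m: "f \<in> borel_measurable N" and bd: "\<And>x. norm (f x) \<le> D x"
  shows integrable_dominated: "integrable N f" and norm_integral_dominated: "norm (LINT x|N. f x) \<le> (LINT x|N. D x)"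
proof -
  show i: "integrable N f"
    by (rule Bochner_Integration.integrable_bound[OF D m]) (use order_trans[OF bd abs_ge_self] in \<open>auto intro: AE_I2\<close>)
  show "norm (LINT x|N. f x) \<le> (LINT x|N. D x)"
    by (rule order_trans[OF integral_norm_bound integral_mono[OF integrable_norm[OF i] D bd]])
qed

text \<open>Up to constants this integrable function dominates \<open>1/|x|\<^sup>2\<close> near the origin and
  \<open>(1 + |x|)^(-4)\<close> away from it. At the origin its value is zero by the convention
  \<open>1 / 0 = 0\<close>.\<close>

definition inv_sq :: "real^3 \<Rightarrow> real" where
  "inv_sq x = 1 / ((norm x)\<^sup>2 * (1 + norm x)\<^sup>2)"

lemma inv_sq_nonneg: "inv_sq x \<ge> 0" by (simp add: inv_sq_def)

lemma inv_sq_measurable [measurable]: "inv_sq \<in> borel_measurable borel"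
  unfolding inv_sq_def by measurable

lemma dyadic_scale: 
  assumes "(r::real) > 0" shows "\<exists>n::int. 2 powi (n-1) \<le> r \<and> r \<le> 2 powi n"
proof -
  define n where "n = \<lceil>log 2 r\<rceil>"
  have "real_of_int (n-1) \<le> log 2 r" "log 2 r \<le> real_of_int n" unfolding n_def by linarith+
  hence "2 powr real_of_int (n-1) \<le> r" "r \<le> 2 powr real_of_int n"
    using assms by (simp_all add: le_log_iff log_le_iff)
  thus ?thesis using powr_real_of_int'[of 2 n] powr_real_of_int'[of 2 "n-1"] by (intro exI[of _ n]) (simp)
qed

lemma emeasure_cball_le:
  fixes R :: real assumes "R \<ge> 0"
  shows "emeasure lborel (cball (0::real^3) R) \<le> ennreal (8 * R^3)"
proof -
  have "unit_ball_vol (real DIM(real^3)) = 4/3*pi" by (simp add: unit_ball_vol_numeral fact_numeral)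
  also have "\<dots> \<le> 8" using pi_less_4 by simp
  finally show ?thesis using assms by (subst emeasure_cball) (auto intro!: ennreal_leI mult_right_mono)
qed

text \<open>The dyadic shell of radius \<open>2 powi n\<close> has volume \<open>O(8^n)\<close>. Near the origin the factor
  \<open>|x|^(-2)\<close> and at infinity the total decay \<open>|x|^(-4)\<close> leave a convergent geometric series.\<close>

lemma inv_sq_integrable: "integrable lborel inv_sq"
proof (rule integrableI_nonneg)
  \<comment> \<open>Shells inside the unit ball and shells outside it, each dominated by a multiple of the indicator of a ball.\<close>
  define a where "a n x = ennreal (4 * 4^n) * indicator (cball (0::real^3) ((1/2)^n)) x" for n :: nat and x
  define b where "b n x = ennreal (16 * (1/16)^n) * indicator (cball (0::real^3) (2^n)) x" for n :: nat and x
  have ub: "ennreal (inv_sq x) \<le> (\<Sum>n. a n x) + (\<Sum>n. b n x)" for x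
  proof (cases "x = 0")
    case False
    then obtain n :: int where n: "2 powi (n-1) \<le> norm x" "norm x \<le> 2 powi n" using dyadic_scale[of "norm x"] by auto
    show ?thesis
    proof (cases "n \<le> 0")
      case True
      define k where "k = nat (-n)"
      have nk: "n = - int k" using True k_def by simp
      have 1: "norm x \<le> (1/2)^k" using n(2) nk by (simp add: power_int_minus power_divide field_simps)
      have 2: "(1/2)^k / 2 \<le> norm x" using n(1) nk by (simp add: power_int_diff power_int_minus power_divide field_simps)
      have "inv_sq x \<le> 1 / (norm x)\<^sup>2" unfolding inv_sq_def using False
        by (intro divide_left_mono) (auto intro!: mult_pos_pos zero_less_power add_pos_nonneg simp: mult_le_cancel_left1 one_le_power)
      also have "\<dots> \<le> 1 / ((1/2)^k/2)\<^sup>2" using 2 False by (intro divide_left_mono power_mono) auto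
      also have "\<dots> = 4 * 4^k" by (simp add: power2_eq_square power_divide field_simps flip: power_mult_distrib)
      finally have "ennreal (inv_sq x) \<le> a k x" using 1 by (simp add: a_def)
      also have "\<dots> \<le> (\<Sum>n. a n x)" using sum_le_suminf[of "\<lambda>n. a n x" "{k}"] by simp
      finally show ?thesis by (simp add: add_increasing2)
    next
      case F: False
      define k where "k = nat n"
      have nk: "n = int k" using F k_def by simp
      have 1: "norm x \<le> 2^k" using n(2) nk by simp
      have 2: "2^k / 2 \<le> norm x" using n(1) nk by (simp add: power_int_diff)
      have "inv_sq x \<le> 1 / ((norm x)\<^sup>2*(norm x)\<^sup>2)" unfolding inv_sq_def using False
        by (intro divide_left_mono mult_mono power_mono) (auto intro!: mult_pos_pos zero_less_power add_pos_nonneg)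
      also have "\<dots> \<le> 1 / ((2^k/2)\<^sup>2*(2^k/2)\<^sup>2)" using 2 False by (intro divide_left_mono mult_mono power_mono) auto
      also have "\<dots> = 16 * (1/16)^k" by (simp add: power2_eq_square power_divide field_simps flip: power_mult_distrib)
      finally have "ennreal (inv_sq x) \<le> b k x" using 1 by (simp add: b_def)
      also have "\<dots> \<le> (\<Sum>n. b n x)" using sum_le_suminf[of "\<lambda>n. b n x" "{k}"] by simp
      finally show ?thesis by (simp add: add_increasing)
    qed
  qed (simp add: inv_sq_def)
  have [measurable]: "a n \<in> borel_measurable borel" for n
    unfolding a_def[abs_def] by (rule borel_measurable_times_ennreal[OF borel_measurable_const borel_measurable_indicator]) simp
  have [measurable]: "b n \<in> borel_measurable borel" for n
    unfolding b_def[abs_def] by (rule borel_measurable_times_ennreal[OF borel_measurable_const borel_measurable_indicator]) simp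
  have "(\<integral>\<^sup>+x. inv_sq x \<partial>lborel) \<le> (\<integral>\<^sup>+x. (\<Sum>n. a n x) + (\<Sum>n. b n x) \<partial>lborel)" by (intro nn_integral_mono ub)
  also have "\<dots> = (\<Sum>n. \<integral>\<^sup>+x. a n x \<partial>lborel) + (\<Sum>n. \<integral>\<^sup>+x. b n x \<partial>lborel)"
    by (subst nn_integral_add) (auto simp: nn_integral_suminf)
  also have "\<dots> \<le> (\<Sum>n. ennreal (32 * (1/2)^n)) + (\<Sum>n. ennreal (128 * (1/2)^n))"
  proof (intro add_mono suminf_le)
    fix n :: nat
    have "(\<integral>\<^sup>+x. a n x \<partial>lborel) = ennreal (4 * 4^n) * emeasure lborel (cball (0::real^3) ((1/2)^n))"
      unfolding a_def by (simp add: nn_integral_cmult_indicator)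
    also have "\<dots> \<le> ennreal (4 * 4^n) * ennreal (8 * ((1/2)^n)^3)" by (intro mult_left_mono emeasure_cball_le) auto
    also have "\<dots> = ennreal (32 * (1/2)^n)"
    proof -
      have "((1/2::real)^n)^3 = ((1/2)^3)^n" by (simp only: power_mult[symmetric] mult.commute)
      hence "(4 * 4^n) * (8 * ((1/2)^n)^3) = 32 * (4^n * ((1/8::real)^n))" by (simp add: power3_eq_cube)
      also have "4^n * ((1/8::real)^n) = (1/2)^n" by (simp flip: power_mult_distrib)
      finally show ?thesis by (subst ennreal_mult[symmetric]) auto
    qed
    finally show "(\<integral>\<^sup>+x. a n x \<partial>lborel) \<le> ennreal (32 * (1/2)^n)" .
    have "(\<integral>\<^sup>+x. b n x \<partial>lborel) = ennreal (16 * (1/16)^n) * emeasure lborel (cball (0::real^3) (2^n))"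
      unfolding b_def by (simp add: nn_integral_cmult_indicator)
    also have "\<dots> \<le> ennreal (16 * (1/16)^n) * ennreal (8 * (2^n)^3)" by (intro mult_left_mono emeasure_cball_le) auto
    also have "\<dots> = ennreal (128 * (1/2)^n)"
    proof -
      have "((2::real)^n)^3 = (2^3)^n" by (simp only: power_mult[symmetric] mult.commute)
      hence "(16 * (1/16)^n) * (8 * (2^n)^3) = 128 * ((1/16)^n * ((8::real)^n))" by simp
      also have "(1/16)^n * ((8::real)^n) = (1/2)^n" by (simp flip: power_mult_distrib)
      finally show ?thesis by (subst ennreal_mult[symmetric]) auto
    qed
    finally show "(\<integral>\<^sup>+x. b n x \<partial>lborel) \<le> ennreal (128 * (1/2)^n)" .
  qed auto
  also have "\<dots> < \<infinity>"
    by (subst (1 2) suminf_ennreal2) (auto intro!: summable_mult summable_geometric)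
  finally show "(\<integral>\<^sup>+x. inv_sq x \<partial>lborel) < \<infinity>" .
qed (auto simp: inv_sq_nonneg)


definition inv_sq_mass :: real where "inv_sq_mass = (LINT x|lborel. inv_sq x)"

lemma inv_sq_mass_nonneg: "inv_sq_mass \<ge> 0" unfolding inv_sq_mass_def by (simp add: inv_sq_nonneg)

lemma lborel_distr_reflect: "distr lborel borel (\<lambda>q. \<xi> - q) = (lborel :: 'a::euclidean_space measure)"
proof -
  have "lborel = density (distr lborel borel (\<lambda>q. \<xi> + (-1) *\<^sub>R q)) (\<lambda>_. ennreal (\<bar>-1\<bar>^DIM('a)))"
    by (rule lborel_affine) simp
  thus ?thesis by (simp add: density_1)
qed

lemma integral_reflect:
  fixes f :: "'a::euclidean_space \<Rightarrow> 'b::{banach, second_countable_topology}"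
  assumes "f \<in> borel_measurable borel"
  shows "(LINT q|lborel. f (\<xi> - q)) = (LINT q|lborel. f q)"
proof -
  have "(LINT q|lborel. f q) = (LINT q|distr lborel borel (\<lambda>q. \<xi> - q). f q)" by (simp add: lborel_distr_reflect)
  also have "\<dots> = (LINT q|lborel. f (\<xi> - q))" using assms by (subst integral_distr) auto
  finally show ?thesis ..
qed

lemma integrable_reflect:
  fixes f :: "'a::euclidean_space \<Rightarrow> 'b::{banach, second_countable_topology}"
  assumes "integrable lborel f"
  shows "integrable lborel (\<lambda>q. f (\<xi> - q))"
proof -
  have "f \<in> borel_measurable borel" using assms by auto
  moreover have "integrable (distr lborel borel (\<lambda>q. \<xi> - q)) f" using assms by (simp add: lborel_distr_reflect)
  ultimately show ?thesis by (subst (asm) integrable_distr_eq) auto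
qed

definition weight :: "real \<Rightarrow> nat \<Rightarrow> real^3 \<Rightarrow> real" where
  "weight c m x = exp (- c * norm x) / (1 + norm x) ^ m"

lemma one_norm_pos [simp]: "1 + norm x > 0" "1 + norm x \<noteq> 0" "1 + norm x \<ge> 0"
proof -
  show "1 + norm x > 0" by (rule add_pos_nonneg) auto
  thus "1 + norm x \<noteq> 0" "1 + norm x \<ge> 0" by linarith+
qed

lemma weight_nonneg [simp]: "weight c m x \<ge> 0" by (simp add: weight_def)

lemma weight_measurable [measurable]: "weight c m \<in> borel_measurable borel"
  unfolding weight_def by measurable

text \<open>The exponential is submultiplicative by the triangle inequality. Of the polynomial factors the larger argument
  supplies the decay at \<open>q + x\<close>, and the smaller one survives.\<close>

lemma weight_mult:
  assumes "c \<ge> 0"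
  shows "weight c m q * weight c m x \<le> 2^m * weight c m (q + x) * (weight 0 m q + weight 0 m x)"
proof -
  have tri: "norm (q+x) \<le> norm q + norm x" by (rule norm_triangle_ineq)
  have e: "exp (- c * norm q) * exp (- c * norm x) \<le> exp (- c * norm (q+x))"
    using mult_left_mono[OF tri assms] by (simp add: mult_exp_exp algebra_simps)
  have p: "1 / ((1 + norm q)^m * (1 + norm x)^m) \<le> 2^m * (1 / (1 + norm (q+x))^m) * (1/(1+norm q)^m + 1/(1+norm x)^m)"
  proof -
    have "(1 + norm (q+x))^m \<le> (2 * max (1 + norm q) (1+norm x))^m" 
      using tri by (intro power_mono) (auto simp: max_def)
    also have "\<dots> = 2^m * max ((1 + norm q)^m) ((1+norm x)^m)"
      by (simp add: power_mult_distrib max_def power_mono) (metis (no_types, opaque_lifting) add_left_mono linorder_not_le one_norm_pos(3) order_less_imp_le power_mono verit_la_disequality)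
    also have "\<dots> \<le> 2^m * ((1 + norm q)^m + (1+norm x)^m)" by (intro mult_left_mono) (auto simp: max_def)
    finally show ?thesis by (simp add: field_simps)
  qed
  have "weight c m q * weight c m x = (exp (- c * norm q) * exp (- c * norm x)) * (1 / ((1 + norm q)^m * (1 + norm x)^m))"
    by (simp add: weight_def field_simps)
  also have "\<dots> \<le> exp (- c * norm (q+x)) * (2^m * (1 / (1 + norm (q+x))^m) * (1/(1+norm q)^m + 1/(1+norm x)^m))"
    by (intro mult_mono e p) auto
  also have "\<dots> = 2^m * weight c m (q + x) * (weight 0 m q + weight 0 m x)" by (simp add: weight_def)
  finally show ?thesis .
qed

lemma weight_le_inv_sq: assumes "m \<ge> 4" "x \<noteq> 0"
  shows "weight 0 m x \<le> inv_sq x" "weight 0 m x / (norm x)\<^sup>2 \<le> inv_sq x"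
proof -
  have n: "(norm x)\<^sup>2 > 0" using assms by simp
  have "(norm x)\<^sup>2 * (1 + norm x)\<^sup>2 \<le> (1 + norm x)\<^sup>2 * (1 + norm x)\<^sup>2" by (intro mult_right_mono power_mono) auto
  also have "\<dots> = (1+norm x)^4" by (simp add: power4_eq_xxxx power2_eq_square)
  also have "\<dots> \<le> (1+norm x)^m" using assms by (intro power_increasing) auto
  finally show "weight 0 m x \<le> inv_sq x" unfolding weight_def inv_sq_def using n by (simp add: field_simps)
  have "(1 + norm x)\<^sup>2 \<le> (1+norm x)^m" using assms by (intro power_increasing) auto
  thus "weight 0 m x / (norm x)\<^sup>2 \<le> inv_sq x" unfolding weight_def inv_sq_def using n by (simp add: field_simps)
qed

lemma inv_sq_le: "1 / (norm x)\<^sup>2 \<le> 1 + 4 * inv_sq x"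
proof (cases "norm x \<le> 1")
  case True
  show ?thesis
  proof (cases "x = 0")
    case False
    have "(1 + norm x)\<^sup>2 \<le> 2\<^sup>2" using True by (intro power_mono) auto
    hence "1 / (norm x)\<^sup>2 \<le> 4 * inv_sq x" using False unfolding inv_sq_def by (simp add: field_simps)
    thus ?thesis by simp
  qed (simp add: inv_sq_def)
next
  case False
  hence "1 \<le> (norm x)\<^sup>2" by (simp add: one_le_power)
  hence "1 / (norm x)\<^sup>2 \<le> 1" by (simp add: divide_le_eq)
  thus ?thesis using inv_sq_nonneg[of x] by linarith
qed

lemma weight_le_one: "weight 0 m x \<le> 1" unfolding weight_def by (simp add: divide_le_eq one_le_power)

lemma inv_prod_weight:
  assumes "m \<ge> 4" "q \<noteq> 0" "x \<noteq> 0"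
  shows "1 / (norm q * norm x) * weight 0 m q \<le> 2 * (inv_sq q + inv_sq x)"
proof -
  have "1 / (norm q * norm x) \<le> 1/2 * (1 / (norm q)\<^sup>2 + 1 / (norm x)\<^sup>2)"
    using sum_squares_bound[of "1 / norm q" "1 / norm x"] by (simp add: power_divide field_simps)
  hence "1 / (norm q * norm x) * weight 0 m q \<le> 1/2 * (1 / (norm q)\<^sup>2 + 1 / (norm x)\<^sup>2) * weight 0 m q"
    by (intro mult_right_mono) auto
  also have "\<dots> \<le> 1/2 * (1 / (norm q)\<^sup>2 + (1 + 4 * inv_sq x)) * weight 0 m q"
    by (intro mult_right_mono mult_left_mono add_left_mono inv_sq_le) auto
  also have "\<dots> = 1/2 * (weight 0 m q / (norm q)\<^sup>2) + 1/2 * weight 0 m q + 2 * inv_sq x * weight 0 m q"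
    by (simp add: algebra_simps add_divide_distrib)
  also have "\<dots> \<le> 1/2 * inv_sq q + 1/2 * inv_sq q + 2 * inv_sq x * 1"
    by (intro add_mono mult_left_mono weight_le_inv_sq weight_le_one assms) (auto simp: inv_sq_nonneg)
  also have "\<dots> \<le> 2 * (inv_sq q + inv_sq x)" using inv_sq_nonneg[of q] by simp
  finally show ?thesis .
qed

text \<open>After \<open>weight_mult\<close> the singular factor \<open>1 / (|q| |x|)\<close> is split by the
  arithmetic-geometric mean, which leaves two integrable terms and no loss in the weight at \<open>q + x\<close>.\<close>

lemma weight_conv_pointwise:
  assumes "m \<ge> 4" "c \<ge> 0"
  shows "weight c m q / norm q * (weight c m x / norm x) \<le> 4 * 2^m * weight c m (q + x) * (inv_sq q + inv_sq x)"
proof (cases "q = 0 \<or> x = 0")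
  case False
  have "weight c m q / norm q * (weight c m x / norm x) = 1 / (norm q * norm x) * (weight c m q * weight c m x)" by simp
  also have "\<dots> \<le> 1 / (norm q * norm x) * (2^m * weight c m (q + x) * (weight 0 m q + weight 0 m x))"
    by (intro mult_left_mono weight_mult assms) auto
  also have "\<dots> = 2^m * weight c m (q + x) * (1 / (norm q * norm x) * weight 0 m q + 1 / (norm x * norm q) * weight 0 m x)"
    by (simp add: algebra_simps add_divide_distrib)
  also have "\<dots> \<le> 2^m * weight c m (q + x) * (2 * (inv_sq q + inv_sq x) + 2 * (inv_sq x + inv_sq q))"
    using False by (intro mult_left_mono add_mono inv_prod_weight assms) auto
  finally show ?thesis by (simp add: algebra_simps)
qed (auto simp: inv_sq_nonneg)

definition conv :: "(real^3 \<Rightarrow> complex) \<Rightarrow> (real^3 \<Rightarrow> complex) \<Rightarrow> real^3 \<Rightarrow> complex" where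
  "conv f g \<xi> = (LINT q|lborel. f q * g (\<xi> - q))"

lemma conv_commute:
  assumes [measurable]: "f \<in> borel_measurable borel" "g \<in> borel_measurable borel"
  shows "conv f g \<xi> = conv g f \<xi>"
  unfolding conv_def using integral_reflect[of "\<lambda>q. f q * g (\<xi> - q)" \<xi>] by (simp add: mult.commute)

definition conv_const :: "nat \<Rightarrow> real" where "conv_const m = 8 * 2^m * inv_sq_mass"

lemma conv_const_nonneg: "conv_const m \<ge> 0" by (simp add: conv_const_def inv_sq_mass_nonneg)

lemma
  assumes m: "m \<ge> 4" "c \<ge> 0"
    and [measurable]: "f \<in> borel_measurable borel" "g \<in> borel_measurable borel"
    and f: "\<And>q. norm (f q) \<le> a * (weight c m q / norm q)" and g: "\<And>q. norm (g q) \<le> b * (weight c m q / norm q)"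
    and a: "a \<ge> 0" and b: "b \<ge> 0"
  shows conv_integrable: "integrable lborel (\<lambda>q. f q * g (\<xi> - q))"
    and conv_bound: "norm (conv f g \<xi>) \<le> conv_const m * a * b * weight c m \<xi>"
proof -
  define D where "D q = a * b * (4 * 2^m * weight c m \<xi>) * (inv_sq q + inv_sq (\<xi> - q))" for q
  have Di: "integrable lborel D" unfolding D_def
    by (intro integrable_mult_right Bochner_Integration.integrable_add inv_sq_integrable integrable_reflect)
  have bd: "norm (f q * g (\<xi> - q)) \<le> D q" for q
  proof -
    have "norm (f q * g (\<xi> - q)) \<le> (a * (weight c m q / norm q)) * (b * (weight c m (\<xi> - q) / norm (\<xi> - q)))"
      unfolding norm_mult by (intro mult_mono f g) (auto simp: a)
    also have "\<dots> = a * b * (weight c m q / norm q * (weight c m (\<xi> - q) / norm (\<xi> - q)))" by simp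
    also have "\<dots> \<le> a * b * (4 * 2^m * weight c m (q + (\<xi> - q)) * (inv_sq q + inv_sq (\<xi> - q)))"
      using a b by (intro mult_left_mono weight_conv_pointwise m) auto
    finally show ?thesis unfolding D_def by simp
  qed
  show int: "integrable lborel (\<lambda>q. f q * g (\<xi> - q))"
    by (rule integrable_dominated[OF Di _ bd]) measurable
  have "norm (conv f g \<xi>) \<le> (LINT q|lborel. D q)" unfolding conv_def
    by (rule norm_integral_dominated[OF Di _ bd]) measurable
  also have "\<dots> = a * b * (4 * 2^m * weight c m \<xi>) * (inv_sq_mass + inv_sq_mass)" unfolding D_def
    by (subst integral_mult_right_zero, subst Bochner_Integration.integral_add)
       (auto simp: inv_sq_mass_def integral_reflect inv_sq_integrable integrable_reflect)
  finally show "norm (conv f g \<xi>) \<le> conv_const m * a * b * weight c m \<xi>" by (simp add: conv_const_def algebra_simps)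
qed

lemma weight_shift:
  assumes "norm q \<le> 8"
  shows "weight 1 4 (\<xi> - q) \<le> exp 8 * 9^4 * weight 1 4 \<xi>"
proof -
  have t: "norm \<xi> \<le> norm (\<xi> - q) + 8" using assms norm_triangle_ineq[of "\<xi> - q" q] by simp
  have "exp (- norm (\<xi> - q)) \<le> exp 8 * exp (- norm \<xi>)" using t by (simp add: mult_exp_exp)
  moreover have "1 / (1 + norm (\<xi> - q))^4 \<le> 9^4 * (1 / (1 + norm \<xi>)^4)"
  proof -
    have "1 + norm \<xi> \<le> 9 * (1 + norm (\<xi> - q))" using t norm_ge_zero[of "\<xi> - q"] by argo
    hence "(1 + norm \<xi>)^4 \<le> (9 * (1 + norm (\<xi> - q)))^4" by (rule power_mono) simp
    hence "(1 + norm \<xi>)^4 \<le> 9^4 * (1 + norm (\<xi> - q))^4" by (simp only: power_mult_distrib)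
    thus ?thesis by (simp add: field_simps)
  qed
  ultimately have "exp (- norm (\<xi> - q)) * (1 / (1 + norm (\<xi> - q))^4) \<le> (exp 8 * exp (- norm \<xi>)) * (9^4 * (1 / (1 + norm \<xi>)^4))"
    by (intro mult_mono) auto
  also have "\<dots> = exp 8 * 9^4 * weight 1 4 \<xi>" by (simp add: weight_def)
  finally show ?thesis by (simp add: weight_def)
qed

text \<open>A bounded density with small integral has a small potential: by
  \<open>1/|x| \<le> 1/\<eta> + \<eta>/|x|\<^sup>2\<close> the first term sees only the integral of
  \<open>F\<close>, and the second, which carries the singularity, comes with the free factor \<open>\<eta>\<close>.\<close>

lemma ball_potential:
  fixes F :: "real^3 \<Rightarrow> real"
  assumes Fm[measurable]: "F \<in> borel_measurable borel" and F0: "\<And>q. F q \<ge> 0" and Fb: "\<And>q. F q \<le> B"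
    and supp: "\<And>q. norm q > 8 \<Longrightarrow> F q = 0"
    and mass: "(LINT q|lborel. F q) \<le> \<delta>" and \<eta>: "\<eta> > 0"
  shows "integrable lborel F" "integrable lborel (\<lambda>q. F q / norm (\<xi> - q))"
    and "(LINT q|lborel. F q / norm (\<xi> - q)) \<le> \<delta> / \<eta> + \<eta> * B * (8 * 8^3 + 4 * inv_sq_mass)"
proof -
  have B0: "B \<ge> 0" using F0[of 0] Fb[of 0] by simp
  have ib: "integrable lborel (indicator (cball 0 8) :: real^3 \<Rightarrow> real)"
    using emeasure_lborel_cball_finite[of "0::real^3" 8] by (intro integrable_real_indicator) auto
  have "emeasure lborel (cball (0::real^3) 8) \<le> ennreal (8 * 8^3)" by (rule emeasure_cball_le) simp
  hence mb: "measure lborel (cball (0::real^3) 8) \<le> 8 * 8^3"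
    unfolding measure_def by (intro enn2real_leI) auto
  have F1: "F q \<le> B * indicator (cball 0 8) q" for q using Fb[of q] supp[of q] by (auto simp: indicator_def not_le)
  show iF: "integrable lborel F"
    by (rule integrable_dominated[OF integrable_mult_right[OF ib, of B]]) (use F0 F1 in auto)
  define D where "D q = F q / \<eta> + \<eta> * B * (indicator (cball 0 8) q + 4 * inv_sq (\<xi> - q))" for q
  have iD: "integrable lborel D" unfolding D_def
    by (intro Bochner_Integration.integrable_add integrable_mult_right integrable_divide iF ib integrable_reflect inv_sq_integrable)
  have bd: "F q / norm (\<xi> - q) \<le> D q" for q
  proof -
    have "1 / norm (\<xi> - q) \<le> 1 / \<eta> + \<eta> * (1 / (norm (\<xi> - q))\<^sup>2)"
    proof (cases "norm (\<xi> - q) \<ge> \<eta>")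
      case True
      have "1 / norm (\<xi> - q) \<le> 1/\<eta>" using True \<eta> by (intro divide_left_mono mult_pos_pos) linarith+
      moreover have "\<eta> * (1 / (norm (\<xi> - q))\<^sup>2) \<ge> 0" using \<eta> by simp
      ultimately show ?thesis by linarith
    next
      case False
      hence "1 / norm (\<xi> - q) \<le> \<eta> * (1 / (norm (\<xi> - q))\<^sup>2)" by (cases "\<xi> = q") (auto simp: field_simps power2_eq_square)
      moreover have "1/\<eta> \<ge> 0" using \<eta> by simp
      ultimately show ?thesis by linarith
    qed
    also have "\<dots> \<le> 1/\<eta> + \<eta> * (1 + 4 * inv_sq (\<xi> - q))" using \<eta> by (intro add_left_mono mult_left_mono inv_sq_le) auto
    finally have "F q * (1 / norm (\<xi> - q)) \<le> F q * (1/\<eta> + \<eta> * (1 + 4 * inv_sq (\<xi> - q)))" by (rule mult_left_mono[OF _ F0])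
    also have "\<dots> = F q / \<eta> + F q * (\<eta> * (1 + 4 * inv_sq (\<xi> - q)))" by (simp add: algebra_simps)
    also have "\<dots> \<le> F q / \<eta> + (B * indicator (cball 0 8) q) * (\<eta> * (1 + 4 * inv_sq (\<xi> - q)))"
      using \<eta> inv_sq_nonneg[of "\<xi> - q"] by (intro add_left_mono mult_right_mono F1) auto
    also have "\<dots> \<le> D q" unfolding D_def using \<eta> B0 inv_sq_nonneg[of "\<xi> - q"]
      by (auto simp: indicator_def algebra_simps)
    finally show ?thesis by simp
  qed
  show i: "integrable lborel (\<lambda>q. F q / norm (\<xi> - q))"
    by (rule integrable_dominated[OF iD]) (use F0 bd in auto)
  have "(LINT q|lborel. F q / norm (\<xi> - q)) \<le> (LINT q|lborel. D q)" by (intro integral_mono i iD bd)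
  also have "\<dots> = (LINT q|lborel. F q) / \<eta> + \<eta> * B * (measure lborel (cball (0::real^3) 8) + 4 * inv_sq_mass)"
    unfolding D_def using iF ib
    by (subst Bochner_Integration.integral_add)
       (auto simp: inv_sq_mass_def integral_reflect inv_sq_integrable integrable_reflect)
  also have "\<dots> \<le> \<delta> / \<eta> + \<eta> * B * (8 * 8^3 + 4 * inv_sq_mass)"
    using \<eta> B0 mass mb by (intro add_mono mult_left_mono divide_right_mono) auto
  finally show "(LINT q|lborel. F q / norm (\<xi> - q)) \<le> \<delta> / \<eta> + \<eta> * B * (8 * 8^3 + 4 * inv_sq_mass)" .
qed

section \<open>Concentration for functions of random signs\<close>

lemma cosh_le_exp_square: fixes x :: real shows "(exp x + exp (- x)) / 2 \<le> exp (x\<^sup>2)"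
proof (cases "\<bar>x\<bar> \<le> 1")
  case True
  have b: "exp y \<le> 1 + y + y\<^sup>2" if "\<bar>y\<bar> \<le> 1" for y :: real
    using exp_bound_lemma[of y] exp_bound[of y] exp_ge_add_one_self that
  proof (cases "y \<ge> 0")
    case False
    define z where "z = - y"
    have z: "0 \<le> z" "z \<le> 1" using False that by (auto simp: z_def)
    \<comment> \<open>The product is \<open>1 + z^3\<close>.\<close>
    have "(1 - z + z\<^sup>2) * (1 + z) \<ge> 1" using z by (simp add: algebra_simps power2_eq_square)
    hence "(1 - z + z\<^sup>2) * exp z \<ge> 1"
      using mult_left_mono[OF exp_ge_add_one_self[of z], of "1 - z + z\<^sup>2"] z by (smt (verit) zero_le_power2)
    hence "exp (- z) \<le> 1 - z + z\<^sup>2" by (simp add: exp_minus field_simps)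
    thus ?thesis by (simp add: z_def)
  qed (use exp_bound that in auto)
  have "(exp x + exp (- x)) / 2 \<le> 1 + x\<^sup>2" using b[of x] b[of "-x"] True by simp
  also have "\<dots> \<le> exp (x\<^sup>2)" by (rule exp_ge_add_one_self)
  finally show ?thesis .
next
  case False
  have "\<bar>x\<bar> \<le> x\<^sup>2" using False by (metis abs_ge_zero abs_le_square_iff abs_of_nonneg linorder_le_cases mult_le_cancel_right1 power2_abs power2_eq_square order_trans not_le)
  hence "x \<le> x\<^sup>2" "- x \<le> x\<^sup>2" by linarith+
  hence "exp x \<le> exp (x\<^sup>2)" "exp (- x) \<le> exp (x\<^sup>2)" by (simp_all only: exp_le_cancel_iff)
  from add_mono[OF this] show ?thesis by simp
qed

lemma sum_Pow_insert:
  fixes f :: "'i set \<Rightarrow> real"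
  assumes "finite I" "i \<notin> I"
  shows "(\<Sum>S\<in>Pow (insert i I). f S) = (\<Sum>S\<in>Pow I. f S + f (insert i S))"
proof -
  have "Pow (insert i I) = Pow I \<union> insert i ` Pow I" by (rule Pow_insert)
  moreover have "Pow I \<inter> insert i ` Pow I = {}" using assms by auto
  moreover have "inj_on (insert i) (Pow I)" using assms by (auto simp: inj_on_def)
  ultimately show ?thesis using assms
    by (simp add: sum.union_disjoint sum.reindex sum.distrib)
qed

text \<open>Sign patterns are encoded as the sets \<open>S\<close> of indices with a positive sign. Averaging over one sign at a
  time replaces \<open>F\<close> by its conditional mean and costs a factor
  \<open>cosh c \<le> exp (c\<^sup>2)\<close>, since conditional means inherit the difference bound.\<close>

lemma signs_mgf:
  fixes F :: "'i set \<Rightarrow> real" and c :: real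
  assumes "finite I" and "\<And>S i. S \<subseteq> I \<Longrightarrow> i \<in> I - S \<Longrightarrow> \<bar>F (insert i S) - F S\<bar> \<le> 2 * c"
  shows "(\<Sum>S\<in>Pow I. exp (F S)) \<le> 2 ^ card I * exp ((\<Sum>S\<in>Pow I. F S) / 2 ^ card I + card I * c\<^sup>2)"
  using assms
proof (induction I arbitrary: F rule: finite_induct)
  case (insert i I)
  define G where "G S = (F S + F (insert i S)) / 2" for S
  have two: "exp (F S) + exp (F (insert i S)) \<le> 2 * exp (c\<^sup>2) * exp (G S)" if "S \<in> Pow I" for S
  proof -
    define d where "d = (F (insert i S) - F S) / 2"
    have "\<bar>d\<bar> \<le> c" using insert.prems[of S i] that insert.hyps by (auto simp: d_def mult.commute)
    hence dc: "d\<^sup>2 \<le> c\<^sup>2" by (metis abs_ge_zero power2_abs power_mono)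
    have "F S = G S + - d" "F (insert i S) = G S + d" by (auto simp: G_def d_def field_simps)
    hence "exp (F S) + exp (F (insert i S)) = 2 * exp (G S) * ((exp d + exp (- d)) / 2)"
      by (simp only: exp_add) (simp add: algebra_simps)
    also have "\<dots> \<le> 2 * exp (G S) * exp (c\<^sup>2)"
      using order_trans[OF cosh_le_exp_square[of d], of "exp (c\<^sup>2)"] dc by (intro mult_left_mono) auto
    finally show ?thesis by (simp add: algebra_simps)
  qed
  have bd: "\<bar>G (insert j S) - G S\<bar> \<le> 2 * c" if "S \<subseteq> I" "j \<in> I - S" for S j
  proof -
    have "\<bar>F (insert j S) - F S\<bar> \<le> 2*c" using that by (intro insert.prems) auto
    moreover have "\<bar>F (insert j (insert i S)) - F (insert i S)\<bar> \<le> 2*c" using that insert.hyps by (intro insert.prems) auto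
    ultimately show ?thesis unfolding G_def by (simp add: insert_commute abs_le_iff field_simps)
  qed
  have "(\<Sum>S\<in>Pow (insert i I). exp (F S)) \<le> (\<Sum>S\<in>Pow I. 2 * exp (c\<^sup>2) * exp (G S))"
    using insert.hyps by (subst sum_Pow_insert) (auto intro!: sum_mono two)
  also have "\<dots> = 2 * exp (c\<^sup>2) * (\<Sum>S\<in>Pow I. exp (G S))" by (simp add: sum_distrib_left)
  also have "\<dots> \<le> 2 * exp (c\<^sup>2) * (2 ^ card I * exp ((\<Sum>S\<in>Pow I. G S) / 2 ^ card I + card I * c\<^sup>2))"
    by (intro mult_left_mono insert.IH bd) auto
  also have "(\<Sum>S\<in>Pow I. G S) = (\<Sum>S\<in>Pow (insert i I). F S) / 2"
    using insert.hyps by (subst sum_Pow_insert) (auto simp: G_def sum_divide_distrib)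
  finally show ?case using insert.hyps by (simp add: exp_add algebra_simps)
qed auto

text \<open>Markov's inequality for the integrated exponential moments. The inequality
  \<open>lam |y| \<le> a + exp (lam |y| - a)\<close>, with \<open>a\<close> exceeding the exponent of the
  moment bound by \<open>k\<close>, turns the exponential integral into an \<open>L\<^sup>1\<close> bound that is only
  linear in \<open>k\<close>.\<close>

lemma signs_L1_concentration:
  fixes Y :: "'i set \<Rightarrow> 'x \<Rightarrow> real" and B c m lam k V :: real
  assumes I: "finite I" and N: "finite_measure N"
    and Ym: "\<And>S. S \<subseteq> I \<Longrightarrow> Y S \<in> borel_measurable N"
    and Yb: "\<And>S x. S \<subseteq> I \<Longrightarrow> x \<in> space N \<Longrightarrow> \<bar>Y S x\<bar> \<le> B"
    and diff: "\<And>S i x. S \<subseteq> I \<Longrightarrow> i \<in> I - S \<Longrightarrow> x \<in> space N \<Longrightarrow> \<bar>Y (insert i S) x - Y S x\<bar> \<le> 2 * c"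
    and mean: "\<And>x. x \<in> space N \<Longrightarrow> \<bar>\<Sum>S\<in>Pow I. Y S x\<bar> \<le> m * 2 ^ card I"
    and lam: "lam > 0" and m: "m \<ge> 0" and k: "k \<ge> 0" and V: "V > 0" "measure N (space N) \<le> V"
  shows "real (card {S \<in> Pow I. (LINT x|N. \<bar>Y S x\<bar>) > V / lam * (2 + k + lam * m + lam\<^sup>2 * card I * c\<^sup>2)})
           \<le> exp (- k) * 2 ^ card I"
proof -
  interpret finite_measure N by fact
  define n where "n = card I"
  define b where "b = lam * m + lam\<^sup>2 * n * c\<^sup>2"
  define a where "a = k + b"
  define Bad where "Bad = {S \<in> Pow I. (LINT x|N. \<bar>Y S x\<bar>) > V / lam * (2 + a)}"
  define Z where "Z S = (LINT x|N. exp (lam * Y S x) + exp (- lam * Y S x))" for S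
  have a0: "a \<ge> 0" using lam m k by (simp add: a_def b_def)
  have iY: "integrable N (Y S)" if "S \<in> Pow I" for S
    using that by (intro integrable_const_bound[of _ B] Ym) (auto intro!: AE_I2 Yb)
  have ie: "integrable N (\<lambda>x. exp (e * Y S x))" if "S \<in> Pow I" for S e
  proof (rule integrable_const_bound)
    have "exp (e * Y S x) \<le> exp (\<bar>e\<bar> * B)" if "x \<in> space N" for x
    proof -
      have "e * Y S x \<le> \<bar>e\<bar> * \<bar>Y S x\<bar>" using abs_ge_self[of "e * Y S x"] by (simp only: abs_mult)
      also have "\<dots> \<le> \<bar>e\<bar> * B" using Yb[OF _ that] \<open>S \<in> Pow I\<close> by (intro mult_left_mono) auto
      finally show ?thesis by simp
    qed
    thus "AE x in N. norm (exp (e * Y S x)) \<le> exp (\<bar>e\<bar> * B)" by (intro AE_I2) simp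
    have [measurable]: "Y S \<in> borel_measurable N" using that Ym by auto
    show "(\<lambda>x. exp (e * Y S x)) \<in> borel_measurable N" by measurable
  qed
  have ie2: "integrable N (\<lambda>x. exp (lam * Y S x) + exp (- lam * Y S x))" if "S \<in> Pow I" for S
    by (intro Bochner_Integration.integrable_add ie that)
  have pt: "(\<Sum>S\<in>Pow I. exp (lam * Y S x) + exp (- lam * Y S x)) \<le> 2 * 2^n * exp b" if x: "x \<in> space N" for x
  proof -
    have *: "(\<Sum>S\<in>Pow I. exp (e * Y S x)) \<le> 2^n * exp b" if e: "\<bar>e\<bar> = lam" for e
    proof -
      have "(\<Sum>S\<in>Pow I. exp (e * Y S x)) \<le> 2 ^ card I * exp ((\<Sum>S\<in>Pow I. e * Y S x) / 2 ^ card I + card I * (lam * c)\<^sup>2)"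
      proof (rule signs_mgf[OF I])
        fix S i assume "S \<subseteq> I" "i \<in> I - S"
        hence "\<bar>Y (insert i S) x - Y S x\<bar> \<le> 2 * c" using diff x by blast
        hence "\<bar>e\<bar> * \<bar>Y (insert i S) x - Y S x\<bar> \<le> lam * (2 * c)" using e lam by (intro mult_mono) auto
        thus "\<bar>e * Y (insert i S) x - e * Y S x\<bar> \<le> 2 * (lam * c)" by (simp add: abs_mult[symmetric] algebra_simps)
      qed
      also have "\<dots> \<le> 2^n * exp b"
      proof -
        have "(\<Sum>S\<in>Pow I. e * Y S x) \<le> \<bar>e * (\<Sum>S\<in>Pow I. Y S x)\<bar>" by (simp add: sum_distrib_left)
        also have "\<dots> \<le> lam * (m * 2^card I)" unfolding abs_mult e by (intro mult_left_mono mean x) (use lam in auto)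
        finally have "(\<Sum>S\<in>Pow I. e * Y S x) / 2^card I \<le> lam * m" by (simp add: field_simps)
        thus ?thesis by (simp add: n_def b_def power_mult_distrib mult_ac)
      qed
      finally show ?thesis .
    qed
    show ?thesis using *[of lam] *[of "-lam"] lam by (simp add: sum.distrib)
  qed
  have "(\<Sum>S\<in>Pow I. Z S) = (LINT x|N. (\<Sum>S\<in>Pow I. exp (lam * Y S x) + exp (- lam * Y S x)))"
    unfolding Z_def by (subst Bochner_Integration.integral_sum) (use ie2 in auto)
  also have "\<dots> \<le> (LINT x|N. 2 * 2^n * exp b)"
    by (intro integral_mono Bochner_Integration.integrable_sum ie2 pt) auto
  also have "\<dots> \<le> 2 * 2^n * exp b * V" using V by (simp add: mult.commute mult_left_mono)
  finally have sumZ: "(\<Sum>S\<in>Pow I. Z S) \<le> 2 * 2^n * exp b * V" .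
  have Zpos: "Z S \<ge> 0" for S unfolding Z_def by (intro integral_nonneg_AE AE_I2) (auto intro: add_nonneg_nonneg)
  \<comment> \<open>A bad pattern has a large exponential integral, and the sum of these over all patterns is under control.\<close>
  have badZ: "2 * V * exp a < Z S" if S: "S \<in> Bad" for S
  proof -
    have S': "S \<in> Pow I" using S by (auto simp: Bad_def)
    have "V * (2 + a) < lam * (LINT x|N. \<bar>Y S x\<bar>)" using S lam by (simp add: Bad_def field_simps)
    also have "\<dots> = (LINT x|N. lam * \<bar>Y S x\<bar>)" by simp
    also have "\<dots> \<le> (LINT x|N. a + exp (-a) * (exp (lam * Y S x) + exp (- lam * Y S x)))"
    proof (rule integral_mono)
      fix x
      have "1 + (lam * \<bar>Y S x\<bar> - a) \<le> exp (lam * \<bar>Y S x\<bar> - a)" by (rule exp_ge_add_one_self)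
      also have "\<dots> = exp (-a) * exp (lam * \<bar>Y S x\<bar>)" by (simp add: mult_exp_exp)
      also have "\<dots> \<le> exp (-a) * (exp (lam * Y S x) + exp (- lam * Y S x))" by (intro mult_left_mono) (auto simp: abs_if)
      finally show "lam * \<bar>Y S x\<bar> \<le> a + exp (-a) * (exp (lam * Y S x) + exp (- lam * Y S x))" by simp
      show "integrable N (\<lambda>x. lam * \<bar>Y S x\<bar>)" by (intro integrable_mult_right integrable_abs iY S')
      show "integrable N (\<lambda>x. a + exp (-a) * (exp (lam * Y S x) + exp (- lam * Y S x)))"
        by (intro Bochner_Integration.integrable_add integrable_mult_right ie2 S') simp
    qed
    also have "\<dots> \<le> a * V + exp (-a) * Z S"
    proof -
      have "(LINT x|N. a + exp (-a) * (exp (lam * Y S x) + exp (- lam * Y S x)))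
         = (LINT x|N. a) + (LINT x|N. exp (-a) * (exp (lam * Y S x) + exp (- lam * Y S x)))"
        by (intro Bochner_Integration.integral_add integrable_mult_right ie2 S') simp
      also have "\<dots> = a * measure N (space N) + exp (-a) * Z S"
        unfolding Z_def by (simp only: integral_mult_right_zero) simp
      also have "\<dots> \<le> a * V + exp (-a) * Z S" using mult_left_mono[OF V(2) a0] by simp
      finally show ?thesis .
    qed
    finally have "2 * V < exp (-a) * Z S" by (simp add: algebra_simps)
    thus ?thesis by (simp add: exp_minus field_simps)
  qed
  have "real (card Bad) \<le> exp (- k) * 2^n"
  proof -
    have fin: "finite Bad" using I by (auto simp: Bad_def)
    have "card Bad * (2 * V * exp a) = (\<Sum>S\<in>Bad. 2 * V * exp a)" by simp
    also have "\<dots> \<le> (\<Sum>S\<in>Bad. Z S)" by (intro sum_mono less_imp_le badZ)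
    also have "\<dots> \<le> (\<Sum>S\<in>Pow I. Z S)" by (intro sum_mono2) (use I Zpos in \<open>auto simp: Bad_def\<close>)
    also have "\<dots> \<le> 2 * 2^n * exp b * V" by (rule sumZ)
    finally have "card Bad * 2 * exp a * V \<le> (2 * 2^n * exp b) * V" by (simp add: mult_ac)
    hence "card Bad * 2 * exp a \<le> 2 * 2^n * exp b" using V by simp
    hence "card Bad * 2 * exp k \<le> 2 * 2^n" unfolding a_def exp_add by simp
    hence "card Bad * exp k \<le> 2^n" by simp
    thus ?thesis by (simp add: exp_minus field_simps)
  qed
  thus ?thesis unfolding Bad_def a_def b_def n_def by (simp add: add.assoc)
qed

section \<open>The Duhamel operator and the bilinear form\<close>

type_synonym fourier_field = "3 \<Rightarrow> real \<Rightarrow> real^3 \<Rightarrow> complex"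

lemma continuous_on_integral_dominated:
  fixes f :: "'a::metric_space \<Rightarrow> 'b \<Rightarrow> 'c::{banach, second_countable_topology}"
  assumes D: "integrable N D" and bd: "\<And>x q. x \<in> S \<Longrightarrow> norm (f x q) \<le> D q"
    and cont: "\<And>q. continuous_on S (\<lambda>x. f x q)"
    and m: "\<And>x. x \<in> S \<Longrightarrow> f x \<in> borel_measurable N"
  shows "continuous_on S (\<lambda>x. LINT q|N. f x q)"
  unfolding continuous_on_sequentially
proof (intro allI ballI impI)
  fix X x assume x: "x \<in> S" and "(\<forall>n. X n \<in> S) \<and> X \<longlonglongrightarrow> x"
  hence X: "\<And>n. X n \<in> S" "X \<longlonglongrightarrow> x" by auto
  have "(\<lambda>n. LINT q|N. f (X n) q) \<longlonglongrightarrow> (LINT q|N. f x q)"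
  proof (rule integral_dominated_convergence[where w = D])
    have "(\<lambda>n. f (X n) q) \<longlonglongrightarrow> f x q" for q
      using cont[of q] X x unfolding continuous_on_sequentially comp_def by blast
    thus "AE q in N. (\<lambda>n. f (X n) q) \<longlonglongrightarrow> f x q" by simp
  qed (use D bd m X x in auto)
  thus "((\<lambda>x. LINT q|N. f x q) \<circ> X) \<longlonglongrightarrow> (LINT q|N. f x q)" by (simp add: comp_def)
qed

definition duhamel :: "real \<Rightarrow> (real \<Rightarrow> complex) \<Rightarrow> real \<Rightarrow> complex" where
  "duhamel c N t = (LINT s:{0..t}|lborel. complex_of_real (exp (- c * (t - s))) * N s)"

lemma duhamel_integrable:
  assumes "continuous_on {0..} N"
  shows "set_integrable lborel {0..t} (\<lambda>s. complex_of_real (exp (- c * (t - s))) * N s)"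
  by (rule borel_integrable_atLeastAtMost') (intro continuous_intros continuous_on_subset[OF assms], auto)

lemma duhamel_eq:
  assumes "continuous_on {0..} N"
  shows "duhamel c N t = complex_of_real (exp (- c * t)) * integral {0..t} (\<lambda>s. complex_of_real (exp (c * s)) * N s)"
proof -
  have "duhamel c N t = integral {0..t} (\<lambda>s. complex_of_real (exp (- c * (t - s))) * N s)"
    unfolding duhamel_def by (rule set_borel_integral_eq_integral(2)[OF duhamel_integrable[OF assms]])
  also have "\<dots> = integral {0..t} (\<lambda>s. complex_of_real (exp (- c * t)) * (complex_of_real (exp (c * s)) * N s))"
  proof (intro integral_cong)
    fix s
    have "exp (- c * (t - s)) = exp (- c * t) * exp (c * s)" by (simp add: mult_exp_exp algebra_simps)
    thus "complex_of_real (exp (- c * (t - s))) * N s = complex_of_real (exp (- c * t)) * (complex_of_real (exp (c * s)) * N s)"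
      by simp
  qed
  finally show ?thesis by simp
qed

text \<open>The operator solves \<open>D' = N - c D\<close>. This is the source both of continuity in time and of the time
  derivatives of the solution.\<close>

lemma duhamel_deriv:
  assumes N: "continuous_on {0..} N" and t: "t \<ge> 0"
  shows "(duhamel c N has_vector_derivative N t - complex_of_real c * duhamel c N t) (at t within {0..})"
proof -
  define I where "I t = integral {0..t} (\<lambda>s. complex_of_real (exp (c * s)) * N s)" for t
  have "continuous_on {0..t+1} (\<lambda>s. complex_of_real (exp (c * s)) * N s)"
    by (intro continuous_intros continuous_on_subset[OF N]) auto
  hence "(I has_vector_derivative complex_of_real (exp (c * t)) * N t) (at t within {0..t+1})"
    unfolding I_def by (rule integral_has_vector_derivative) (use t in auto)
  moreover have "at t within {0..t+1} = at t within {0..}"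
    by (rule at_within_nhd[of _ "{..<t+1}"]) (use t in auto)
  ultimately have I: "(I has_vector_derivative complex_of_real (exp (c * t)) * N t) (at t within {0..})" by simp
  have e: "((\<lambda>t. complex_of_real (exp (- c * t))) has_vector_derivative complex_of_real (- c * exp (- c * t))) (at t within {0..})"
    by (rule has_vector_derivative_of_real) (auto intro!: derivative_eq_intros simp flip: has_real_derivative_iff_has_vector_derivative)
  have "((\<lambda>t. complex_of_real (exp (- c * t)) * I t) has_vector_derivative
      complex_of_real (exp (- c * t)) * (complex_of_real (exp (c * t)) * N t) + complex_of_real (- c * exp (- c * t)) * I t) (at t within {0..})"
    by (rule has_vector_derivative_mult[OF e I])
  moreover have "(\<lambda>t. complex_of_real (exp (- c * t)) * I t) = duhamel c N" using duhamel_eq[OF N] by (auto simp: I_def fun_eq_iff)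
  moreover have "complex_of_real (exp (- c * t)) * (complex_of_real (exp (c * t)) * N t) = N t"
  proof -
    have "exp (- c * t) * exp (c * t) = 1" by (simp add: mult_exp_exp)
    hence "complex_of_real (exp (- c * t)) * complex_of_real (exp (c * t)) = 1" by (metis of_real_1 of_real_mult)
    thus ?thesis by (simp only: mult.assoc[symmetric] mult_1_left)
  qed
  moreover have "complex_of_real (- c * exp (- c * t)) * I t = - complex_of_real c * duhamel c N t"
    by (simp add: duhamel_eq[OF N] I_def)
  ultimately show ?thesis by (simp only: diff_conv_add_uminus mult_minus_left)
qed

lemma duhamel_continuous:
  assumes N: "continuous_on {0..} N" shows "continuous_on {0..} (duhamel c N)"
  using duhamel_deriv[OF N] by (auto intro!: has_vector_derivative_continuous simp: continuous_on_eq_continuous_within)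

text \<open>A primitive \<open>H\<close> of any majorant of the integrand bounds the integral, which reduces all time integrals
  below to differentiation.\<close>

lemma duhamel_le:
  assumes N: "continuous_on {0..} N" and t: "t \<ge> 0"
    and H: "\<And>s. 0 \<le> s \<Longrightarrow> s \<le> t \<Longrightarrow> (H has_real_derivative h s) (at s within {0..t})"
    and h: "\<And>s. 0 \<le> s \<Longrightarrow> s \<le> t \<Longrightarrow> exp (- c * (t - s)) * norm (N s) \<le> h s"
  shows "norm (duhamel c N t) \<le> H t - H 0"
proof -
  have hi: "(h has_integral H t - H 0) {0..t}"
    by (rule fundamental_theorem_of_calculus) (use t H in \<open>auto simp: has_real_derivative_iff_has_vector_derivative\<close>)
  have i: "(\<lambda>s. complex_of_real (exp (- c * (t - s))) * N s) integrable_on {0..t}"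
    using duhamel_integrable[OF N] by (rule set_borel_integral_eq_integral(1))
  have "duhamel c N t = integral {0..t} (\<lambda>s. complex_of_real (exp (- c * (t - s))) * N s)"
    unfolding duhamel_def by (rule set_borel_integral_eq_integral(2)[OF duhamel_integrable[OF N]])
  also have "norm \<dots> \<le> integral {0..t} h"
    by (rule integral_norm_bound_integral[OF i]) (use hi h in \<open>auto simp: norm_mult\<close>)
  also have "\<dots> = H t - H 0" using hi by (rule integral_unique)
  finally show ?thesis .
qed

text \<open>The logarithmic derivative of this time weight is \<open>lam * exp (- t)\<close>, matched to the decay of the
  heat flow of data supported away from the origin; the weight stays between 1 and \<open>exp lam\<close>.\<close>

definition growth :: "real \<Rightarrow> real \<Rightarrow> real" where "growth lam t = exp (lam * (1 - exp (- t)))"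

lemma growth_pos [simp]: "growth lam t > 0" "growth lam t \<ge> 0" by (simp_all add: growth_def)
lemma growth_mono: "lam \<ge> 0 \<Longrightarrow> s \<le> t \<Longrightarrow> growth lam s \<le> growth lam t" by (simp add: growth_def mult_left_mono)
lemma growth_zero: "growth 0 t = 1" by (simp add: growth_def)
lemma growth_le: "lam \<ge> 0 \<Longrightarrow> growth lam t \<le> exp lam" by (simp add: growth_def mult_left_le)
lemma growth_ge_1: "lam \<ge> 0 \<Longrightarrow> t \<ge> 0 \<Longrightarrow> growth lam t \<ge> 1" by (simp add: growth_def)

text \<open>Parabolic gain of \<open>1/c\<close> for a forcing that is dominated by an increasing weight.\<close>

lemma duhamel_bound:
  assumes N: "continuous_on {0..} N" and t: "t \<ge> 0" and c: "c \<ge> 0" and lam: "lam \<ge> 0" and n: "n \<ge> 0"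
    and b: "\<And>s. 0 \<le> s \<Longrightarrow> s \<le> t \<Longrightarrow> norm (N s) \<le> n * growth lam s"
  shows "c * norm (duhamel c N t) \<le> n * growth lam t"
proof (cases "c = 0")
  case False
  have "norm (duhamel c N t) \<le> n * growth lam t * exp (- c * (t - t)) / c - n * growth lam t * exp (- c * (t - 0)) / c"
  proof (rule duhamel_le[OF N t])
    fix s assume s: "0 \<le> s" "s \<le> t"
    show "((\<lambda>s. n * growth lam t * exp (- c * (t - s)) / c) has_real_derivative exp (- c * (t - s)) * (n * growth lam t)) (at s within {0..t})"
      using False by (auto intro!: derivative_eq_intros)
    have "norm (N s) \<le> n * growth lam t" using b[OF s] mult_left_mono[OF growth_mono[OF lam s(2)] n] by linarith
    thus "exp (- c * (t - s)) * norm (N s) \<le> exp (- c * (t - s)) * (n * growth lam t)" by (intro mult_left_mono) auto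
  qed
  also have "\<dots> \<le> n * growth lam t / c" using c n by simp
  finally show ?thesis using c False by (simp add: field_simps)
qed (use n in auto)

text \<open>A forcing with the extra factor \<open>exp (-s)\<close> gains \<open>1/c\<close> from the heat kernel and
  \<open>1/lam\<close> from the growth of the weight. The geometric mean of the two gains is
  \<open>1/sqrt (c lam)\<close>, so \<open>lam\<close> large makes the bound small at every frequency while still
  absorbing one power of \<open>|\<xi>|\<close>.\<close>

lemma duhamel_bound_decay:
  assumes N: "continuous_on {0..} N" and t: "t \<ge> 0" and c: "c \<ge> 0" and lam: "lam > 0" and n: "n \<ge> 0"
    and b: "\<And>s. 0 \<le> s \<Longrightarrow> s \<le> t \<Longrightarrow> norm (N s) \<le> n * exp (- s) * growth lam s"
  shows "sqrt c * norm (duhamel c N t) \<le> n * growth lam t / sqrt lam"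
proof -
  have 1: "c * norm (duhamel c N t) \<le> n * growth lam t"
  proof (rule duhamel_bound[OF N t c _ n])
    fix s assume s: "0 \<le> s" "s \<le> t"
    have "n * exp (- s) * growth lam s \<le> n * 1 * growth lam s" using s n by (intro mult_right_mono mult_left_mono) auto
    thus "norm (N s) \<le> n * growth lam s" using b[OF s] by simp
  qed (use lam in auto)
  have "norm (duhamel c N t) \<le> n * growth lam t / lam - n * growth lam 0 / lam"
  proof (rule duhamel_le[OF N t])
    fix s assume s: "0 \<le> s" "s \<le> t"
    show "((\<lambda>s. n * growth lam s / lam) has_real_derivative n * exp (-s) * growth lam s) (at s within {0..t})"
      unfolding growth_def using lam by (auto intro!: derivative_eq_intros)
    have "exp (- c * (t - s)) \<le> 1" using c s by (simp add: mult_nonneg_nonneg)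
    hence "exp (- c * (t - s)) * norm (N s) \<le> 1 * norm (N s)" by (intro mult_right_mono) auto
    thus "exp (- c * (t - s)) * norm (N s) \<le> n * exp (-s) * growth lam s" using b[OF s] by simp
  qed
  also have "\<dots> \<le> n * growth lam t / lam" using n lam by simp
  finally have 2: "lam * norm (duhamel c N t) \<le> n * growth lam t" using lam by (simp add: field_simps)
  have nn: "n * growth lam t \<ge> 0" using n by simp
  have "(sqrt c * norm (duhamel c N t) * sqrt lam)\<^sup>2 = (c * norm (duhamel c N t)) * (lam * norm (duhamel c N t))"
    using c lam by (simp add: power_mult_distrib) (simp add: power2_eq_square)
  also have "\<dots> \<le> (n * growth lam t) * (n * growth lam t)" using lam nn by (intro mult_mono 1 2) auto
  finally have "sqrt c * norm (duhamel c N t) * sqrt lam \<le> n * growth lam t"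
    using nn power2_le_imp_le[of "sqrt c * norm (duhamel c N t) * sqrt lam" "n * growth lam t"] by (simp only: power2_eq_square)
  thus ?thesis using lam by (simp add: field_simps)
qed

text \<open>At the origin the value is \<open>0\<close> by the convention \<open>1 / 0 = 0\<close>; fields bounded by a
  multiple of the envelope vanish there, which is consistent with the equation as the kernels vanish at the origin.\<close>

definition envelope :: "real^3 \<Rightarrow> real" where "envelope x = weight 1 4 x / norm x"

lemma envelope_nonneg [simp]: "envelope x \<ge> 0" by (simp add: envelope_def)
lemma envelope_0 [simp]: "envelope 0 = 0" by (simp add: envelope_def)

text \<open>Continuity and the bound are required for nonnegative times only, measurability for all times, so that iterates can
  be formed without a case distinction.\<close>

definition admissible :: "fourier_field \<Rightarrow> bool" where
  "admissible z \<longleftrightarrow> (\<forall>l. (\<lambda>x. z l (fst x) (snd x)) \<in> borel_measurable (borel \<Otimes>\<^sub>M borel)) \<and>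
     (\<forall>l \<xi>. continuous_on {0..} (\<lambda>t. z l t \<xi>)) \<and>
     (\<exists>C\<ge>0. \<forall>l t \<xi>. t \<ge> 0 \<longrightarrow> norm (z l t \<xi>) \<le> C * envelope \<xi>)"

lemma admissible_measurable:
  assumes "admissible z" "f \<in> borel_measurable N" "g \<in> borel_measurable N"
  shows "(\<lambda>x. z l (f x) (g x)) \<in> borel_measurable N"
proof -
  have "(\<lambda>x. z l (fst x) (snd x)) \<in> borel_measurable (borel \<Otimes>\<^sub>M borel)" using assms by (auto simp: admissible_def)
  from measurable_compose[OF measurable_Pair[OF assms(2,3)] this] show ?thesis by simp
qed

lemma admissible_cont: "admissible z \<Longrightarrow> continuous_on {0..} (\<lambda>t. z l t \<xi>)" by (auto simp: admissible_def)

lemma admissible_bound: assumes "admissible z" obtains C where "C \<ge> 0" "\<And>l t \<xi>. t \<ge> 0 \<Longrightarrow> norm (z l t \<xi>) \<le> C * envelope \<xi>"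
  using assms by (auto simp: admissible_def)

lemma admissible_meas1: "admissible z \<Longrightarrow> z l t \<in> borel_measurable borel"
  using admissible_measurable[of z "\<lambda>_. t" borel "\<lambda>x. x" l] by simp

lemma admissible_add: assumes "admissible a" "admissible b" shows "admissible (\<lambda>l t \<xi>. a l t \<xi> + b l t \<xi>)"
proof -
  obtain C where C: "C \<ge> 0" "\<And>l t \<xi>. t \<ge> 0 \<Longrightarrow> norm (a l t \<xi>) \<le> C * envelope \<xi>" using assms(1) by (rule admissible_bound) auto
  obtain D where D: "D \<ge> 0" "\<And>l t \<xi>. t \<ge> 0 \<Longrightarrow> norm (b l t \<xi>) \<le> D * envelope \<xi>" using assms(2) by (rule admissible_bound) auto
  have bd: "norm (a l t \<xi> + b l t \<xi>) \<le> (C + D) * envelope \<xi>" if "t \<ge> 0" for l t \<xi>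
    using norm_triangle_ineq[of "a l t \<xi>" "b l t \<xi>"] C(2)[OF that] D(2)[OF that] by (smt (verit) distrib_right)
  thus ?thesis unfolding admissible_def
  proof (intro conjI allI)
    show "\<exists>K\<ge>0. \<forall>l t \<xi>. t \<ge> 0 \<longrightarrow> norm (a l t \<xi> + b l t \<xi>) \<le> K * envelope \<xi>"
      using C(1) D(1) bd by (intro exI[of _ "C+D"]) auto
  qed (intro borel_measurable_add continuous_on_add admissible_measurable[OF assms(1)] admissible_measurable[OF assms(2)] admissible_cont assms measurable_fst measurable_snd)+
qed

lemma admissible_minus: assumes "admissible a" "admissible b" shows "admissible (\<lambda>l t \<xi>. a l t \<xi> - b l t \<xi>)"
proof -
  have "admissible (\<lambda>l t \<xi>. - b l t \<xi>)" using assms(2) unfolding admissible_def by (auto intro!: continuous_on_minus)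
  from admissible_add[OF assms(1) this] show ?thesis by simp
qed

lemma conv_dom:
  fixes f g :: "real^3 \<Rightarrow> complex"
  assumes "m \<ge> 4" "c \<ge> 0"
    and f: "\<And>q. norm (f q) \<le> a * (weight c m q / norm q)" and g: "\<And>q. norm (g q) \<le> b * (weight c m q / norm q)"
    and a: "a \<ge> 0" and b: "b \<ge> 0"
  shows "norm (f q * g (\<xi> - q)) \<le> a * b * (4 * 2^m * weight c m \<xi>) * (inv_sq q + inv_sq (\<xi> - q))"
proof -
  have "norm (f q * g (\<xi> - q)) \<le> (a * (weight c m q / norm q)) * (b * (weight c m (\<xi> - q) / norm (\<xi> - q)))"
    unfolding norm_mult by (rule mult_mono[OF f g]) (auto simp: a)
  also have "\<dots> = a * b * (weight c m q / norm q * (weight c m (\<xi> - q) / norm (\<xi> - q)))" by simp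
  also have "\<dots> \<le> a * b * (4 * 2^m * weight c m (q + (\<xi> - q)) * (inv_sq q + inv_sq (\<xi> - q)))"
    using a b by (intro mult_left_mono weight_conv_pointwise assms) auto
  finally show ?thesis by simp
qed

lemma inv_sq_sum_integrable: "integrable lborel (\<lambda>q. C * (inv_sq q + inv_sq (\<xi> - q)))"
  by (intro integrable_mult_right Bochner_Integration.integrable_add inv_sq_integrable integrable_reflect)

lemma admissible_conv_cont:
  assumes "admissible a" "admissible b" shows "continuous_on {0..} (\<lambda>s. conv (a k s) (b j s) \<xi>)"
proof -
  obtain C where C: "C \<ge> 0" "\<And>l t \<xi>. t \<ge> 0 \<Longrightarrow> norm (a l t \<xi>) \<le> C * envelope \<xi>" using assms(1) by (rule admissible_bound) auto
  obtain D where D: "D \<ge> 0" "\<And>l t \<xi>. t \<ge> 0 \<Longrightarrow> norm (b l t \<xi>) \<le> D * envelope \<xi>" using assms(2) by (rule admissible_bound) auto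
  show ?thesis unfolding conv_def
  proof (rule continuous_on_integral_dominated)
    show "integrable lborel (\<lambda>q. C * D * (4 * 2^4 * weight 1 4 \<xi>) * (inv_sq q + inv_sq (\<xi> - q)))" by (rule inv_sq_sum_integrable)
    fix s :: real and q assume "s \<in> {0..}"
    thus "norm (a k s q * b j s (\<xi> - q)) \<le> C * D * (4 * 2^4 * weight 1 4 \<xi>) * (inv_sq q + inv_sq (\<xi> - q))"
      using C D by (intro conv_dom) (auto simp: envelope_def)
    show "(\<lambda>q. a k s q * b j s (\<xi> - q)) \<in> borel_measurable lborel"
      by (intro borel_measurable_times admissible_measurable[OF assms(1)] admissible_measurable[OF assms(2)]) auto
  qed (intro continuous_on_mult admissible_cont assms)
qed

lemma admissible_conv_integrable:
  assumes "admissible a" "admissible b" "s \<ge> 0" shows "integrable lborel (\<lambda>q. a k s q * b j s (\<xi> - q))"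
proof -
  obtain C where C: "C \<ge> 0" "\<And>l t \<xi>. t \<ge> 0 \<Longrightarrow> norm (a l t \<xi>) \<le> C * envelope \<xi>" using assms(1) by (rule admissible_bound) auto
  obtain D where D: "D \<ge> 0" "\<And>l t \<xi>. t \<ge> 0 \<Longrightarrow> norm (b l t \<xi>) \<le> D * envelope \<xi>" using assms(2) by (rule admissible_bound) auto
  show ?thesis using C D assms by (intro conv_integrable[of 4 1 _ _ C D] admissible_meas1) (auto simp: envelope_def)
qed

lemma admissible_conv_measurable:
  assumes "admissible a" "admissible b" "f \<in> borel_measurable N" "g \<in> borel_measurable N"
  shows "(\<lambda>x. conv (a k (f x)) (b j (f x)) (g x)) \<in> borel_measurable N"
  unfolding conv_def
proof (rule lborel.borel_measurable_lebesgue_integral)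
  have 1: "(\<lambda>x. f (fst x)) \<in> borel_measurable (N \<Otimes>\<^sub>M lborel)" "(\<lambda>x. g (fst x)) \<in> borel_measurable (N \<Otimes>\<^sub>M lborel)"
    using assms(3,4) by measurable
  show "(\<lambda>(x, q). a k (f x) q * b j (f x) (g x - q)) \<in> borel_measurable (N \<Otimes>\<^sub>M lborel)"
    unfolding case_prod_beta
    by (intro borel_measurable_times admissible_measurable[OF assms(1)] admissible_measurable[OF assms(2)] 1 borel_measurable_diff) auto
qed

locale borel_kernels =
  fixes M :: kernels
  assumes M_meas [measurable]: "\<And>k j l. M k j l \<in> borel_measurable borel"
    and M_le: "\<And>k j l \<xi>. norm (M k j l \<xi>) \<le> norm \<xi>"
begin

definition nonlin :: "fourier_field \<Rightarrow> fourier_field \<Rightarrow> 3 \<Rightarrow> real^3 \<Rightarrow> real \<Rightarrow> complex" where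
  "nonlin a b l \<xi> s = (\<Sum>k\<in>UNIV. \<Sum>j\<in>UNIV. M k j l \<xi> * conv (a k s) (b j s) \<xi>)"

definition bilin :: "fourier_field \<Rightarrow> fourier_field \<Rightarrow> fourier_field" where
  "bilin a b l t \<xi> = duhamel ((norm \<xi>)\<^sup>2) (nonlin a b l \<xi>) t"

lemma nonlin_le:
  assumes "\<And>k j. norm (conv (a k s) (b j s) \<xi>) \<le> n"
  shows "norm (nonlin a b l \<xi> s) \<le> 9 * norm \<xi> * n"
proof -
  have "norm (nonlin a b l \<xi> s) \<le> (\<Sum>k\<in>(UNIV::3 set). \<Sum>j\<in>(UNIV::3 set). norm \<xi> * n)"
    unfolding nonlin_def by (intro sum_norm_le) (auto simp: norm_mult intro!: mult_mono M_le assms)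
  thus ?thesis by simp
qed

lemma nonlin_cont: "admissible a \<Longrightarrow> admissible b \<Longrightarrow> continuous_on {0..} (nonlin a b l \<xi>)"
  unfolding nonlin_def by (intro continuous_intros admissible_conv_cont)

lemma nonlin_measurable:
  assumes "admissible a" "admissible b" "f \<in> borel_measurable N" "g \<in> borel_measurable N"
  shows "(\<lambda>x. nonlin a b l (g x) (f x)) \<in> borel_measurable N"
  unfolding nonlin_def
  by (intro borel_measurable_sum borel_measurable_times admissible_conv_measurable assms measurable_compose[OF assms(4) M_meas])

lemma bilin_measurable:
  assumes "admissible a" "admissible b"
  shows "(\<lambda>x. bilin a b l (fst x) (snd x)) \<in> borel_measurable (borel \<Otimes>\<^sub>M borel)"
  unfolding bilin_def duhamel_def set_lebesgue_integral_def
proof (rule lborel.borel_measurable_lebesgue_integral)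
  have 1: "(\<lambda>x. nonlin a b l (snd (fst x)) (snd x)) \<in> borel_measurable ((borel \<Otimes>\<^sub>M borel) \<Otimes>\<^sub>M lborel)"
    by (rule nonlin_measurable[OF assms]) auto
  have 2: "(\<lambda>x. indicator {0..fst (fst x)} (snd x)) \<in> borel_measurable (((borel::real measure) \<Otimes>\<^sub>M (borel::(real^3) measure)) \<Otimes>\<^sub>M lborel)"
    unfolding indicator_def atLeastAtMost_iff by measurable
  show "(\<lambda>(x, s). indicator {0..fst x} s *\<^sub>R (complex_of_real (exp (- (norm (snd x))\<^sup>2 * (fst x - s))) * nonlin a b l (snd x) s))
     \<in> borel_measurable ((borel \<Otimes>\<^sub>M borel) \<Otimes>\<^sub>M lborel)"
    unfolding case_prod_beta
    by (intro borel_measurable_scaleR 2 borel_measurable_times 1) measurable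
qed

lemma bilin_cont: "admissible a \<Longrightarrow> admissible b \<Longrightarrow> continuous_on {0..} (\<lambda>t. bilin a b l t \<xi>)"
  unfolding bilin_def by (intro duhamel_continuous nonlin_cont)

lemma M_zero: "M k j l 0 = 0"
  using M_le[of k j l 0] by simp

lemma bilin_zero: "bilin a b l t 0 = 0"
  by (simp add: bilin_def duhamel_def nonlin_def M_zero)

lemma bilin_le:
  assumes "admissible a" "admissible b" and t: "t \<ge> 0" and lam: "lam \<ge> 0" and n: "n \<ge> 0"
    and b: "\<And>k j s. 0 \<le> s \<Longrightarrow> s \<le> t \<Longrightarrow> norm (conv (a k s) (b j s) \<xi>) \<le> n * weight 1 4 \<xi> * growth lam s"
  shows "norm (bilin a b l t \<xi>) \<le> 9 * n * growth lam t * envelope \<xi>"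
proof (cases "\<xi> = 0")
  case True
  thus ?thesis by (simp add: bilin_zero)
next
  case False
  have "(norm \<xi>)\<^sup>2 * norm (bilin a b l t \<xi>) \<le> 9 * norm \<xi> * (n * weight 1 4 \<xi>) * growth lam t"
    unfolding bilin_def
  proof (rule duhamel_bound[OF nonlin_cont[OF assms(1,2)] t _ lam])
    fix s assume "0 \<le> s" "s \<le> t"
    thus "norm (nonlin a b l \<xi> s) \<le> 9 * norm \<xi> * (n * weight 1 4 \<xi>) * growth lam s"
      using nonlin_le[of a s b \<xi> "n * weight 1 4 \<xi> * growth lam s" l, OF b] by (simp add: mult_ac)
  qed (use n in auto)
  thus ?thesis using False by (simp add: envelope_def field_simps power2_eq_square)
qed

text \<open>Compared with \<open>bilin_le\<close>, the convolution is assumed one power of \<open>|\<xi>|\<close> smaller at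
  high frequencies. This pays for using \<open>duhamel_bound_decay\<close>, and produces the factor
  \<open>1 / sqrt lam\<close>.\<close>

lemma bilin_le_decay:
  assumes "admissible a" "admissible b" and t: "t \<ge> 0" and lam: "lam > 0" and n: "n \<ge> 0"
    and b: "\<And>k j s. 0 \<le> s \<Longrightarrow> s \<le> t \<Longrightarrow> norm \<xi> * norm (conv (a k s) (b j s) \<xi>) \<le> n * weight 1 4 \<xi> * exp (- s) * growth lam s"
  shows "norm (bilin a b l t \<xi>) \<le> 9 * n / sqrt lam * growth lam t * envelope \<xi>"
proof (cases "\<xi> = 0")
  case True
  thus ?thesis by (simp add: bilin_zero)
next
  case False
  have "sqrt ((norm \<xi>)\<^sup>2) * norm (bilin a b l t \<xi>) \<le> 9 * (n * weight 1 4 \<xi>) * growth lam t / sqrt lam"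
    unfolding bilin_def
  proof (rule duhamel_bound_decay[OF nonlin_cont[OF assms(1,2)] t _ lam])
    fix s assume s: "0 \<le> s" "s \<le> t"
    have "norm (conv (a k s) (b j s) \<xi>) \<le> n * weight 1 4 \<xi> * exp (- s) * growth lam s / norm \<xi>" for k j
      using b[OF s, of k j] False by (simp add: field_simps)
    from nonlin_le[of a s b \<xi> _ l, OF this] show "norm (nonlin a b l \<xi> s) \<le> 9 * (n * weight 1 4 \<xi>) * exp (- s) * growth lam s"
      using False by (simp add: mult_ac)
  qed (use n in auto)
  thus ?thesis using False lam by (simp add: envelope_def field_simps)
qed

lemma conv_le_envelope:
  assumes "admissible a" "admissible b" "s \<ge> 0" "\<alpha> \<ge> 0" "\<beta> \<ge> 0"
    and a: "\<And>q. norm (a k s q) \<le> \<alpha> * envelope q" and b: "\<And>q. norm (b j s q) \<le> \<beta> * envelope q"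
  shows "norm (conv (a k s) (b j s) \<xi>) \<le> conv_const 4 * \<alpha> * \<beta> * weight 1 4 \<xi>"
  using assms by (intro conv_bound admissible_meas1) (auto simp: envelope_def)

text \<open>The kernel contributes \<open>|\<xi>|\<close>, the convolution of two envelopes \<open>|\<xi>|\<close> times the
  envelope, and the heat kernel returns \<open>1/|\<xi>|\<^sup>2\<close>.\<close>

lemma bilin_le_envelope:
  assumes ab: "admissible a" "admissible b" and t: "t \<ge> 0" and lam: "lam \<ge> 0" and n: "\<alpha> \<ge> 0" "\<beta> \<ge> 0"
    and a: "\<And>l s \<xi>. s \<ge> 0 \<Longrightarrow> norm (a l s \<xi>) \<le> \<alpha> * envelope \<xi>"
    and b: "\<And>l s \<xi>. s \<ge> 0 \<Longrightarrow> norm (b l s \<xi>) \<le> \<beta> * growth lam s * envelope \<xi>"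
  shows "norm (bilin a b l t \<xi>) \<le> 9 * conv_const 4 * \<alpha> * \<beta> * growth lam t * envelope \<xi>"
    and "norm (bilin b a l t \<xi>) \<le> 9 * conv_const 4 * \<alpha> * \<beta> * growth lam t * envelope \<xi>"
proof -
  have "norm (bilin a b l t \<xi>) \<le> 9 * (conv_const 4 * \<alpha> * \<beta>) * growth lam t * envelope \<xi>"
  proof (rule bilin_le[OF ab t lam])
    fix k j s assume s: "0 \<le> s" "s \<le> t"
    have "norm (conv (a k s) (b j s) \<xi>) \<le> conv_const 4 * \<alpha> * (\<beta> * growth lam s) * weight 1 4 \<xi>"
      using s n a b by (intro conv_le_envelope ab) auto
    thus "norm (conv (a k s) (b j s) \<xi>) \<le> conv_const 4 * \<alpha> * \<beta> * weight 1 4 \<xi> * growth lam s" by (simp add: mult_ac)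
  qed (use n conv_const_nonneg in auto)
  thus "norm (bilin a b l t \<xi>) \<le> 9 * conv_const 4 * \<alpha> * \<beta> * growth lam t * envelope \<xi>" by (simp add: mult_ac)
  have "norm (bilin b a l t \<xi>) \<le> 9 * (conv_const 4 * \<alpha> * \<beta>) * growth lam t * envelope \<xi>"
  proof (rule bilin_le[OF ab(2,1) t lam])
    fix k j s assume s: "0 \<le> s" "s \<le> t"
    have "norm (conv (b k s) (a j s) \<xi>) \<le> conv_const 4 * (\<beta> * growth lam s) * \<alpha> * weight 1 4 \<xi>"
      using s n a b by (intro conv_le_envelope ab) auto
    thus "norm (conv (b k s) (a j s) \<xi>) \<le> conv_const 4 * \<alpha> * \<beta> * weight 1 4 \<xi> * growth lam s" by (simp add: mult_ac)
  qed (use n conv_const_nonneg in auto)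
  thus "norm (bilin b a l t \<xi>) \<le> 9 * conv_const 4 * \<alpha> * \<beta> * growth lam t * envelope \<xi>" by (simp add: mult_ac)
qed

lemma admissible_bilin: assumes "admissible a" "admissible b" shows "admissible (bilin a b)"
proof -
  obtain C where C: "C \<ge> 0" "\<And>l t \<xi>. t \<ge> 0 \<Longrightarrow> norm (a l t \<xi>) \<le> C * envelope \<xi>" using assms(1) by (rule admissible_bound) auto
  obtain D where D: "D \<ge> 0" "\<And>l t \<xi>. t \<ge> 0 \<Longrightarrow> norm (b l t \<xi>) \<le> D * envelope \<xi>" using assms(2) by (rule admissible_bound) auto
  have "norm (bilin a b l t \<xi>) \<le> 9 * conv_const 4 * C * D * growth 0 t * envelope \<xi>" if "t \<ge> 0" for l t \<xi>
    by (rule bilin_le_envelope(1)[OF assms that]) (use C D in \<open>auto simp: growth_zero\<close>)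
  hence "\<exists>C\<ge>0. \<forall>l t \<xi>. t \<ge> 0 \<longrightarrow> norm (bilin a b l t \<xi>) \<le> C * envelope \<xi>"
    using C(1) D(1) conv_const_nonneg[of 4] by (intro exI[of _ "9 * conv_const 4 * C * D"]) (auto simp: growth_zero)
  thus ?thesis unfolding admissible_def using bilin_measurable[OF assms] bilin_cont[OF assms] by auto
qed

lemma bilin_split:
  assumes admissible: "admissible a" "admissible b" "admissible a'" "admissible b'"
    and eq: "\<And>s. s \<ge> 0 \<Longrightarrow> nonlin c d l \<xi> s = nonlin a b l \<xi> s + nonlin a' b' l \<xi> s"
  shows "bilin c d l t \<xi> = bilin a b l t \<xi> + bilin a' b' l t \<xi>"
proof -
  define e where "e s = complex_of_real (exp (- (norm \<xi>)\<^sup>2 * (t - s)))" for s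
  have "bilin c d l t \<xi> = (LINT s:{0..t}|lborel. e s * nonlin a b l \<xi> s + e s * nonlin a' b' l \<xi> s)"
    unfolding bilin_def duhamel_def e_def by (intro set_lebesgue_integral_cong) (auto simp: ring_distribs eq)
  also have "\<dots> = bilin a b l t \<xi> + bilin a' b' l t \<xi>"
    unfolding bilin_def duhamel_def e_def by (intro set_integral_add duhamel_integrable nonlin_cont admissible)
  finally show ?thesis .
qed

lemma bilin_add_left:
  assumes "admissible a" "admissible a'" "admissible b"
  shows "bilin (\<lambda>l t \<xi>. a l t \<xi> + a' l t \<xi>) b l t \<xi> = bilin a b l t \<xi> + bilin a' b l t \<xi>"
proof (rule bilin_split[OF assms(1,3,2,3)])
  fix s :: real assume s: "s \<ge> 0"
  have "conv (\<lambda>x. a k s x + a' k s x) (b j s) \<xi> = conv (a k s) (b j s) \<xi> + conv (a' k s) (b j s) \<xi>" for k j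
    unfolding conv_def using admissible_conv_integrable assms s
    by (subst Bochner_Integration.integral_add[symmetric]) (auto simp: algebra_simps)
  thus "nonlin (\<lambda>l t \<xi>. a l t \<xi> + a' l t \<xi>) b l \<xi> s = nonlin a b l \<xi> s + nonlin a' b l \<xi> s"
    unfolding nonlin_def by (simp add: sum.distrib ring_distribs)
qed

lemma bilin_add_right:
  assumes "admissible a" "admissible b" "admissible b'"
  shows "bilin a (\<lambda>l t \<xi>. b l t \<xi> + b' l t \<xi>) l t \<xi> = bilin a b l t \<xi> + bilin a b' l t \<xi>"
proof (rule bilin_split[OF assms(1,2,1,3)])
  fix s :: real assume s: "s \<ge> 0"
  have "conv (a k s) (\<lambda>x. b j s x + b' j s x) \<xi> = conv (a k s) (b j s) \<xi> + conv (a k s) (b' j s) \<xi>" for k j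
    unfolding conv_def using admissible_conv_integrable assms s
    by (subst Bochner_Integration.integral_add[symmetric]) (auto simp: algebra_simps)
  thus "nonlin a (\<lambda>l t \<xi>. b l t \<xi> + b' l t \<xi>) l \<xi> s = nonlin a b l \<xi> s + nonlin a b' l \<xi> s"
    unfolding nonlin_def by (simp add: sum.distrib ring_distribs)
qed

lemma bilin_diff:
  assumes "admissible a" "admissible b"
  shows "bilin a a l t \<xi> - bilin b b l t \<xi> = bilin (\<lambda>l t \<xi>. a l t \<xi> - b l t \<xi>) a l t \<xi> + bilin b (\<lambda>l t \<xi>. a l t \<xi> - b l t \<xi>) l t \<xi>"
proof -
  define d where "d l t \<xi> = a l t \<xi> - b l t \<xi>" for l t \<xi>
  have d: "admissible d" unfolding d_def by (intro admissible_minus assms)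
  have "bilin a a l t \<xi> = bilin d a l t \<xi> + bilin b a l t \<xi>" using bilin_add_left[OF d assms(2,1)] by (simp add: d_def)
  moreover have "bilin b a l t \<xi> = bilin b d l t \<xi> + bilin b b l t \<xi>" using bilin_add_right[OF assms(2) d assms(2)] by (simp add: d_def)
  ultimately show ?thesis unfolding d_def by simp
qed

end

section \<open>Picard iteration around an approximate solution\<close>

context borel_kernels begin

text \<open>Iterate \<open>u \<mapsto> v + B(u, u)\<close> from \<open>a0\<close>. All iterates stay within twice the
  residual of \<open>a0\<close>; near \<open>a0\<close> the map contracts by one half, namely by \<open>1/8\<close>
  for each side of \<open>a0\<close> and by \<open>1/8\<close> for each side of the deviation from \<open>a0\<close>.
  The smallness condition contains \<open>exp lam\<close> because one of the two factors has to be measured without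
  the time weight.\<close>

lemma picard:
  fixes v a0 :: fourier_field
  assumes admissible: "admissible v" "admissible a0" and lam: "lam \<ge> 0" and eps: "eps \<ge> 0"
    and T: "\<And>d \<beta> l t \<xi>. admissible d \<Longrightarrow> \<beta> \<ge> 0 \<Longrightarrow> (\<And>l s \<xi>. s \<ge> 0 \<Longrightarrow> norm (d l s \<xi>) \<le> \<beta> * growth lam s * envelope \<xi>) \<Longrightarrow> t \<ge> 0 \<Longrightarrow>
        norm (bilin a0 d l t \<xi>) \<le> \<beta> / 8 * growth lam t * envelope \<xi> \<and> norm (bilin d a0 l t \<xi>) \<le> \<beta> / 8 * growth lam t * envelope \<xi>"
    and R: "\<And>l t \<xi>. t \<ge> 0 \<Longrightarrow> norm (v l t \<xi> + bilin a0 a0 l t \<xi> - a0 l t \<xi>) \<le> eps * growth lam t * envelope \<xi>"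
    and small: "9 * conv_const 4 * (2 * eps * exp lam) \<le> 1 / 8"
  shows "\<exists>u. admissible u \<and> (\<forall>l t \<xi>. t \<ge> 0 \<longrightarrow> u l t \<xi> = v l t \<xi> + bilin u u l t \<xi>)"
proof -
  \<comment> \<open>Within twice the residual of \<open>a0\<close>, multiplication by \<open>x\<close> on either side has norm at most \<open>1/4\<close>.\<close>
  have quarter: "norm (bilin x d l t \<xi>) \<le> \<beta> / 4 * growth lam t * envelope \<xi>" "norm (bilin d x l t \<xi>) \<le> \<beta> / 4 * growth lam t * envelope \<xi>"
    if x: "admissible x" and xa: "\<And>l s \<xi>. s \<ge> 0 \<Longrightarrow> norm (x l s \<xi> - a0 l s \<xi>) \<le> 2 * eps * growth lam s * envelope \<xi>"
      and d: "admissible d" and \<beta>: "\<beta> \<ge> 0" and db: "\<And>l s \<xi>. s \<ge> 0 \<Longrightarrow> norm (d l s \<xi>) \<le> \<beta> * growth lam s * envelope \<xi>"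
      and t: "t \<ge> 0" for x d \<beta> l t \<xi>
  proof -
    define y where "y l t \<xi> = x l t \<xi> - a0 l t \<xi>" for l t \<xi>
    have y: "admissible y" unfolding y_def by (intro admissible_minus x admissible)
    have yb: "norm (y l s \<xi>) \<le> (2 * eps * exp lam) * envelope \<xi>" if "s \<ge> 0" for l s \<xi>
    proof -
      have "2 * eps * growth lam s * envelope \<xi> \<le> 2 * eps * exp lam * envelope \<xi>"
        using eps growth_le[OF lam] by (intro mult_right_mono mult_left_mono) auto
      thus ?thesis using xa[OF that, of l \<xi>] by (simp add: y_def)
    qed
    have c: "9 * conv_const 4 * (2 * eps * exp lam) * \<beta> * growth lam t * envelope \<xi> \<le> 1 / 8 * \<beta> * growth lam t * envelope \<xi>"
      using \<beta> by (intro mult_right_mono small) auto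
    have x_eq: "x = (\<lambda>l t \<xi>. a0 l t \<xi> + y l t \<xi>)" by (simp add: y_def)
    have "norm (bilin x d l t \<xi>) \<le> norm (bilin a0 d l t \<xi>) + norm (bilin y d l t \<xi>)"
      unfolding x_eq using bilin_add_left[OF admissible(2) y d] norm_triangle_ineq by metis
    also have "norm (bilin a0 d l t \<xi>) \<le> \<beta> / 8 * growth lam t * envelope \<xi>" using T[OF d \<beta> db t] by blast
    also have "norm (bilin y d l t \<xi>) \<le> 9 * conv_const 4 * (2 * eps * exp lam) * \<beta> * growth lam t * envelope \<xi>"
      by (rule bilin_le_envelope(1)[OF y d t lam _ \<beta> yb db]) (use eps in auto)
    finally show "norm (bilin x d l t \<xi>) \<le> \<beta> / 4 * growth lam t * envelope \<xi>" using c by (simp add: field_simps)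
    have "norm (bilin d x l t \<xi>) \<le> norm (bilin d a0 l t \<xi>) + norm (bilin d y l t \<xi>)"
      unfolding x_eq using bilin_add_right[OF d admissible(2) y] norm_triangle_ineq by metis
    also have "norm (bilin d a0 l t \<xi>) \<le> \<beta> / 8 * growth lam t * envelope \<xi>" using T[OF d \<beta> db t] by blast
    also have "norm (bilin d y l t \<xi>) \<le> 9 * conv_const 4 * (2 * eps * exp lam) * \<beta> * growth lam t * envelope \<xi>"
      by (rule bilin_le_envelope(2)[OF y d t lam _ \<beta> yb db]) (use eps in auto)
    finally show "norm (bilin d x l t \<xi>) \<le> \<beta> / 4 * growth lam t * envelope \<xi>" using c by (simp add: field_simps)
  qed
  have contr: "norm (bilin x x l t \<xi> - bilin y y l t \<xi>) \<le> \<beta> / 2 * growth lam t * envelope \<xi>"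
    if x: "admissible x" "\<And>l s \<xi>. s \<ge> 0 \<Longrightarrow> norm (x l s \<xi> - a0 l s \<xi>) \<le> 2 * eps * growth lam s * envelope \<xi>"
      and y: "admissible y" "\<And>l s \<xi>. s \<ge> 0 \<Longrightarrow> norm (y l s \<xi> - a0 l s \<xi>) \<le> 2 * eps * growth lam s * envelope \<xi>"
      and \<beta>: "\<beta> \<ge> 0" and d: "\<And>l s \<xi>. s \<ge> 0 \<Longrightarrow> norm (x l s \<xi> - y l s \<xi>) \<le> \<beta> * growth lam s * envelope \<xi>"
      and t: "t \<ge> 0" for x y \<beta> l t \<xi>
  proof -
    have dd: "admissible (\<lambda>l t \<xi>. x l t \<xi> - y l t \<xi>)" by (intro admissible_minus x y)
    have "norm (bilin x x l t \<xi> - bilin y y l t \<xi>)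
        \<le> norm (bilin (\<lambda>l t \<xi>. x l t \<xi> - y l t \<xi>) x l t \<xi>) + norm (bilin y (\<lambda>l t \<xi>. x l t \<xi> - y l t \<xi>) l t \<xi>)"
      unfolding bilin_diff[OF x(1) y(1)] by (rule norm_triangle_ineq)
    also have "\<dots> \<le> \<beta> / 4 * growth lam t * envelope \<xi> + \<beta> / 4 * growth lam t * envelope \<xi>"
      by (intro add_mono quarter dd x y \<beta> t d)
    finally show ?thesis by (simp add: field_simps)
  qed
  define U where "U n = ((\<lambda>u l t \<xi>. v l t \<xi> + bilin u u l t \<xi>) ^^ n) a0" for n
  have U0: "U 0 = a0" and US: "U (Suc n) = (\<lambda>l t \<xi>. v l t \<xi> + bilin (U n) (U n) l t \<xi>)" for n by (simp_all add: U_def)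
  have U_admissible: "admissible (U n)" for n
    by (induction n) (auto simp: U0 US admissible intro!: admissible_add admissible_bilin)
  have main: "(\<forall>l t \<xi>. t \<ge> 0 \<longrightarrow> norm (U (Suc n) l t \<xi> - U n l t \<xi>) \<le> eps * (1/2)^n * growth lam t * envelope \<xi>) \<and>
     (\<forall>l t \<xi>. t \<ge> 0 \<longrightarrow> norm (U n l t \<xi> - a0 l t \<xi>) \<le> 2 * eps * (1 - (1/2)^n) * growth lam t * envelope \<xi>) \<and>
     (\<forall>l t \<xi>. t \<ge> 0 \<longrightarrow> norm (U (Suc n) l t \<xi> - a0 l t \<xi>) \<le> 2 * eps * (1 - (1/2)^Suc n) * growth lam t * envelope \<xi>)" for n
  proof (induction n)
    case 0
    show ?case using R by (auto simp: U0 US[of 0])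
  next
    case (Suc n)
    have le: "2 * eps * (1 - (1/2)^m) * growth lam t * envelope \<xi> \<le> 2 * eps * growth lam t * envelope \<xi>" for m t \<xi>
      using eps by (intro mult_right_mono) (auto simp: mult_left_le)
    have near: "norm (U m l t \<xi> - a0 l t \<xi>) \<le> 2 * eps * growth lam t * envelope \<xi>" if "t \<ge> 0" "m = n \<or> m = Suc n" for l t \<xi> m
      using Suc that le[of m t \<xi>] order_trans by blast
    have 1: "norm (U (Suc (Suc n)) l t \<xi> - U (Suc n) l t \<xi>) \<le> eps * (1/2)^Suc n * growth lam t * envelope \<xi>" if "t \<ge> 0" for l t \<xi>
    proof -
      have "norm (U (Suc (Suc n)) l t \<xi> - U (Suc n) l t \<xi>) = norm (bilin (U (Suc n)) (U (Suc n)) l t \<xi> - bilin (U n) (U n) l t \<xi>)"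
        by (simp add: US[of "Suc n"]) (simp add: US[of n])
      also have "\<dots> \<le> eps * (1/2)^n / 2 * growth lam t * envelope \<xi>"
        using Suc eps that near by (intro contr U_admissible) auto
      finally show ?thesis by simp
    qed
    have "norm (U (Suc (Suc n)) l t \<xi> - a0 l t \<xi>) \<le> 2 * eps * (1 - (1/2)^Suc (Suc n)) * growth lam t * envelope \<xi>" if "t \<ge> 0" for l t \<xi>
    proof -
      have "norm (U (Suc (Suc n)) l t \<xi> - a0 l t \<xi>) \<le> norm (U (Suc (Suc n)) l t \<xi> - U (Suc n) l t \<xi>) + norm (U (Suc n) l t \<xi> - a0 l t \<xi>)"
        using norm_triangle_ineq[of "U (Suc (Suc n)) l t \<xi> - U (Suc n) l t \<xi>" "U (Suc n) l t \<xi> - a0 l t \<xi>"] by simp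
      also have "\<dots> \<le> eps * (1/2)^Suc n * growth lam t * envelope \<xi> + 2 * eps * (1 - (1/2)^Suc n) * growth lam t * envelope \<xi>"
        using Suc 1 that by (intro add_mono) auto
      also have "\<dots> = 2 * eps * (1 - (1/2)^Suc (Suc n)) * growth lam t * envelope \<xi>" by (simp add: field_simps)
      finally show ?thesis .
    qed
    thus ?case using Suc 1 by blast
  qed
  \<comment> \<open>The limit is the telescoping series of the increments, which converges geometrically.\<close>
  define dd where "dd n l t \<xi> = U (Suc n) l t \<xi> - U n l t \<xi>" for n l t \<xi>
  define u where "u l t \<xi> = a0 l t \<xi> + (\<Sum>n. dd n l t \<xi>)" for l t \<xi>
  have dle: "norm (dd n l t \<xi>) \<le> eps * growth lam t * envelope \<xi> * (1/2)^n" if "t \<ge> 0" for n l t \<xi>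
    using main[of n] that by (simp add: dd_def mult_ac)
  have geo: "summable (\<lambda>n. C * (1/2::real)^n)" for C by (intro summable_mult summable_geometric) auto
  have dsum: "summable (\<lambda>n. dd n l t \<xi>)" if "t \<ge> 0" for l t \<xi>
    by (rule summable_comparison_test'[OF geo dle[OF that]])
  have part: "(\<Sum>i<n. dd i l t \<xi>) = U n l t \<xi> - a0 l t \<xi>" for n l t \<xi>
    by (induction n) (auto simp: dd_def U0)
  have close: "norm (u l t \<xi> - U n l t \<xi>) \<le> 2 * eps * (1/2)^n * growth lam t * envelope \<xi>" if t: "t \<ge> 0" for n l t \<xi>
  proof -
    have "u l t \<xi> - U n l t \<xi> = (\<Sum>i. dd (i + n) l t \<xi>)"
      unfolding suminf_minus_initial_segment[OF dsum[OF t]] part by (simp add: u_def)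
    also have "norm \<dots> \<le> (\<Sum>i. (eps * growth lam t * envelope \<xi> * (1/2)^n) * (1/2)^i)"
    proof (intro norm_suminf_le geo)
      fix i show "norm (dd (i + n) l t \<xi>) \<le> (eps * growth lam t * envelope \<xi> * (1/2)^n) * (1/2)^i"
        using dle[OF t, of "i + n" l \<xi>] by (simp add: power_add mult_ac)
    qed
    also have "\<dots> = 2 * eps * (1/2)^n * growth lam t * envelope \<xi>"
      by (subst suminf_mult) (auto simp: suminf_geometric)
    finally show ?thesis .
  qed
  have close0: "norm (u l t \<xi> - a0 l t \<xi>) \<le> 2 * eps * growth lam t * envelope \<xi>" if "t \<ge> 0" for l t \<xi>
    using close[OF that, of l \<xi> 0] by (simp add: U0)
  have dd_admissible: "admissible (dd n)" for n unfolding dd_def by (intro admissible_minus U_admissible)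
  have u_admissible: "admissible u" unfolding admissible_def
  proof (intro conjI allI)
    show "(\<lambda>x. u l (fst x) (snd x)) \<in> borel_measurable (borel \<Otimes>\<^sub>M borel)" for l
      unfolding u_def by (intro borel_measurable_add borel_measurable_suminf admissible_measurable[OF admissible(2)] admissible_measurable[OF dd_admissible]) auto
    show "continuous_on {0..} (\<lambda>t. u l t \<xi>)" for l \<xi>
    proof (rule uniform_limit_theorem)
      show "\<forall>\<^sub>F n in sequentially. continuous_on {0..} (\<lambda>t. U n l t \<xi>)" by (intro always_eventually allI admissible_cont U_admissible)
      show "uniform_limit {0..} (\<lambda>n t. U n l t \<xi>) (\<lambda>t. u l t \<xi>) sequentially"
      proof (rule uniform_limitI)
        fix e :: real assume e: "e > 0"
        have "(\<lambda>n. 2 * eps * (1/2)^n * exp lam * envelope \<xi>) \<longlonglongrightarrow> 2 * eps * 0 * exp lam * envelope \<xi>"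
          by (intro tendsto_intros LIMSEQ_power_zero) auto
        hence "\<forall>\<^sub>F n in sequentially. 2 * eps * (1/2)^n * exp lam * envelope \<xi> < e" using e by (intro order_tendstoD) auto
        thus "\<forall>\<^sub>F n in sequentially. \<forall>t\<in>{0..}. dist (U n l t \<xi>) (u l t \<xi>) < e"
        proof eventually_elim
          case (elim n)
          show ?case
          proof
            fix t :: real assume "t \<in> {0..}"
            hence "dist (U n l t \<xi>) (u l t \<xi>) \<le> 2 * eps * (1/2)^n * growth lam t * envelope \<xi>"
              using close[of t l \<xi> n] by (simp add: dist_norm norm_minus_commute)
            also have "\<dots> \<le> 2 * eps * (1/2)^n * exp lam * envelope \<xi>"
              using eps growth_le[OF lam] by (intro mult_right_mono mult_left_mono) auto
            finally show "dist (U n l t \<xi>) (u l t \<xi>) < e" using elim by simp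
          qed
        qed
      qed
    qed simp
    obtain C where C: "C \<ge> 0" "\<And>l t \<xi>. t \<ge> 0 \<Longrightarrow> norm (a0 l t \<xi>) \<le> C * envelope \<xi>" using admissible(2) by (rule admissible_bound) auto
    have "norm (u l t \<xi>) \<le> (C + 2 * eps * exp lam) * envelope \<xi>" if "t \<ge> 0" for l t \<xi>
    proof -
      have "norm (u l t \<xi>) \<le> norm (a0 l t \<xi>) + norm (u l t \<xi> - a0 l t \<xi>)" by (rule norm_triangle_sub)
      also have "\<dots> \<le> C * envelope \<xi> + 2 * eps * growth lam t * envelope \<xi>" by (intro add_mono C close0 that)
      also have "\<dots> \<le> C * envelope \<xi> + 2 * eps * exp lam * envelope \<xi>"
        using eps growth_le[OF lam] by (intro add_left_mono mult_right_mono mult_left_mono) auto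
      finally show ?thesis by (simp add: algebra_simps)
    qed
    thus "\<exists>C\<ge>0. \<forall>l t \<xi>. t \<ge> 0 \<longrightarrow> norm (u l t \<xi>) \<le> C * envelope \<xi>"
      using C(1) eps by (intro exI[of _ "C + 2 * eps * exp lam"]) auto
  qed
  have "u l t \<xi> = v l t \<xi> + bilin u u l t \<xi>" if t: "t \<ge> 0" for l t \<xi>
  proof -
    have near: "norm (U n l t \<xi> - a0 l t \<xi>) \<le> 2 * eps * growth lam t * envelope \<xi>" if "t \<ge> 0" for n l t \<xi>
    proof -
      have "2 * eps * (1 - (1/2)^n) * growth lam t * envelope \<xi> \<le> 2 * eps * growth lam t * envelope \<xi>"
        using eps by (intro mult_right_mono) (auto simp: mult_left_le)
      thus ?thesis using main[of n] that order_trans by blast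
    qed
    have bd: "norm (v l t \<xi> + bilin u u l t \<xi> - u l t \<xi>) \<le> (3 * eps * growth lam t * envelope \<xi>) * (1/2)^n" for n
    proof -
      have "v l t \<xi> + bilin u u l t \<xi> - u l t \<xi> = (bilin u u l t \<xi> - bilin (U n) (U n) l t \<xi>) - (u l t \<xi> - U (Suc n) l t \<xi>)"
        by (simp add: US)
      also have "norm \<dots> \<le> norm (bilin u u l t \<xi> - bilin (U n) (U n) l t \<xi>) + norm (u l t \<xi> - U (Suc n) l t \<xi>)"
        by (rule norm_triangle_ineq4)
      also have "\<dots> \<le> 2 * eps * (1/2)^n / 2 * growth lam t * envelope \<xi> + 2 * eps * (1/2)^Suc n * growth lam t * envelope \<xi>"
        using eps by (intro add_mono close t contr u_admissible U_admissible close0 near) auto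
      also have "\<dots> \<le> (3 * eps * growth lam t * envelope \<xi>) * (1/2)^n" using eps by (simp add: field_simps)
      finally show ?thesis .
    qed
    have "(\<lambda>n. (3 * eps * growth lam t * envelope \<xi>) * (1/2)^n) \<longlonglongrightarrow> (3 * eps * growth lam t * envelope \<xi>) * 0"
      by (intro tendsto_intros LIMSEQ_power_zero) auto
    hence "norm (v l t \<xi> + bilin u u l t \<xi> - u l t \<xi>) \<le> (3 * eps * growth lam t * envelope \<xi>) * 0"
      by (rule LIMSEQ_le_const) (use bd in blast)
    thus ?thesis by simp
  qed
  thus ?thesis using u_admissible by blast
qed

end

section \<open>Data supported in a frequency shell\<close>

definition shift_const :: real where "shift_const = exp 8 * 9^4"
definition shell_const :: real where "shell_const = 4 * (exp 4 * 5^4)"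
definition pot_const :: real where "pot_const = 8 * 8^3 + 4 * inv_sq_mass"

lemma consts_pos: "shift_const > 0" "shell_const > 0" "pot_const > 0"
  using inv_sq_mass_nonneg by (auto simp: shift_const_def shell_const_def pot_const_def add_pos_nonneg)

text \<open>For \<open>|q| \<le> 8\<close> the numerator of the envelope at \<open>\<xi> - q\<close> is at most a constant
  times its value at \<open>\<xi>\<close>, so only the singular factor \<open>1/|\<xi> - q|\<close> stays under the
  integral.\<close>

lemma conv_potential:
  fixes F :: "real^3 \<Rightarrow> real" and f g :: "real^3 \<Rightarrow> complex"
  assumes [measurable]: "f \<in> borel_measurable borel" "g \<in> borel_measurable borel"
    and f: "\<And>q. norm (f q) \<le> \<tau> * F q" and g: "\<And>q. norm (g q) \<le> \<beta> * envelope q" and \<tau>: "\<tau> \<ge> 0" and \<beta>: "\<beta> \<ge> 0"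
    and F0: "\<And>q. F q \<ge> 0" and supp: "\<And>q. norm q > 8 \<Longrightarrow> F q = 0"
    and int: "integrable lborel (\<lambda>q. F q / norm (\<xi> - q))"
  shows "norm (conv f g \<xi>) \<le> \<tau> * \<beta> * shift_const * weight 1 4 \<xi> * (LINT q|lborel. F q / norm (\<xi> - q))"
    and "norm (conv g f \<xi>) \<le> \<tau> * \<beta> * shift_const * weight 1 4 \<xi> * (LINT q|lborel. F q / norm (\<xi> - q))"
proof -
  have bd: "norm (f q * g (\<xi> - q)) \<le> \<tau> * \<beta> * shift_const * weight 1 4 \<xi> * (F q / norm (\<xi> - q))" for q
  proof (cases "norm q \<le> 8")
    case True
    have "norm (f q * g (\<xi> - q)) \<le> (\<tau> * F q) * (\<beta> * envelope (\<xi> - q))" unfolding norm_mult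
      by (intro mult_mono f g) (auto simp: F0 \<tau>)
    also have "envelope (\<xi> - q) \<le> shift_const * weight 1 4 \<xi> / norm (\<xi> - q)"
      unfolding envelope_def shift_const_def by (intro divide_right_mono weight_shift True) auto
    hence "(\<tau> * F q) * (\<beta> * envelope (\<xi> - q)) \<le> (\<tau> * F q) * (\<beta> * (shift_const * weight 1 4 \<xi> / norm (\<xi> - q)))"
      using \<tau> \<beta> F0 by (intro mult_left_mono) auto
    finally show ?thesis by (simp add: mult_ac)
  next
    case False
    hence "f q = 0" using f[of q] supp[of q] by simp
    thus ?thesis using supp[of q] False by simp
  qed
  have i2: "integrable lborel (\<lambda>q. \<tau> * \<beta> * shift_const * weight 1 4 \<xi> * (F q / norm (\<xi> - q)))"
    by (intro integrable_mult_right int)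
  have "norm (conv f g \<xi>) \<le> (LINT q|lborel. \<tau> * \<beta> * shift_const * weight 1 4 \<xi> * (F q / norm (\<xi> - q)))"
    unfolding conv_def by (rule norm_integral_dominated[OF i2 _ bd]) measurable
  thus 1: "norm (conv f g \<xi>) \<le> \<tau> * \<beta> * shift_const * weight 1 4 \<xi> * (LINT q|lborel. F q / norm (\<xi> - q))"
    by (simp only: integral_mult_right_zero)
  thus "norm (conv g f \<xi>) \<le> \<tau> * \<beta> * shift_const * weight 1 4 \<xi> * (LINT q|lborel. F q / norm (\<xi> - q))"
    using conv_commute[of g f \<xi>] by simp
qed

lemma measure_cball8: "measure lborel (cball (0::real^3) 8) \<le> 8 * 8^3"
proof -
  have "emeasure lborel (cball (0::real^3) 8) \<le> ennreal (8 * 8^3)" by (rule emeasure_cball_le) simp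
  thus ?thesis unfolding measure_def by (intro enn2real_leI) auto
qed

text \<open>The decay \<open>1/|\<xi>|\<close> follows from
  \<open>|\<xi>| / |\<xi> - q| \<le> 1 + 8 / |\<xi> - q|\<close> for \<open>|q| \<le> 8\<close>. It is
  the extra power of \<open>|\<xi>|\<close> that \<open>bilin_le_decay\<close> requires.\<close>

lemma ball_potential_decay:
  defines "F \<equiv> (indicator (cball 0 8) :: real^3 \<Rightarrow> real)"
  shows "integrable lborel (\<lambda>q. F q / norm (\<xi> - q))"
    and "norm \<xi> * (LINT q|lborel. F q / norm (\<xi> - q)) \<le> 17 * pot_const"
proof -
  have Fm: "F \<in> borel_measurable borel" unfolding F_def by (rule borel_measurable_indicator) simp
  have iF: "(LINT q|lborel. F q) \<le> 8 * 8^3" unfolding F_def using measure_cball8 by simp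
  have supp: "\<And>q. norm q > 8 \<Longrightarrow> F q = 0" by (simp add: F_def)
  note bp = ball_potential(1)[OF Fm _ _ supp iF, where B = 1 and \<eta> = 1]
    ball_potential(2,3)[OF Fm _ _ supp iF, where B = 1 and \<eta> = 1 and \<xi> = \<xi>]
  show i: "integrable lborel (\<lambda>q. F q / norm (\<xi> - q))" by (rule bp) (auto simp: F_def indicator_def)
  have i0: "integrable lborel F" by (rule bp) (auto simp: F_def indicator_def)
  have b: "(LINT q|lborel. F q / norm (\<xi> - q)) \<le> 2 * pot_const"
  proof -
    have "(LINT q|lborel. F q / norm (\<xi> - q)) \<le> 8*8^3/1 + 1 * 1 * (8 * 8^3 + 4 * inv_sq_mass)" by (rule bp) (auto simp: F_def indicator_def)
    thus ?thesis using inv_sq_mass_nonneg by (simp add: pot_const_def)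
  qed
  have "norm \<xi> * (LINT q|lborel. F q / norm (\<xi> - q)) = (LINT q|lborel. norm \<xi> * (F q / norm (\<xi> - q)))"
    by (simp only: integral_mult_right_zero)
  also have "\<dots> \<le> (LINT q|lborel. F q + 8 * (F q / norm (\<xi> - q)))"
  proof (rule integral_mono)
    fix q
    show "norm \<xi> * (F q / norm (\<xi> - q)) \<le> F q + 8 * (F q / norm (\<xi> - q))"
    proof (cases "norm q \<le> 8 \<and> \<xi> \<noteq> q")
      case True
      have "norm \<xi> \<le> norm (\<xi> - q) + 8" using True norm_triangle_ineq[of "\<xi> - q" q] by simp
      hence "norm \<xi> / norm (\<xi> - q) \<le> (norm (\<xi> - q) + 8) / norm (\<xi> - q)" by (intro divide_right_mono) auto
      thus ?thesis using True by (simp add: F_def add_divide_distrib)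
    qed (auto simp: F_def)
  qed (auto intro!: i i0 Bochner_Integration.integrable_add integrable_mult_right simp del: times_divide_eq_right)
  also have "\<dots> = (LINT q|lborel. F q) + 8 * (LINT q|lborel. F q / norm (\<xi> - q))"
    unfolding integral_mult_right_zero[symmetric]
    by (intro Bochner_Integration.integral_add i0 integrable_mult_right i)
  also have "\<dots> \<le> 17 * pot_const" using iF b inv_sq_mass_nonneg by (simp add: pot_const_def)
  finally show "norm \<xi> * (LINT q|lborel. F q / norm (\<xi> - q)) \<le> 17 * pot_const" .
qed

definition heat :: "(3 \<Rightarrow> real^3 \<Rightarrow> complex) \<Rightarrow> fourier_field" where
  "heat psi l t \<xi> = psi l \<xi> * complex_of_real (exp (- (norm \<xi>)\<^sup>2 * t))"

lemma shell_le_envelope: assumes "1 \<le> norm x" "norm x \<le> 4" shows "1 \<le> shell_const * envelope x"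
proof -
  have "exp (norm x) * (1 + norm x)^4 \<le> exp 4 * 5^4" using assms by (intro mult_mono power_mono) auto
  hence "norm x * (exp (norm x) * (1 + norm x)^4) \<le> 4 * (exp 4 * 5^4)" by (rule mult_mono[OF assms(2)]) auto
  moreover have Y: "norm x * (exp (norm x) * (1 + norm x)^4) > 0" using assms(1) by (intro mult_pos_pos) auto
  moreover have "shell_const * envelope x = 4 * (exp 4 * 5^4) / (norm x * (exp (norm x) * (1 + norm x)^4))"
    by (simp add: envelope_def weight_def shell_const_def exp_minus field_simps)
  ultimately show ?thesis by (simp only: le_divide_eq_1_pos[OF Y])
qed

locale shell_datum = borel_kernels +
  fixes psi :: "3 \<Rightarrow> real^3 \<Rightarrow> complex" and A :: real
  assumes psi_meas [measurable]: "\<And>l. psi l \<in> borel_measurable borel"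
    and psi_le: "\<And>l \<xi>. norm (psi l \<xi>) \<le> A"
    and psi_supp: "\<And>l \<xi>. psi l \<xi> \<noteq> 0 \<Longrightarrow> 1 \<le> norm \<xi> \<and> norm \<xi> \<le> 4"
    and A_ge1: "A \<ge> 1"
begin

abbreviation v :: fourier_field where "v \<equiv> heat psi"

lemma heat_le: "t \<ge> 0 \<Longrightarrow> norm (v l t \<xi>) \<le> A * exp (- t)"
proof (cases "psi l \<xi> = 0")
  case False
  assume t: "t \<ge> 0"
  have "1 \<le> (norm \<xi>)\<^sup>2" using psi_supp[OF False] by (simp add: one_le_power)
  hence "t \<le> (norm \<xi>)\<^sup>2 * t" using t by (simp add: mult_le_cancel_right1)
  hence "exp (- (norm \<xi>)\<^sup>2 * t) \<le> exp (- t)" by simp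
  thus ?thesis unfolding heat_def norm_mult using psi_le A_ge1 by (intro mult_mono) auto
qed (use A_ge1 in \<open>auto simp: heat_def\<close>)

lemma heat_supp: "v l t \<xi> \<noteq> 0 \<Longrightarrow> 1 \<le> norm \<xi> \<and> norm \<xi> \<le> 4"
  using psi_supp by (auto simp: heat_def)

lemma heat_le_envelope: assumes "t \<ge> 0" shows "norm (v l t \<xi>) \<le> A * shell_const * envelope \<xi>"
proof (cases "v l t \<xi> = 0")
  case False
  have "exp (- t) \<le> 1" using assms by simp
  hence "A * exp (- t) \<le> A * 1" using A_ge1 by (intro mult_left_mono) auto
  hence "norm (v l t \<xi>) \<le> A * 1" using heat_le[OF assms, of l \<xi>] by simp
  also have "\<dots> \<le> A * (shell_const * envelope \<xi>)" using heat_supp[OF False] shell_le_envelope A_ge1 by (intro mult_left_mono) auto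
  finally show ?thesis by simp
qed (use A_ge1 consts_pos in auto)

lemma admissible_heat: "admissible v" unfolding admissible_def
proof (intro conjI allI)
  show "(\<lambda>x. v l (fst x) (snd x)) \<in> borel_measurable (borel \<Otimes>\<^sub>M borel)" for l
    unfolding heat_def by measurable
  show "continuous_on {0..} (\<lambda>t. v l t \<xi>)" for l \<xi> unfolding heat_def by (intro continuous_intros)
  show "\<exists>C\<ge>0. \<forall>l t \<xi>. t \<ge> 0 \<longrightarrow> norm (v l t \<xi>) \<le> C * envelope \<xi>"
    using heat_le_envelope A_ge1 consts_pos by (intro exI[of _ "A * shell_const"]) auto
qed

text \<open>The large part of the linearized operator. It is tamed by \<open>lam\<close> alone, without any smallness of
  \<open>A\<close>.\<close>

lemma bilin_heat_le:
  assumes d: "admissible d" and \<beta>: "\<beta> \<ge> 0" and db: "\<And>l s \<xi>. s \<ge> 0 \<Longrightarrow> norm (d l s \<xi>) \<le> \<beta> * growth lam s * envelope \<xi>"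
    and lam: "lam > 0" and t: "t \<ge> 0"
  shows "norm (bilin v d l t \<xi>) \<le> 9 * (A * \<beta> * shift_const * (17 * pot_const)) / sqrt lam * growth lam t * envelope \<xi>"
    and "norm (bilin d v l t \<xi>) \<le> 9 * (A * \<beta> * shift_const * (17 * pot_const)) / sqrt lam * growth lam t * envelope \<xi>"
proof -
  define n where "n = A * \<beta> * shift_const * (17 * pot_const)"
  have n0: "n \<ge> 0" unfolding n_def using A_ge1 \<beta> consts_pos by simp
  have c: "norm \<xi> * norm (conv (v k s) (d j s) \<xi>) \<le> n * weight 1 4 \<xi> * exp (- s) * growth lam s \<and>
           norm \<xi> * norm (conv (d k s) (v j s) \<xi>) \<le> n * weight 1 4 \<xi> * exp (- s) * growth lam s" if s: "s \<ge> 0" for k j s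
  proof -
    define F where "F = (indicator (cball 0 8) :: real^3 \<Rightarrow> real)"
    define J where "J = (LINT q|lborel. F q / norm (\<xi> - q))"
    have vF: "norm (v k s q) \<le> (A * exp (-s)) * F q" for k q
      using heat_le[OF s, of k q] heat_supp[of k s q] unfolding F_def by (cases "v k s q = 0") (auto simp: indicator_def)
    have Jn: "norm \<xi> * J \<le> 17 * pot_const" unfolding J_def F_def by (rule ball_potential_decay)
    have *: "norm \<xi> * ((A * exp (-s)) * (\<beta> * growth lam s) * shift_const * weight 1 4 \<xi> * J) \<le> n * weight 1 4 \<xi> * exp (- s) * growth lam s"
    proof -
      have "norm \<xi> * ((A * exp (-s)) * (\<beta> * growth lam s) * shift_const * weight 1 4 \<xi> * J)
         = ((A * exp (-s)) * (\<beta> * growth lam s) * shift_const * weight 1 4 \<xi>) * (norm \<xi> * J)" by simp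
      also have "\<dots> \<le> ((A * exp (-s)) * (\<beta> * growth lam s) * shift_const * weight 1 4 \<xi>) * (17 * pot_const)"
        using A_ge1 \<beta> consts_pos by (intro mult_left_mono Jn) auto
      finally show ?thesis by (simp add: n_def mult_ac)
    qed
    have 1: "norm (conv (v k s) (d j s) \<xi>) \<le> (A * exp (-s)) * (\<beta> * growth lam s) * shift_const * weight 1 4 \<xi> * J"
      unfolding J_def using A_ge1 \<beta> db s ball_potential_decay(1)[of \<xi>]
      by (intro conv_potential admissible_meas1 admissible_heat d vF) (auto simp: F_def)
    have 2: "norm (conv (d k s) (v j s) \<xi>) \<le> (A * exp (-s)) * (\<beta> * growth lam s) * shift_const * weight 1 4 \<xi> * J"
      unfolding J_def using A_ge1 \<beta> db s ball_potential_decay(1)[of \<xi>]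
      by (intro conv_potential admissible_meas1 admissible_heat d vF) (auto simp: F_def)
    show ?thesis using order_trans[OF mult_left_mono[OF 1] *] order_trans[OF mult_left_mono[OF 2] *] by simp
  qed
  show "norm (bilin v d l t \<xi>) \<le> 9 * (A * \<beta> * shift_const * (17 * pot_const)) / sqrt lam * growth lam t * envelope \<xi>"
    unfolding n_def[symmetric] using c by (intro bilin_le_decay admissible_heat d t lam n0) auto
  show "norm (bilin d v l t \<xi>) \<le> 9 * (A * \<beta> * shift_const * (17 * pot_const)) / sqrt lam * growth lam t * envelope \<xi>"
    unfolding n_def[symmetric] using c by (intro bilin_le_decay admissible_heat d t lam n0) auto
qed

text \<open>The part of the linearized operator coming from the first iterate, with \<open>ball_potential\<close> used at
  \<open>\<eta> = sqrt \<delta>\<close>.\<close>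

lemma bilin_potential_le:
  assumes f: "admissible f" and d: "admissible d" and \<beta>: "\<beta> \<ge> 0"
    and db: "\<And>l s \<xi>. s \<ge> 0 \<Longrightarrow> norm (d l s \<xi>) \<le> \<beta> * growth lam s * envelope \<xi>"
    and lam: "lam \<ge> 0" and t: "t \<ge> 0"
    and fF: "\<And>l s q. s \<ge> 0 \<Longrightarrow> norm (f l s q) \<le> F q"
    and F[measurable]: "F \<in> borel_measurable borel" and FB: "\<And>q. F q \<le> B"
    and supp: "\<And>q. norm q > 8 \<Longrightarrow> F q = 0"
    and mass: "(LINT q|lborel. F q) \<le> \<delta>" and \<delta>: "\<delta> > 0"
  shows "norm (bilin f d l t \<xi>) \<le> 9 * (shift_const * sqrt \<delta> * (1 + B * pot_const) * \<beta>) * growth lam t * envelope \<xi>"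
    and "norm (bilin d f l t \<xi>) \<le> 9 * (shift_const * sqrt \<delta> * (1 + B * pot_const) * \<beta>) * growth lam t * envelope \<xi>"
proof -
  have F0: "F q \<ge> 0" for q using fF[of 0 1 q] order_trans[OF norm_ge_zero] by auto
  have B0: "B \<ge> 0" using F0[of 0] FB[of 0] by linarith
  define n where "n = shift_const * sqrt \<delta> * (1 + B * pot_const) * \<beta>"
  have n0: "n \<ge> 0" unfolding n_def using B0 \<beta> \<delta> consts_pos by simp
  have c: "norm (conv (f k s) (d j s) \<xi>) \<le> n * weight 1 4 \<xi> * growth lam s \<and>
           norm (conv (d k s) (f j s) \<xi>) \<le> n * weight 1 4 \<xi> * growth lam s" if s: "s \<ge> 0" for k j s
  proof -
    define J where "J = (LINT q|lborel. F q / norm (\<xi> - q))"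
    note bp = ball_potential(2,3)[OF F F0 FB supp mass, where \<eta> = "sqrt \<delta>" and \<xi> = \<xi>]
    have Ji: "integrable lborel (\<lambda>q. F q / norm (\<xi> - q))" using \<delta> by (intro bp) auto
    have "J \<le> \<delta> / sqrt \<delta> + sqrt \<delta> * B * (8 * 8^3 + 4 * inv_sq_mass)" unfolding J_def using \<delta> by (intro bp) auto
    hence J: "J \<le> sqrt \<delta> * (1 + B * pot_const)" using \<delta> by (simp add: pot_const_def algebra_simps real_div_sqrt)
    have *: "1 * (\<beta> * growth lam s) * shift_const * weight 1 4 \<xi> * J \<le> n * weight 1 4 \<xi> * growth lam s"
    proof -
      have "1 * (\<beta> * growth lam s) * shift_const * weight 1 4 \<xi> * J \<le> 1 * (\<beta> * growth lam s) * shift_const * weight 1 4 \<xi> * (sqrt \<delta> * (1 + B * pot_const))"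
        using \<beta> consts_pos by (intro mult_left_mono J) auto
      thus ?thesis by (simp add: n_def mult_ac)
    qed
    have fF1: "norm (f l s q) \<le> 1 * F q" for l q using fF[OF s] by simp
    have 1: "norm (conv (f k s) (d j s) \<xi>) \<le> 1 * (\<beta> * growth lam s) * shift_const * weight 1 4 \<xi> * J"
      unfolding J_def using \<beta> db s by (intro conv_potential admissible_meas1 f d fF1 F0 supp Ji) auto
    have 2: "norm (conv (d k s) (f j s) \<xi>) \<le> 1 * (\<beta> * growth lam s) * shift_const * weight 1 4 \<xi> * J"
      unfolding J_def using \<beta> db s by (intro conv_potential admissible_meas1 f d fF1 F0 supp Ji) auto
    show ?thesis using order_trans[OF 1 *] order_trans[OF 2 *] by simp
  qed
  show "norm (bilin f d l t \<xi>) \<le> 9 * (shift_const * sqrt \<delta> * (1 + B * pot_const) * \<beta>) * growth lam t * envelope \<xi>"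
    unfolding n_def[symmetric] using c by (intro bilin_le f d t lam n0) auto
  show "norm (bilin d f l t \<xi>) \<le> 9 * (shift_const * sqrt \<delta> * (1 + B * pot_const) * \<beta>) * growth lam t * envelope \<xi>"
    unfolding n_def[symmetric] using c by (intro bilin_le f d t lam n0) auto
qed

text \<open>The approximate solution is \<open>a0 = v + B(v, v)\<close>. Its residual is
  \<open>B(f, a0) + B(v, f)\<close> with \<open>f = B(v, v)\<close>, and every term contains \<open>f\<close>.\<close>

lemma global_field:
  assumes F[measurable]: "F \<in> borel_measurable borel" and FB: "\<And>q. F q \<le> B"
    and supp: "\<And>q. norm q > 8 \<Longrightarrow> F q = 0"
    and mass: "(LINT q|lborel. F q) \<le> \<delta>" and \<delta>: "\<delta> > 0"
    and fF: "\<And>l s q. s \<ge> 0 \<Longrightarrow> norm (bilin v v l s q) \<le> F q"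
    and lam: "lam > 0" "9 * (A * shift_const * (17 * pot_const)) / sqrt lam \<le> 1/16"
    and \<sigma>: "\<sigma> = 9 * (shift_const * sqrt \<delta> * (1 + B * pot_const))" "\<sigma> \<le> 1/16"
    and \<beta>: "\<beta> = A * shell_const + 9 * conv_const 4 * (A * shell_const) * (A * shell_const)"
    and small: "9 * conv_const 4 * (2 * (2 * \<sigma> * \<beta>) * exp lam) \<le> 1/8"
  shows "\<exists>u. admissible u \<and> (\<forall>l t \<xi>. t \<ge> 0 \<longrightarrow> u l t \<xi> = v l t \<xi> + bilin u u l t \<xi>)"
proof (rule picard)
  define f where "f = bilin v v"
  define a0 where "a0 l t \<xi> = v l t \<xi> + f l t \<xi>" for l t \<xi>
  have f: "admissible f" unfolding f_def by (intro admissible_bilin admissible_heat)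
  have a0: "admissible a0" unfolding a0_def by (intro admissible_add admissible_heat f)
  show "admissible v" "admissible a0" by (fact admissible_heat, fact a0)
  show l0: "lam \<ge> 0" using lam by simp
  have pos: "A * shell_const \<ge> 0" using A_ge1 consts_pos by simp
  have \<beta>0: "\<beta> \<ge> 0" unfolding \<beta> using pos conv_const_nonneg[of 4] by simp
  have F0: "F q \<ge> 0" for q using fF[of 0 1 q] order_trans[OF norm_ge_zero] by auto
  have B0: "B \<ge> 0" using F0[of 0] FB[of 0] by linarith
  have \<sigma>0: "\<sigma> \<ge> 0" unfolding \<sigma> using B0 \<delta> consts_pos by simp
  show "2 * \<sigma> * \<beta> \<ge> 0" using \<sigma>0 \<beta>0 by simp
  show "9 * conv_const 4 * (2 * (2 * \<sigma> * \<beta>) * exp lam) \<le> 1/8" by (fact small)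
  have fle: "norm (bilin f d l t \<xi>) \<le> \<sigma> * b * growth lam t * envelope \<xi> \<and> norm (bilin d f l t \<xi>) \<le> \<sigma> * b * growth lam t * envelope \<xi>"
    if "admissible d" "b \<ge> 0" "\<And>l s \<xi>. s \<ge> 0 \<Longrightarrow> norm (d l s \<xi>) \<le> b * growth lam s * envelope \<xi>" "t \<ge> 0" for d b l t \<xi>
    using bilin_potential_le[OF f that(1,2,3) l0 that(4) fF[folded f_def] F FB supp mass \<delta>, of l \<xi>] unfolding \<sigma> by (simp add: mult_ac)
  {
    fix d b l t \<xi> assume d: "admissible d" "b \<ge> 0" "\<And>l s \<xi>. s \<ge> 0 \<Longrightarrow> norm (d l s \<xi>) \<le> b * growth lam s * envelope \<xi>" "t \<ge> (0::real)"
    have vle: "norm (bilin v d l t \<xi>) \<le> 1/16 * (b * growth lam t * envelope \<xi>)" "norm (bilin d v l t \<xi>) \<le> 1/16 * (b * growth lam t * envelope \<xi>)"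
    proof -
      have "9 * (A * b * shift_const * (17 * pot_const)) / sqrt lam * growth lam t * envelope \<xi>
          = 9 * (A * shift_const * (17 * pot_const)) / sqrt lam * (b * growth lam t * envelope \<xi>)" by simp
      also have "\<dots> \<le> 1/16 * (b * growth lam t * envelope \<xi>)" using d(2) by (intro mult_right_mono lam) auto
      finally show "norm (bilin v d l t \<xi>) \<le> 1/16 * (b * growth lam t * envelope \<xi>)" "norm (bilin d v l t \<xi>) \<le> 1/16 * (b * growth lam t * envelope \<xi>)"
        using bilin_heat_le[OF d(1,2,3) lam(1) d(4), of l \<xi>] order_trans by blast+
    qed
    have fle2: "norm (bilin f d l t \<xi>) \<le> 1/16 * (b * growth lam t * envelope \<xi>)" "norm (bilin d f l t \<xi>) \<le> 1/16 * (b * growth lam t * envelope \<xi>)"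
      using fle[OF d, of l \<xi>] mult_right_mono[OF \<sigma>(2), of "b * growth lam t * envelope \<xi>"] d(2) by (auto simp: mult_ac)
    have "norm (bilin a0 d l t \<xi>) \<le> norm (bilin v d l t \<xi>) + norm (bilin f d l t \<xi>)"
      unfolding a0_def bilin_add_left[OF admissible_heat f d(1)] by (rule norm_triangle_ineq)
    moreover have "norm (bilin d a0 l t \<xi>) \<le> norm (bilin d v l t \<xi>) + norm (bilin d f l t \<xi>)"
      unfolding a0_def bilin_add_right[OF d(1) admissible_heat f] by (rule norm_triangle_ineq)
    ultimately show "norm (bilin a0 d l t \<xi>) \<le> b / 8 * growth lam t * envelope \<xi> \<and> norm (bilin d a0 l t \<xi>) \<le> b / 8 * growth lam t * envelope \<xi>"
      using vle fle2 by simp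
  }
  have grow: "b * envelope \<xi> \<le> b * growth lam s * envelope \<xi>" if "s \<ge> 0" "b \<ge> 0" for b s \<xi>
    using growth_ge_1[OF l0 that(1)] that(2) by (intro mult_right_mono) (auto simp: mult_le_cancel_left1)
  have f_le: "norm (f l s \<xi>) \<le> 9 * conv_const 4 * (A * shell_const) * (A * shell_const) * envelope \<xi>" if "s \<ge> 0" for l s \<xi>
  proof -
    have "norm (bilin v v l s \<xi>) \<le> 9 * conv_const 4 * (A * shell_const) * (A * shell_const) * growth 0 s * envelope \<xi>"
      by (rule bilin_le_envelope(1)[OF admissible_heat admissible_heat that]) (use pos heat_le_envelope in \<open>auto simp: growth_zero\<close>)
    thus ?thesis by (simp add: f_def growth_zero)
  qed
  have v_le: "norm (v l s \<xi>) \<le> \<beta> * growth lam s * envelope \<xi>" if "s \<ge> 0" for l s \<xi>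
  proof -
    have "norm (v l s \<xi>) \<le> A * shell_const * envelope \<xi>" by (rule heat_le_envelope[OF that])
    also have "\<dots> \<le> \<beta> * envelope \<xi>" unfolding \<beta> using pos conv_const_nonneg[of 4] by (intro mult_right_mono) auto
    also have "\<dots> \<le> \<beta> * growth lam s * envelope \<xi>" by (rule grow[OF that \<beta>0])
    finally show ?thesis .
  qed
  have a_le: "norm (a0 l s \<xi>) \<le> \<beta> * growth lam s * envelope \<xi>" if "s \<ge> 0" for l s \<xi>
  proof -
    have "norm (a0 l s \<xi>) \<le> \<beta> * envelope \<xi>"
      using norm_triangle_ineq[of "v l s \<xi>" "f l s \<xi>"] heat_le_envelope[OF that, of l \<xi>] f_le[OF that, of l \<xi>]
      unfolding a0_def \<beta> by (simp add: distrib_right)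
    also have "\<dots> \<le> \<beta> * growth lam s * envelope \<xi>" by (rule grow[OF that \<beta>0])
    finally show ?thesis .
  qed
  fix l t \<xi> assume t: "t \<ge> (0::real)"
  \<comment> \<open>Since \<open>a0 - v = f\<close>, the residual is a difference of two values of the quadratic term.\<close>
  have fe: "(\<lambda>l t \<xi>. a0 l t \<xi> - v l t \<xi>) = f" by (simp add: a0_def)
  have "v l t \<xi> + bilin a0 a0 l t \<xi> - a0 l t \<xi> = bilin a0 a0 l t \<xi> - bilin v v l t \<xi>" by (simp add: a0_def f_def)
  also have "\<dots> = bilin f a0 l t \<xi> + bilin v f l t \<xi>" using bilin_diff[OF a0 admissible_heat, of l t \<xi>] by (simp add: fe)
  also have "norm \<dots> \<le> norm (bilin f a0 l t \<xi>) + norm (bilin v f l t \<xi>)" by (rule norm_triangle_ineq)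
  also have "\<dots> \<le> \<sigma> * \<beta> * growth lam t * envelope \<xi> + \<sigma> * \<beta> * growth lam t * envelope \<xi>"
    by (intro add_mono conjunct1[OF fle] conjunct2[OF fle] a0 admissible_heat \<beta>0 a_le v_le t)
  finally show "norm (v l t \<xi> + bilin a0 a0 l t \<xi> - a0 l t \<xi>) \<le> 2 * \<sigma> * \<beta> * growth lam t * envelope \<xi>" by (simp add: mult_ac)
qed

end

section \<open>Rapidly decaying symbols and their convolutions\<close>

text \<open>Differentiation under the integral sign: the mean value inequality dominates the difference quotients by
  \<open>D\<close>.\<close>

lemma has_derivative_integral:
  fixes f :: "'a::real_normed_vector \<Rightarrow> 'b \<Rightarrow> 'c::{banach, second_countable_topology}"
  assumes e: "e > 0"
    and int: "\<And>y. y \<in> ball y0 e \<Longrightarrow> integrable N (f y)"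
    and der: "\<And>y q. y \<in> ball y0 e \<Longrightarrow> ((\<lambda>y. f y q) has_derivative f' y q) (at y)"
    and bd: "\<And>y q h. y \<in> ball y0 e \<Longrightarrow> norm (f' y q h) \<le> D q * norm h"
    and D: "integrable N D" and D0: "\<And>q. D q \<ge> 0"
    and int': "\<And>h. (\<lambda>q. f' y0 q h) \<in> borel_measurable N"
  shows "((\<lambda>y. LINT q|N. f y q) has_derivative (\<lambda>h. LINT q|N. f' y0 q h)) (at y0)"
proof -
  have y0: "y0 \<in> ball y0 e" using e by simp
  have if': "integrable N (\<lambda>q. f' y0 q h)" for h
    by (rule integrable_dominated[OF integrable_mult_left[OF D] int' bd[OF y0]])
  have bl: "bounded_linear (f' y0 q)" for q using der[OF y0] by (rule has_derivative_bounded_linear)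
  have BL: "bounded_linear (\<lambda>h. LINT q|N. f' y0 q h)"
  proof (rule bounded_linear_intro)
    show "(LINT q|N. f' y0 q (a + b)) = (LINT q|N. f' y0 q a) + (LINT q|N. f' y0 q b)" for a b
      using linear_add[OF bounded_linear.linear[OF bl]] if' by simp
    show "(LINT q|N. f' y0 q (r *\<^sub>R a)) = r *\<^sub>R (LINT q|N. f' y0 q a)" for r a
      using linear_scale[OF bounded_linear.linear[OF bl]] by simp
    show "norm (LINT q|N. f' y0 q h) \<le> norm h * (LINT q|N. D q)" for h
    proof -
      have "norm (LINT q|N. f' y0 q h) \<le> (LINT q|N. D q * norm h)"
        by (rule norm_integral_dominated[OF integrable_mult_left[OF D] int' bd[OF y0]])
      thus ?thesis by (simp add: mult.commute)
    qed
  qed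
  have lip: "norm (f y q - f y0 q) \<le> D q * norm (y - y0)" if y: "y \<in> ball y0 e" for y q
  proof (rule differentiable_bound[of "ball y0 e" "\<lambda>y. f y q" "\<lambda>y. f' y q" "D q" y y0])
    fix z assume z: "z \<in> ball y0 e"
    show "((\<lambda>y. f y q) has_derivative f' z q) (at z within ball y0 e)" using der[OF z] by (rule has_derivative_at_withinI)
    show "onorm (f' z q) \<le> D q" by (rule onorm_bound[OF D0 bd[OF z]])
  qed (use y y0 in auto)
  have at: "at y0 within ball y0 e = at y0" by (rule at_within_open[OF y0]) simp
  have "((\<lambda>y. norm (((LINT q|N. f y q) - (LINT q|N. f y0 q)) - (LINT q|N. f' y0 q (y - y0))) / norm (y - y0)) \<longlongrightarrow> 0) (at y0 within ball y0 e)"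
    unfolding tendsto_at_iff_sequentially comp_def
  proof (intro allI impI)
    fix X assume X: "\<forall>i. X i \<in> ball y0 e - {y0}" "X \<longlonglongrightarrow> y0"
    define R where "R n q = (1 / norm (X n - y0)) *\<^sub>R (f (X n) q - f y0 q - f' y0 q (X n - y0))" for n q
    have Xb: "X n \<in> ball y0 e" "X n \<noteq> y0" for n using X by auto
    have "(\<lambda>n. LINT q|N. R n q) \<longlonglongrightarrow> (LINT q|N. 0)"
    proof (rule integral_dominated_convergence[where w = "\<lambda>q. 2 * D q"])
      show "AE q in N. (\<lambda>n. R n q) \<longlonglongrightarrow> 0"
      proof (rule AE_I2)
        fix q
        have "((\<lambda>y. norm ((f y q - f y0 q) - f' y0 q (y - y0)) / norm (y - y0)) \<longlongrightarrow> 0) (at y0 within ball y0 e)"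
          using der[OF y0, of q] unfolding at has_derivative_iff_norm by auto
        hence "(\<lambda>n. norm ((f (X n) q - f y0 q) - f' y0 q (X n - y0)) / norm (X n - y0)) \<longlonglongrightarrow> 0"
          unfolding tendsto_at_iff_sequentially comp_def using X by blast
        hence "(\<lambda>n. norm (R n q)) \<longlonglongrightarrow> 0" by (simp add: R_def)
        thus "(\<lambda>n. R n q) \<longlonglongrightarrow> 0" by (rule tendsto_norm_zero_cancel)
      qed
      show "AE q in N. norm (R n q) \<le> 2 * D q" for n
      proof (rule AE_I2)
        fix q
        have "norm (f (X n) q - f y0 q - f' y0 q (X n - y0)) \<le> D q * norm (X n - y0) + D q * norm (X n - y0)"
          by (rule order_trans[OF norm_triangle_ineq4 add_mono[OF lip[OF Xb(1)] bd[OF y0]]])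
        moreover have "norm (R n q) = norm (f (X n) q - f y0 q - f' y0 q (X n - y0)) / norm (X n - y0)"
          unfolding R_def norm_scaleR by simp
        ultimately show "norm (R n q) \<le> 2 * D q" using Xb(2)[of n] by (simp add: divide_le_eq)
      qed
      show "R n \<in> borel_measurable N" for n unfolding R_def
        using borel_measurable_integrable[OF int[OF Xb(1)]] borel_measurable_integrable[OF int[OF y0]] int' by measurable
    qed (use D in auto)
    moreover have "norm (LINT q|N. R n q) = norm (((LINT q|N. f (X n) q) - (LINT q|N. f y0 q)) - (LINT q|N. f' y0 q (X n - y0))) / norm (X n - y0)" for n
      unfolding R_def using int[OF Xb(1)] int[OF y0] if' by simp
    ultimately show "(\<lambda>n. norm (((LINT q|N. f (X n) q) - (LINT q|N. f y0 q)) - (LINT q|N. f' y0 q (X n - y0))) / norm (X n - y0)) \<longlonglongrightarrow> 0"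
      using tendsto_norm_zero[of "\<lambda>n. LINT q|N. R n q" sequentially] by simp
  qed
  thus ?thesis unfolding has_derivative_iff_norm using BL at by simp
qed

definition poly_growth :: "(real^3 \<Rightarrow> complex) \<Rightarrow> bool" where
  "poly_growth p \<longleftrightarrow> p \<in> borel_measurable borel \<and> (\<exists>C N. \<forall>\<xi>. norm (p \<xi>) \<le> C * (1 + norm \<xi>) ^ N)"

text \<open>One bound for all positive times and every power of \<open>|\<xi>|\<close>, with the integrable singularity of the
  envelope at the origin.\<close>

definition rapid :: "(real \<Rightarrow> real^3 \<Rightarrow> complex) \<Rightarrow> bool" where
  "rapid g \<longleftrightarrow> (\<forall>t>0. g t \<in> borel_measurable borel) \<and>
     (\<forall>m. \<exists>C\<ge>0. \<forall>t>0. \<forall>\<xi>. norm (g t \<xi>) \<le> C * (weight 0 m \<xi> / norm \<xi>))"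

lemma rapidD: assumes "rapid g" obtains C where "C \<ge> 0" "\<And>t \<xi>. t > 0 \<Longrightarrow> norm (g t \<xi>) \<le> C * (weight 0 m \<xi> / norm \<xi>)"
  using assms unfolding rapid_def by metis

lemma rapid_meas: "rapid g \<Longrightarrow> t > 0 \<Longrightarrow> g t \<in> borel_measurable borel" by (auto simp: rapid_def)

lemma weight_mult_pow: "(1 + norm x) ^ n * weight 0 (n + m) x = weight 0 m x"
  by (simp add: weight_def power_add)

lemma rapid_mult:
  assumes g: "rapid g" and p: "poly_growth p" shows "rapid (\<lambda>t \<xi>. p \<xi> * g t \<xi>)"
proof -
  obtain C n where C: "\<And>\<xi>. norm (p \<xi>) \<le> C * (1 + norm \<xi>) ^ n" and pm: "p \<in> borel_measurable borel" using p by (auto simp: poly_growth_def)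
  have C0: "C \<ge> 0" using order_trans[OF norm_ge_zero C[of 0]] by simp
  show ?thesis unfolding rapid_def
  proof (intro conjI allI impI)
    fix t :: real assume "t > 0" thus "(\<lambda>\<xi>. p \<xi> * g t \<xi>) \<in> borel_measurable borel"
      using pm rapid_meas[OF g] by (intro borel_measurable_times) auto
  next
    fix m
    obtain B where B: "B \<ge> 0" "\<And>t \<xi>. t > 0 \<Longrightarrow> norm (g t \<xi>) \<le> B * (weight 0 (n + m) \<xi> / norm \<xi>)" using g by (rule rapidD) blast
    have "norm (p \<xi> * g t \<xi>) \<le> C * B * (weight 0 m \<xi> / norm \<xi>)" if "t > 0" for t \<xi>
    proof -
      have "norm (p \<xi> * g t \<xi>) \<le> (C * (1 + norm \<xi>) ^ n) * (B * (weight 0 (n + m) \<xi> / norm \<xi>))"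
        unfolding norm_mult by (intro mult_mono C B that) (use C0 in auto)
      also have "\<dots> = C * B * (((1 + norm \<xi>) ^ n * weight 0 (n + m) \<xi>) / norm \<xi>)" by simp
      finally show ?thesis by (simp only: weight_mult_pow)
    qed
    thus "\<exists>C\<ge>0. \<forall>t>0. \<forall>\<xi>. norm (p \<xi> * g t \<xi>) \<le> C * (weight 0 m \<xi> / norm \<xi>)"
      using C0 B(1) by (intro exI[of _ "C * B"]) auto
  qed
qed

lemma rapid_add:
  assumes g: "rapid g" and h: "rapid h" shows "rapid (\<lambda>t \<xi>. g t \<xi> + h t \<xi>)"
  unfolding rapid_def
proof (intro conjI allI impI)
  fix t :: real assume "t > 0" thus "(\<lambda>\<xi>. g t \<xi> + h t \<xi>) \<in> borel_measurable borel"
    using rapid_meas[OF g] rapid_meas[OF h] by (intro borel_measurable_add) auto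
next
  fix m
  obtain B where B: "B \<ge> 0" "\<And>t \<xi>. t > 0 \<Longrightarrow> norm (g t \<xi>) \<le> B * (weight 0 m \<xi> / norm \<xi>)" using g by (rule rapidD) blast
  obtain C where C: "C \<ge> 0" "\<And>t \<xi>. t > 0 \<Longrightarrow> norm (h t \<xi>) \<le> C * (weight 0 m \<xi> / norm \<xi>)" using h by (rule rapidD) blast
  have "norm (g t \<xi> + h t \<xi>) \<le> (B + C) * (weight 0 m \<xi> / norm \<xi>)" if "t > 0" for t \<xi>
    using norm_triangle_ineq[of "g t \<xi>" "h t \<xi>"] B(2)[OF that, of \<xi>] C(2)[OF that, of \<xi>] unfolding distrib_right by linarith
  thus "\<exists>C\<ge>0. \<forall>t>0. \<forall>\<xi>. norm (g t \<xi> + h t \<xi>) \<le> C * (weight 0 m \<xi> / norm \<xi>)"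
    using B C by (intro exI[of _ "B + C"]) auto
qed

text \<open>The multiplier has to vanish at the origin: there the convolution need not be zero, while the bound defining
  \<open>rapid\<close> reads \<open>0\<close> under the convention \<open>1 / 0 = 0\<close>.\<close>

lemma rapid_conv:
  assumes g: "rapid g" and h: "rapid h" and p: "poly_growth p" and p0: "p 0 = 0"
  shows "rapid (\<lambda>t \<xi>. p \<xi> * conv (g t) (h t) \<xi>)"
proof -
  obtain C n where C: "\<And>\<xi>. norm (p \<xi>) \<le> C * (1 + norm \<xi>) ^ n" and pm: "p \<in> borel_measurable borel" using p by (auto simp: poly_growth_def)
  have C0: "C \<ge> 0" using order_trans[OF norm_ge_zero C[of 0]] by simp
  show ?thesis unfolding rapid_def
  proof (intro conjI allI impI)
    fix t :: real assume t: "t > 0"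
    have [measurable]: "g t \<in> borel_measurable borel" "h t \<in> borel_measurable borel" using rapid_meas[OF _ t] g h by auto
    have "(\<lambda>\<xi>. conv (g t) (h t) \<xi>) \<in> borel_measurable borel" unfolding conv_def
      by (rule lborel.borel_measurable_lebesgue_integral) measurable
    thus "(\<lambda>\<xi>. p \<xi> * conv (g t) (h t) \<xi>) \<in> borel_measurable borel" using pm by (intro borel_measurable_times)
  next
    fix m
    obtain B where B: "B \<ge> 0" "\<And>t \<xi>. t > 0 \<Longrightarrow> norm (g t \<xi>) \<le> B * (weight 0 (n + (4 + m)) \<xi> / norm \<xi>)" using g by (rule rapidD) blast
    obtain B' where B': "B' \<ge> 0" "\<And>t \<xi>. t > 0 \<Longrightarrow> norm (h t \<xi>) \<le> B' * (weight 0 (n + (4 + m)) \<xi> / norm \<xi>)" using h by (rule rapidD) blast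
    define K where "K = C * (conv_const (n + (4 + m)) * B * B')"
    have K0: "K \<ge> 0" unfolding K_def using C0 B(1) B'(1) conv_const_nonneg by simp
    have "norm (p \<xi> * conv (g t) (h t) \<xi>) \<le> K * (weight 0 m \<xi> / norm \<xi>)" if t: "t > 0" for t \<xi>
    proof (cases "\<xi> = 0")
      case False
      have "norm (p \<xi> * conv (g t) (h t) \<xi>) \<le> (C * (1 + norm \<xi>) ^ n) * (conv_const (n + (4 + m)) * B * B' * weight 0 (n + (4 + m)) \<xi>)"
        unfolding norm_mult using rapid_meas[OF _ t] g h B B' t C0 by (intro mult_mono C conv_bound) auto
      also have "\<dots> = K * ((1 + norm \<xi>) ^ n * weight 0 (n + (4 + m)) \<xi>)" by (simp add: K_def)
      also have "\<dots> = K * weight 0 (4 + m) \<xi>" by (simp only: weight_mult_pow)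
      also have "weight 0 (4 + m) \<xi> \<le> weight 0 m \<xi> / norm \<xi>"
      proof -
        have "norm \<xi> \<le> (1 + norm \<xi>)^1" by simp
        also have "\<dots> \<le> (1 + norm \<xi>)^4" by (intro power_increasing) auto
        finally have "norm \<xi> * weight 0 (4 + m) \<xi> \<le> (1 + norm \<xi>)^4 * weight 0 (4 + m) \<xi>" by (intro mult_right_mono) auto
        thus ?thesis using False by (simp only: weight_mult_pow) (simp add: field_simps)
      qed
      hence "K * weight 0 (4 + m) \<xi> \<le> K * (weight 0 m \<xi> / norm \<xi>)" using K0 by (intro mult_left_mono)
      finally show ?thesis .
    qed (simp add: p0)
    thus "\<exists>C\<ge>0. \<forall>t>0. \<forall>\<xi>. norm (p \<xi> * conv (g t) (h t) \<xi>) \<le> C * (weight 0 m \<xi> / norm \<xi>)"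
      using K0 by blast
  qed
qed

lemma envelope_rapid: "\<exists>C\<ge>0. \<forall>\<xi>. envelope \<xi> \<le> C * (weight 0 m \<xi> / norm \<xi>)"
proof -
  have fle: "x ^ m / fact m \<le> exp x" if "x \<ge> 0" for x :: real
  proof -
    have "(\<Sum>i\<in>{m}. x^i /\<^sub>R fact i) \<le> (\<Sum>i. x^i /\<^sub>R fact i)"
      using that by (intro sum_le_suminf summable_exp_generic) auto
    thus ?thesis by (simp add: exp_def divide_inverse mult.commute)
  qed
  have "envelope \<xi> \<le> (fact m * exp 1) * (weight 0 m \<xi> / norm \<xi>)" for \<xi>
  proof -
    have "(1 + norm \<xi>) ^ m \<le> fact m * exp (1 + norm \<xi>)" using fle[of "1 + norm \<xi>"] by (simp add: field_simps)
    hence "exp (- norm \<xi>) \<le> fact m * exp 1 / (1 + norm \<xi>) ^ m" by (simp add: exp_minus exp_add field_simps)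
    moreover have "weight 1 4 \<xi> \<le> exp (- norm \<xi>)" unfolding weight_def by (simp add: divide_le_eq one_le_power mult_le_cancel_left1)
    ultimately have "weight 1 4 \<xi> \<le> fact m * exp 1 * weight 0 m \<xi>" by (simp add: weight_def)
    hence "weight 1 4 \<xi> / norm \<xi> \<le> fact m * exp 1 * weight 0 m \<xi> / norm \<xi>" by (intro divide_right_mono) auto
    thus ?thesis by (simp add: envelope_def)
  qed
  thus ?thesis by (intro exI[of _ "fact m * exp 1"]) auto
qed

inductive_set symbol_class :: "fourier_field \<Rightarrow> (real \<Rightarrow> real^3 \<Rightarrow> complex) set" for u :: fourier_field where
  base: "u l \<in> symbol_class u"
| mult: "g \<in> symbol_class u \<Longrightarrow> poly_growth p \<Longrightarrow> (\<lambda>t \<xi>. p \<xi> * g t \<xi>) \<in> symbol_class u"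
| add: "g \<in> symbol_class u \<Longrightarrow> h \<in> symbol_class u \<Longrightarrow> (\<lambda>t \<xi>. g t \<xi> + h t \<xi>) \<in> symbol_class u"
| conv: "g \<in> symbol_class u \<Longrightarrow> h \<in> symbol_class u \<Longrightarrow> poly_growth p \<Longrightarrow> p 0 = 0 \<Longrightarrow>
      (\<lambda>t \<xi>. p \<xi> * conv (g t) (h t) \<xi>) \<in> symbol_class u"

lemma symbol_rapid: assumes "admissible u" "g \<in> symbol_class u" shows "rapid g"
  using assms(2)
proof induction
  case (base l)
  obtain C where C: "C \<ge> 0" "\<And>l t \<xi>. t \<ge> 0 \<Longrightarrow> norm (u l t \<xi>) \<le> C * envelope \<xi>" using assms(1) by (rule admissible_bound) auto
  show ?case unfolding rapid_def
  proof (intro conjI allI impI)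
    show "u l t \<in> borel_measurable borel" for t by (rule admissible_meas1[OF assms(1)])
    fix m
    obtain B where B: "B \<ge> 0" "\<And>\<xi>. envelope \<xi> \<le> B * (weight 0 m \<xi> / norm \<xi>)" using envelope_rapid[of m] by blast
    have "norm (u l t \<xi>) \<le> C * B * (weight 0 m \<xi> / norm \<xi>)" if "t > 0" for t \<xi>
      using C(2)[of t l \<xi>] mult_left_mono[OF B(2)[of \<xi>] C(1)] that by (simp add: mult_ac)
    thus "\<exists>C\<ge>0. \<forall>t>0. \<forall>\<xi>. norm (u l t \<xi>) \<le> C * (weight 0 m \<xi> / norm \<xi>)" using B C by (intro exI[of _ "C * B"]) auto
  qed
qed (auto intro: rapid_mult rapid_add rapid_conv)

lemma conv_deriv:
  assumes r: "rapid g" "rapid h" "rapid g'" "rapid h'" and t: "t > 0"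
    and dg: "\<And>t \<xi>. t > 0 \<Longrightarrow> ((\<lambda>t. g t \<xi>) has_vector_derivative g' t \<xi>) (at t)"
    and dh: "\<And>t \<xi>. t > 0 \<Longrightarrow> ((\<lambda>t. h t \<xi>) has_vector_derivative h' t \<xi>) (at t)"
  shows "((\<lambda>t. conv (g t) (h t) \<xi>) has_vector_derivative conv (g' t) (h t) \<xi> + conv (g t) (h' t) \<xi>) (at t)"
proof -
  note R = rapidD[where m = 4]
  obtain A where A: "A \<ge> 0" "\<And>t \<xi>. t > 0 \<Longrightarrow> norm (g t \<xi>) \<le> A * (weight 0 4 \<xi> / norm \<xi>)" using r(1) by (rule R) blast
  obtain B where B: "B \<ge> 0" "\<And>t \<xi>. t > 0 \<Longrightarrow> norm (h t \<xi>) \<le> B * (weight 0 4 \<xi> / norm \<xi>)" using r(2) by (rule R) blast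
  obtain A' where A': "A' \<ge> 0" "\<And>t \<xi>. t > 0 \<Longrightarrow> norm (g' t \<xi>) \<le> A' * (weight 0 4 \<xi> / norm \<xi>)" using r(3) by (rule R) blast
  obtain B' where B': "B' \<ge> 0" "\<And>t \<xi>. t > 0 \<Longrightarrow> norm (h' t \<xi>) \<le> B' * (weight 0 4 \<xi> / norm \<xi>)" using r(4) by (rule R) blast
  define w where "w q = 4 * 2^4 * weight 0 4 \<xi> * (inv_sq q + inv_sq (\<xi> - q))" for q
  define D where "D q = A' * B * w q + A * B' * w q" for q
  have meas: "k t \<in> borel_measurable borel" if "rapid k" "t > 0" for k t using rapid_meas that by auto
  have pos: "s > 0" if "s \<in> ball t t" for s using that by (auto simp: dist_real_def)
  have "((\<lambda>t. LINT q|lborel. g t q * h t (\<xi> - q)) has_derivative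
     (\<lambda>x. LINT q|lborel. x *\<^sub>R (g t q * h' t (\<xi> - q) + g' t q * h t (\<xi> - q)))) (at t)"
  proof (rule has_derivative_integral[where e = t and D = D and f' = "\<lambda>t q x. x *\<^sub>R (g t q * h' t (\<xi> - q) + g' t q * h t (\<xi> - q))"])
    fix s assume s: "s \<in> ball t t"
    show "integrable lborel (\<lambda>q. g s q * h s (\<xi> - q))"
      using A B pos[OF s] by (intro conv_integrable[of 4 0 _ _ A B] meas r) auto
    fix q
    show "((\<lambda>t. g t q * h t (\<xi> - q)) has_derivative (\<lambda>x. x *\<^sub>R (g s q * h' s (\<xi> - q) + g' s q * h s (\<xi> - q)))) (at s)"
      using has_vector_derivative_mult[OF dg[OF pos[OF s]] dh[OF pos[OF s]]] by (simp add: has_vector_derivative_def)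
    fix x :: real
    have "norm (g s q * h' s (\<xi> - q) + g' s q * h s (\<xi> - q)) \<le> A * B' * w q + A' * B * w q"
    proof (rule order_trans[OF norm_triangle_ineq add_mono])
      show "norm (g s q * h' s (\<xi> - q)) \<le> A * B' * w q"
        using conv_dom[of 4 0 "g s" A "h' s" B' q \<xi>] A B' pos[OF s] by (simp add: w_def mult.assoc)
      show "norm (g' s q * h s (\<xi> - q)) \<le> A' * B * w q"
        using conv_dom[of 4 0 "g' s" A' "h s" B q \<xi>] A' B pos[OF s] by (simp add: w_def mult.assoc)
    qed
    hence "\<bar>x\<bar> * norm (g s q * h' s (\<xi> - q) + g' s q * h s (\<xi> - q)) \<le> \<bar>x\<bar> * D q"
      by (intro mult_left_mono) (auto simp: D_def)
    thus "norm (x *\<^sub>R (g s q * h' s (\<xi> - q) + g' s q * h s (\<xi> - q))) \<le> D q * norm x" by (simp add: mult.commute)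
  next
    show "D q \<ge> 0" for q unfolding D_def w_def using A(1) B(1) A'(1) B'(1) inv_sq_nonneg
      by (auto intro!: add_nonneg_nonneg mult_nonneg_nonneg)
    show "integrable lborel D" unfolding D_def w_def by (intro Bochner_Integration.integrable_add integrable_mult_right inv_sq_sum_integrable)
    fix x
    note [measurable] = meas[OF r(1) t] meas[OF r(2) t] meas[OF r(3) t] meas[OF r(4) t]
    show "(\<lambda>q. x *\<^sub>R (g t q * h' t (\<xi> - q) + g' t q * h t (\<xi> - q))) \<in> borel_measurable lborel" by measurable
  qed (rule t)
  moreover have "(LINT q|lborel. x *\<^sub>R (g t q * h' t (\<xi> - q) + g' t q * h t (\<xi> - q))) = x *\<^sub>R (conv (g' t) (h t) \<xi> + conv (g t) (h' t) \<xi>)" for x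
  proof -
    have "integrable lborel (\<lambda>q. g t q * h' t (\<xi> - q))" "integrable lborel (\<lambda>q. g' t q * h t (\<xi> - q))"
      using conv_integrable[of 4 0 "g t" "h' t" A B' \<xi>] conv_integrable[of 4 0 "g' t" "h t" A' B \<xi>] meas[OF _ t] r A B A' B' t by auto
    thus ?thesis by (simp add: conv_def add.commute)
  qed
  ultimately show ?thesis unfolding has_vector_derivative_def by (simp only: conv_def[of "g _" "h _"])
qed

section \<open>Smoothness in space and time\<close>

lemma sum_mem_symbol:
  fixes f :: "3 \<Rightarrow> real \<Rightarrow> real^3 \<Rightarrow> complex"
  assumes "\<And>k. f k \<in> symbol_class u"
  shows "(\<lambda>t \<xi>. \<Sum>k\<in>UNIV. f k t \<xi>) \<in> symbol_class u"
  unfolding sum_3 by (intro symbol_class.add assms)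

definition field_regular :: "fourier_field \<Rightarrow> bool" where
  "field_regular u \<longleftrightarrow> admissible u \<and> (\<forall>l. \<exists>g\<in>symbol_class u. \<forall>t>0. \<forall>\<xi>. ((\<lambda>t. u l t \<xi>) has_vector_derivative g t \<xi>) (at t))"

lemma poly_growth_const: "poly_growth (\<lambda>_. c)"
  unfolding poly_growth_def by (rule conjI, simp, rule exI[of _ "norm c"], rule exI[of _ 0], simp)

lemma poly_growth_inner: "poly_growth (\<lambda>\<xi>. \<i> * complex_of_real (a \<bullet> \<xi>))"
  unfolding poly_growth_def
proof (intro conjI exI allI)
  show "(\<lambda>\<xi>. \<i> * complex_of_real (a \<bullet> \<xi>)) \<in> borel_measurable borel" by measurable
  fix \<xi>
  have "norm (\<i> * complex_of_real (a \<bullet> \<xi>)) = \<bar>a \<bullet> \<xi>\<bar>" by (simp add: norm_mult)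
  also have "\<dots> \<le> norm a * norm \<xi>" by (rule Cauchy_Schwarz_ineq2)
  also have "\<dots> \<le> norm a * (1 + norm \<xi>)^1" by (intro mult_left_mono) auto
  finally show "norm (\<i> * complex_of_real (a \<bullet> \<xi>)) \<le> norm a * (1 + norm \<xi>)^1" .
qed

text \<open>Closure under time derivatives holds by induction on the construction, once it is known for \<open>u\<close> itself;
  multipliers commute with \<open>d/dt\<close> and convolutions obey the product rule.\<close>

lemma symbol_deriv:
  assumes u: "field_regular u" and g: "g \<in> symbol_class u"
  shows "\<exists>g'\<in>symbol_class u. \<forall>t>0. \<forall>\<xi>. ((\<lambda>t. g t \<xi>) has_vector_derivative g' t \<xi>) (at t)"
  using g
proof induction
  case (base l)
  then show ?case using u by (auto simp: field_regular_def)
next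
  case (mult g p)
  then obtain g' where g': "g' \<in> symbol_class u" "\<forall>t>0. \<forall>\<xi>. ((\<lambda>t. g t \<xi>) has_vector_derivative g' t \<xi>) (at t)" by blast
  show ?case
    by (rule bexI[of _ "\<lambda>t \<xi>. p \<xi> * g' t \<xi>"]) (use g' mult in \<open>auto intro!: has_vector_derivative_mult_right symbol_class.mult\<close>)
next
  case (add g h)
  then obtain g' h' where g': "g' \<in> symbol_class u" "\<forall>t>0. \<forall>\<xi>. ((\<lambda>t. g t \<xi>) has_vector_derivative g' t \<xi>) (at t)"
    and h': "h' \<in> symbol_class u" "\<forall>t>0. \<forall>\<xi>. ((\<lambda>t. h t \<xi>) has_vector_derivative h' t \<xi>) (at t)" by blast
  show ?case
    by (rule bexI[of _ "\<lambda>t \<xi>. g' t \<xi> + h' t \<xi>"]) (use g' h' in \<open>auto intro!: has_vector_derivative_add symbol_class.add\<close>)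
next
  case (conv g h p)
  then obtain g' h' where g': "g' \<in> symbol_class u" "\<forall>t>0. \<forall>\<xi>. ((\<lambda>t. g t \<xi>) has_vector_derivative g' t \<xi>) (at t)"
    and h': "h' \<in> symbol_class u" "\<forall>t>0. \<forall>\<xi>. ((\<lambda>t. h t \<xi>) has_vector_derivative h' t \<xi>) (at t)" by blast
  have ad: "admissible u" using u by (simp add: field_regular_def)
  show ?case
  proof (rule bexI[of _ "\<lambda>t \<xi>. p \<xi> * conv (g' t) (h t) \<xi> + p \<xi> * conv (g t) (h' t) \<xi>"], intro allI impI)
    show "(\<lambda>t \<xi>. p \<xi> * conv (g' t) (h t) \<xi> + p \<xi> * conv (g t) (h' t) \<xi>) \<in> symbol_class u"
      by (intro symbol_class.add symbol_class.conv g' h' conv)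
    fix t :: real and \<xi> assume t: "t > 0"
    have "((\<lambda>t. conv (g t) (h t) \<xi>) has_vector_derivative conv (g' t) (h t) \<xi> + conv (g t) (h' t) \<xi>) (at t)"
      using g' h' conv by (intro conv_deriv symbol_rapid[OF ad] t) auto
    thus "((\<lambda>t. p \<xi> * conv (g t) (h t) \<xi>) has_vector_derivative p \<xi> * conv (g' t) (h t) \<xi> + p \<xi> * conv (g t) (h' t) \<xi>) (at t)"
      unfolding distrib_left[symmetric] by (rule has_vector_derivative_mult_right)
  qed
qed

definition physical :: "(real \<Rightarrow> real^3 \<Rightarrow> complex) \<Rightarrow> (real^3) \<times> real \<Rightarrow> complex" where
  "physical g y = (LINT \<xi>|lborel. cis (fst y \<bullet> \<xi>) * g (snd y) \<xi>)"

lemma cis_measurable [measurable]: "cis \<in> borel_measurable borel"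
  by (intro borel_measurable_continuous_onI continuous_intros)

lemma weight_int: "integrable lborel (\<lambda>\<xi>. weight 0 4 \<xi> / norm \<xi>)"
proof (rule integrable_dominated[OF inv_sq_integrable])
  have "weight 0 4 \<xi> / norm \<xi> \<le> inv_sq \<xi>" for \<xi>
  proof (cases "\<xi> = 0")
    case False
    have "norm \<xi> * (1 + norm \<xi>)\<^sup>2 \<le> (1 + norm \<xi>)\<^sup>2 * (1 + norm \<xi>)\<^sup>2"
    proof (rule mult_right_mono)
      show "norm \<xi> \<le> (1 + norm \<xi>)\<^sup>2" by (simp add: power2_eq_square algebra_simps)
    qed simp
    also have "\<dots> = (1 + norm \<xi>)^4" by (simp add: power4_eq_xxxx power2_eq_square)
    finally have "(norm \<xi>)\<^sup>2 * (1 + norm \<xi>)\<^sup>2 \<le> norm \<xi> * (1 + norm \<xi>)^4" by (simp add: power2_eq_square mult.assoc mult_left_mono)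
    hence "1 / (norm \<xi> * (1 + norm \<xi>)^4) \<le> 1 / ((norm \<xi>)\<^sup>2 * (1 + norm \<xi>)\<^sup>2)"
      using False by (intro divide_left_mono mult_pos_pos) auto
    thus ?thesis by (simp add: weight_def inv_sq_def mult.commute)
  qed (simp add: inv_sq_def)
  thus "norm (weight 0 4 x / norm x) \<le> inv_sq x" for x by simp
qed measurable

text \<open>A spatial derivative multiplies the symbol by \<open>\<i> (a \<bullet> \<xi>)\<close> and a time derivative
  replaces it by its own, so all directional derivatives are again of the form \<open>physical g\<close> with
  \<open>g\<close> in the class.\<close>

lemma physical_deriv:
  assumes u: "field_regular u" and g: "g \<in> symbol_class u"
  shows "\<exists>G. (\<forall>h. G h \<in> symbol_class u) \<and>
     (\<forall>y. snd y > 0 \<longrightarrow> (physical g has_derivative (\<lambda>h. physical (G h) y)) (at y))"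
proof -
  obtain g' where g': "g' \<in> symbol_class u" and dg: "\<And>t \<xi>. t > 0 \<Longrightarrow> ((\<lambda>t. g t \<xi>) has_vector_derivative g' t \<xi>) (at t)"
    using symbol_deriv[OF u g] by blast
  have ad: "admissible u" using u by (simp add: field_regular_def)
  have rg: "rapid g" "rapid g'" using symbol_rapid[OF ad] g g' by auto
  define G where "G h = (\<lambda>t \<xi>. (\<i> * complex_of_real (fst h \<bullet> \<xi>)) * g t \<xi> + complex_of_real (snd h) * g' t \<xi>)" for h :: "(real^3) \<times> real"
  have GS: "G h \<in> symbol_class u" for h
    unfolding G_def by (intro symbol_class.add symbol_class.mult poly_growth_inner poly_growth_const g g')
  obtain A where A: "A \<ge> 0" "\<And>t \<xi>. t > 0 \<Longrightarrow> norm (g t \<xi>) \<le> A * (weight 0 (1 + 4) \<xi> / norm \<xi>)" using rg(1) by (rule rapidD) blast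
  obtain A' where A': "A' \<ge> 0" "\<And>t \<xi>. t > 0 \<Longrightarrow> norm (g' t \<xi>) \<le> A' * (weight 0 4 \<xi> / norm \<xi>)" using rg(2) by (rule rapidD) blast
  define D where "D \<xi> = (A + A') * (weight 0 4 \<xi> / norm \<xi>)" for \<xi> :: "real^3"
  have Di: "integrable lborel D" unfolding D_def by (intro integrable_mult_right weight_int)
  have wk54: "(1 + norm \<xi>) * (weight 0 (1 + 4) \<xi> / norm \<xi>) = weight 0 4 \<xi> / norm \<xi>" for \<xi>
    using weight_mult_pow[of \<xi> 1 4] by simp
  have gD: "norm (g t \<xi>) * (1 + norm \<xi>) \<le> A * (weight 0 4 \<xi> / norm \<xi>)" if "t > 0" for t \<xi>
  proof -
    have "norm (g t \<xi>) * (1 + norm \<xi>) \<le> A * (weight 0 (1 + 4) \<xi> / norm \<xi>) * (1 + norm \<xi>)"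
      by (intro mult_right_mono A that) auto
    also have "\<dots> = A * ((1 + norm \<xi>) * (weight 0 (1 + 4) \<xi> / norm \<xi>))" by (simp only: mult_ac)
    finally show ?thesis by (simp only: wk54)
  qed
  have gD1: "norm (g t \<xi>) \<le> D \<xi>" if "t > 0" for t \<xi>
  proof -
    have "norm (g t \<xi>) * 1 \<le> norm (g t \<xi>) * (1 + norm \<xi>)" by (intro mult_left_mono) auto
    also have "\<dots> \<le> A * (weight 0 4 \<xi> / norm \<xi>)" by (rule gD[OF that])
    also have "\<dots> \<le> D \<xi>" unfolding D_def using A' by (intro mult_right_mono) auto
    finally show ?thesis by simp
  qed
  have meas: "k t \<in> borel_measurable borel" if "rapid k" "t > 0" for k t using rapid_meas that by auto
  have mF: "(\<lambda>\<xi>. cis (x \<bullet> \<xi>) * k \<xi>) \<in> borel_measurable borel" if [measurable]: "k \<in> borel_measurable borel" for x :: "real^3" and k by measurable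
  have "(physical g has_derivative (\<lambda>h. physical (G h) y)) (at y)" if y: "snd y > 0" for y
    unfolding physical_def
  proof (rule has_derivative_integral[where e = "snd y" and D = D and f' = "\<lambda>y \<xi> h. cis (fst y \<bullet> \<xi>) * G h (snd y) \<xi>"])
    fix z assume z0: "z \<in> ball y (snd y)"
    have "\<bar>snd z - snd y\<bar> \<le> dist z y" using dist_snd_le[of z y] by (simp add: dist_real_def)
    hence z: "snd z > 0" using z0 by (simp add: dist_commute)
    show "integrable lborel (\<lambda>\<xi>. cis (fst z \<bullet> \<xi>) * g (snd z) \<xi>)"
      by (rule integrable_dominated[OF Di]) (use gD1[OF z] mF meas[OF rg(1) z] in \<open>auto simp: norm_mult\<close>)
    fix \<xi>
    have 1: "((\<lambda>y. cis (fst y \<bullet> \<xi>)) has_derivative (\<lambda>h. (fst h \<bullet> \<xi>) *\<^sub>R (\<i> * cis (fst z \<bullet> \<xi>)))) (at z)"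
      by (rule has_derivative_cis) (auto intro!: derivative_eq_intros)
    have 2: "((\<lambda>y. g (snd y) \<xi>) has_derivative (\<lambda>h. snd h *\<^sub>R g' (snd z) \<xi>)) (at z)"
    proof -
      have "((\<lambda>t. g t \<xi>) has_derivative (\<lambda>s. s *\<^sub>R g' (snd z) \<xi>)) (at (snd z))" using dg[OF z] by (simp add: has_vector_derivative_def)
      moreover have "(snd has_derivative snd) (at z)" by (auto intro!: derivative_eq_intros)
      ultimately show ?thesis using diff_chain_at[of snd snd z "\<lambda>t. g t \<xi>"] by (simp add: comp_def)
    qed
    show "((\<lambda>y. cis (fst y \<bullet> \<xi>) * g (snd y) \<xi>) has_derivative (\<lambda>h. cis (fst z \<bullet> \<xi>) * G h (snd z) \<xi>)) (at z)"
      by (rule has_derivative_eq_rhs[OF has_derivative_mult[OF 1 2]])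
         (auto simp: G_def fun_eq_iff scaleR_conv_of_real algebra_simps)
    fix h :: "(real^3) \<times> real"
    have hn: "norm (fst h) \<le> norm h" "\<bar>snd h\<bar> \<le> norm h"
      using norm_fst_le[of "fst h" "snd h"] norm_snd_le[of "snd h" "fst h"] by auto
    have "norm (cis (fst z \<bullet> \<xi>) * G h (snd z) \<xi>) \<le> \<bar>fst h \<bullet> \<xi>\<bar> * norm (g (snd z) \<xi>) + \<bar>snd h\<bar> * norm (g' (snd z) \<xi>)"
      unfolding G_def norm_mult by (rule order_trans[OF mult_left_mono[OF norm_triangle_ineq]]) (auto simp: norm_mult)
    also have "\<dots> \<le> (norm h * (1 + norm \<xi>)) * norm (g (snd z) \<xi>) + norm h * norm (g' (snd z) \<xi>)"
    proof (intro add_mono mult_right_mono hn)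
      have "\<bar>fst h \<bullet> \<xi>\<bar> \<le> norm (fst h) * norm \<xi>" by (rule Cauchy_Schwarz_ineq2)
      also have "\<dots> \<le> norm h * (1 + norm \<xi>)" using hn by (intro mult_mono) auto
      finally show "\<bar>fst h \<bullet> \<xi>\<bar> \<le> norm h * (1 + norm \<xi>)" .
    qed auto
    also have "\<dots> = norm h * (norm (g (snd z) \<xi>) * (1 + norm \<xi>) + norm (g' (snd z) \<xi>))" by (simp add: algebra_simps)
    also have "\<dots> \<le> norm h * (A * (weight 0 4 \<xi> / norm \<xi>) + A' * (weight 0 4 \<xi> / norm \<xi>))"
      by (intro mult_left_mono add_mono gD A' z) auto
    also have "\<dots> = D \<xi> * norm h" by (simp only: D_def distrib_right distrib_left mult_ac)
    finally show "norm (cis (fst z \<bullet> \<xi>) * G h (snd z) \<xi>) \<le> D \<xi> * norm h" .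
  next
    show "D q \<ge> 0" for q unfolding D_def using A A' by simp
    show "(\<lambda>q. cis (fst y \<bullet> q) * G h (snd y) q) \<in> borel_measurable lborel" for h
      using mF meas[OF symbol_rapid[OF ad GS] y] by auto
  qed (use y Di in auto)
  thus ?thesis using GS by blast
qed

lemma physical_iter:
  assumes u: "field_regular u" and g: "g \<in> symbol_class u"
  shows "\<exists>g'\<in>symbol_class u. \<forall>y. snd y > 0 \<longrightarrow> iter_deriv vs (physical g) y = physical g' y"
proof (induction vs)
  case (Cons w vs)
  then obtain g1 where g1: "g1 \<in> symbol_class u" "\<And>y. snd y > 0 \<Longrightarrow> iter_deriv vs (physical g) y = physical g1 y" by blast
  obtain G where G: "\<And>h. G h \<in> symbol_class u" "\<And>y. snd y > 0 \<Longrightarrow> (physical g1 has_derivative (\<lambda>h. physical (G h) y)) (at y)"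
    using physical_deriv[OF u g1(1)] by blast
  have "iter_deriv (w # vs) (physical g) y = physical (G w) y" if y: "snd y > 0" for y
  proof -
    have "(iter_deriv vs (physical g) has_derivative (\<lambda>h. physical (G h) y)) (at y)"
    proof (rule has_derivative_transform_within_open[OF G(2)[OF y]])
      show "open {y :: (real^3) \<times> real. snd y > 0}" by (intro open_Collect_less continuous_intros)
    qed (use y g1 in auto)
    from frechet_derivative_at[OF this] show ?thesis by (metis iter_deriv.simps(2))
  qed
  thus ?case using G(1) by blast
qed (use g in auto)

lemma physical_smooth:
  assumes u: "field_regular u" and g: "g \<in> symbol_class u"
  shows "smooth_on (UNIV \<times> {0<..}) (physical g)"
  unfolding smooth_on_def
proof (intro allI impI ballI)
  fix vs :: "((real^3) \<times> real) list" and y :: "(real^3) \<times> real" assume y: "y \<in> UNIV \<times> {0<..}"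
  obtain g1 where g1: "g1 \<in> symbol_class u" "\<And>y. snd y > 0 \<Longrightarrow> iter_deriv vs (physical g) y = physical g1 y"
    using physical_iter[OF u g] by blast
  obtain G where G: "\<And>y. snd y > 0 \<Longrightarrow> (physical g1 has_derivative (\<lambda>h. physical (G h) y)) (at y)"
    using physical_deriv[OF u g1(1)] by blast
  have y': "snd y > 0" using y by auto
  have "(iter_deriv vs (physical g) has_derivative (\<lambda>h. physical (G h) y)) (at y)"
  proof (rule has_derivative_transform_within_open[OF G[OF y']])
    show "open {y :: (real^3) \<times> real. snd y > 0}" by (intro open_Collect_less continuous_intros)
  qed (use y' g1 in auto)
  thus "iter_deriv vs (physical g) differentiable at y" by (auto simp: differentiable_def)
qed

context borel_kernels begin

text \<open>The derivative of the Duhamel formula, \<open>du/dt = - |\<xi>|\<^sup>2 u + N(u)\<close>, expresses the time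
  derivative by operations that define the class.\<close>

lemma solution_field_regular:
  assumes u: "admissible u" and eq: "\<And>l t \<xi>. t \<ge> 0 \<Longrightarrow> u l t \<xi> = psi l \<xi> * complex_of_real (exp (- (norm \<xi>)\<^sup>2 * t)) + bilin u u l t \<xi>"
  shows "field_regular u"
  unfolding field_regular_def
proof (intro conjI u allI)
  fix l
  define g where "g t \<xi> = (- complex_of_real ((norm \<xi>)\<^sup>2)) * u l t \<xi> + nonlin u u l \<xi> t" for t \<xi>
  have PM: "poly_growth (M k j l)" for k j l
    unfolding poly_growth_def
  proof (intro conjI exI allI)
    show "norm (M k j l \<xi>) \<le> 1 * (1 + norm \<xi>)^1" for \<xi> using M_le[of k j l \<xi>] by simp
  qed measurable
  have PN: "poly_growth (\<lambda>\<xi>. - complex_of_real ((norm \<xi>)\<^sup>2))"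
    unfolding poly_growth_def
  proof (intro conjI exI allI)
    show "norm (- complex_of_real ((norm \<xi>)\<^sup>2)) \<le> 1 * (1 + norm \<xi>)^2" for \<xi> :: "real^3"
      by (simp add: norm_power power_mono del: of_real_power)
  qed measurable
  have gS: "g \<in> symbol_class u"
    unfolding g_def nonlin_def
    by (intro symbol_class.add symbol_class.mult symbol_class.base sum_mem_symbol symbol_class.conv PM M_zero PN)
  moreover have "((\<lambda>t. u l t \<xi>) has_vector_derivative g t \<xi>) (at t)" if t: "t > 0" for t \<xi>
  proof -
    define c where "c = (norm \<xi>)\<^sup>2"
    have "(duhamel c (nonlin u u l \<xi>) has_vector_derivative nonlin u u l \<xi> t - complex_of_real c * duhamel c (nonlin u u l \<xi>) t) (at t within {0..})"
      using t by (intro duhamel_deriv nonlin_cont u) auto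
    hence 1: "(duhamel c (nonlin u u l \<xi>) has_vector_derivative nonlin u u l \<xi> t - complex_of_real c * duhamel c (nonlin u u l \<xi>) t) (at t)"
      using t by (subst (asm) at_within_interior) auto
    have 2: "((\<lambda>t. psi l \<xi> * complex_of_real (exp (- c * t))) has_vector_derivative psi l \<xi> * complex_of_real (- c * exp (- c * t))) (at t)"
      by (intro has_vector_derivative_mult_right has_vector_derivative_of_real)
         (auto intro!: derivative_eq_intros simp flip: has_real_derivative_iff_has_vector_derivative)
    have "((\<lambda>t. psi l \<xi> * complex_of_real (exp (- c * t)) + duhamel c (nonlin u u l \<xi>) t) has_vector_derivative
        psi l \<xi> * complex_of_real (- c * exp (- c * t)) + (nonlin u u l \<xi> t - complex_of_real c * duhamel c (nonlin u u l \<xi>) t)) (at t)"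
      by (rule has_vector_derivative_add[OF 2 1])
    also have "psi l \<xi> * complex_of_real (- c * exp (- c * t)) + (nonlin u u l \<xi> t - complex_of_real c * duhamel c (nonlin u u l \<xi>) t) = g t \<xi>"
      using eq[of t l \<xi>] t by (simp add: g_def bilin_def c_def algebra_simps)
    finally show ?thesis
      by (rule has_vector_derivative_transform_within_open[where S = "{0<..}"]) (use t eq in \<open>auto simp: bilin_def c_def\<close>)
  qed
  ultimately show "\<exists>g\<in>symbol_class u. \<forall>t>0. \<forall>\<xi>. ((\<lambda>t. u l t \<xi>) has_vector_derivative g t \<xi>) (at t)" by blast
qed

end

section \<open>From Fourier fields to solutions\<close>

lemma weight4_integrable: "integrable lborel (weight 0 4)"
proof (rule Bochner_Integration.integrable_bound[OF inv_sq_integrable])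
  show "AE x in lborel. norm (weight 0 4 x) \<le> norm (inv_sq x)"
    using AE_lborel_singleton[of "0::real^3"]
  proof eventually_elim
    case (elim x)
    thus ?case using weight_le_inv_sq(1)[of 4 x] by simp
  qed
qed measurable

lemma smooth_continuous: assumes "smooth_on UNIV \<phi>" shows "continuous_on UNIV \<phi>"
proof -
  have "\<phi> differentiable (at x)" for x
    using assms unfolding smooth_on_def by (metis UNIV_I empty_subsetI iter_deriv.simps(1) list.set(1))
  thus ?thesis by (intro continuous_at_imp_continuous_on ballI differentiable_imp_continuous_within)
qed

text \<open>The summand for the empty list of directions gives the bound, and the other summands are nonnegative because the
  suprema are finite.\<close>

lemma schwartz_bound:
  fixes \<phi> :: "real^3 \<Rightarrow> complex"
  assumes "\<phi> \<in> schwartz"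
  shows "norm (\<phi> x) \<le> schwartz_seminorm 4 \<phi> * weight 0 4 x"
proof -
  have bdd: "bdd_above (range (\<lambda>x. (1 + norm x) ^ 4 * norm (iter_deriv vs \<phi> x)))" if vs: "set vs \<subseteq> Basis" for vs
  proof -
    have "bounded (range (\<lambda>x. complex_of_real ((1 + norm x) ^ 4) * iter_deriv vs \<phi> x))"
      using assms vs unfolding schwartz_def by blast
    then obtain B where "\<And>x. norm (complex_of_real ((1 + norm x) ^ 4) * iter_deriv vs \<phi> x) \<le> B"
      unfolding bounded_iff by auto
    hence "(1 + norm x) ^ 4 * norm (iter_deriv vs \<phi> x) \<le> B" for x
      by (simp add: norm_mult norm_power del: of_real_power) 
    thus ?thesis by (intro bdd_aboveI[of _ B]) auto
  qed
  have up: "(1 + norm x) ^ 4 * norm (iter_deriv vs \<phi> x) \<le> (SUP x. (1 + norm x) ^ 4 * norm (iter_deriv vs \<phi> x))"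
    if "set vs \<subseteq> Basis" for vs x
    by (rule cSUP_upper[OF _ bdd[OF that]]) simp
  have nn: "0 \<le> (SUP x. (1 + norm x) ^ 4 * norm (iter_deriv vs \<phi> x))" if "set vs \<subseteq> Basis" for vs
    using up[OF that, of 0] by (rule order_trans[rotated]) simp
  have "(1 + norm x) ^ 4 * norm (\<phi> x) \<le> (SUP x. (1 + norm x) ^ 4 * norm (iter_deriv [] \<phi> x))" using up[of "[]" x] by simp
  also have "\<dots> \<le> schwartz_seminorm 4 \<phi>" unfolding schwartz_seminorm_def
  proof (rule member_le_sum)
    show "finite {vs :: (real^3) list. set vs \<subseteq> Basis \<and> length vs \<le> 4}" by (rule finite_lists_length_le) simp
    show "[] \<in> {vs :: (real^3) list. set vs \<subseteq> Basis \<and> length vs \<le> 4}" by simp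
    fix vs :: "(real^3) list" assume "vs \<in> {vs. set vs \<subseteq> Basis \<and> length vs \<le> 4} - {[]}"
    hence "set vs \<subseteq> Basis" by blast
    thus "0 \<le> (SUP x. (1 + norm x) ^ 4 * norm (iter_deriv vs \<phi> x))" by (rule nn)
  qed
  finally have "norm (\<phi> x) * (1 + norm x) ^ 4 \<le> schwartz_seminorm 4 \<phi>" by (simp only: mult.commute)
  hence "norm (\<phi> x) \<le> schwartz_seminorm 4 \<phi> / (1 + norm x) ^ 4" by (simp only: pos_le_divide_eq[OF zero_less_power[OF one_norm_pos(1)]])
  thus ?thesis unfolding weight_def by simp
qed

lemma schwartz_integrable:
  fixes \<phi> :: "real^3 \<Rightarrow> complex"
  assumes "\<phi> \<in> schwartz" shows "integrable lborel \<phi>"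
proof (rule integrable_dominated[OF integrable_mult_right[OF weight4_integrable] _ schwartz_bound[OF assms]])
  have "smooth_on UNIV \<phi>" using assms by (simp add: schwartz_def)
  thus "\<phi> \<in> borel_measurable lborel" using borel_measurable_continuous_onI[OF smooth_continuous] by simp
qed

lemma test_integrable:
  fixes \<phi> :: "real^3 \<Rightarrow> complex"
  assumes "\<phi> \<in> test_functions" shows "integrable lborel \<phi>"
proof -
  obtain C where sm: "smooth_on UNIV \<phi>" and C: "compact C" "\<And>x. x \<notin> C \<Longrightarrow> \<phi> x = 0"
    using assms by (auto simp: test_functions_def)
  have "integrable lborel (\<lambda>x. indicator C x *\<^sub>R \<phi> x)"
    by (rule borel_integrable_compact[OF C(1) continuous_on_subset[OF smooth_continuous[OF sm]]]) simp
  moreover have "(\<lambda>x. indicator C x *\<^sub>R \<phi> x) = \<phi>" using C(2) by (auto simp: fun_eq_iff indicator_def)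
  ultimately show ?thesis by simp
qed

lemma cis_integrable:
  fixes \<phi> :: "real^3 \<Rightarrow> complex"
  assumes "integrable lborel \<phi>" shows "integrable lborel (\<lambda>x. cis (x \<bullet> \<xi>) * \<phi> x)"
proof (rule integrable_dominated[OF integrable_norm[OF assms]])
  have [measurable]: "\<phi> \<in> borel_measurable borel" using borel_measurable_integrable[OF assms] by simp
  show "(\<lambda>x. cis (x \<bullet> \<xi>) * \<phi> x) \<in> borel_measurable lborel" by measurable
qed (simp add: norm_mult)

lemma
  fixes \<phi> :: "real^3 \<Rightarrow> complex"
  assumes \<phi>: "integrable lborel \<phi>"
  shows inverse_fourier_lborel: "inverse_fourier \<phi> \<xi> = complex_of_real (1 / (2 * pi) ^ 3) * (LINT x|lborel. cis (x \<bullet> \<xi>) * \<phi> x)"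
    and inverse_fourier_measurable: "inverse_fourier \<phi> \<in> borel_measurable borel"
    and inverse_fourier_bound: "norm (inverse_fourier \<phi> \<xi>) \<le> 1 / (2 * pi) ^ 3 * (LINT x|lborel. norm (\<phi> x))"
proof -
  have [measurable]: "\<phi> \<in> borel_measurable borel" using borel_measurable_integrable[OF \<phi>] by simp
  show eq: "inverse_fourier \<phi> \<xi> = complex_of_real (1 / (2 * pi) ^ 3) * (LINT x|lborel. cis (x \<bullet> \<xi>) * \<phi> x)" for \<xi>
    unfolding inverse_fourier_def by (subst integral_completion) measurable
  have "(\<lambda>\<xi>. LINT x|lborel. cis (x \<bullet> \<xi>) * \<phi> x) \<in> borel_measurable borel"
    by (rule lborel.borel_measurable_lebesgue_integral) measurable
  thus "inverse_fourier \<phi> \<in> borel_measurable borel" unfolding eq[abs_def] by measurable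
  have "norm (LINT x|lborel. cis (x \<bullet> \<xi>) * \<phi> x) \<le> (LINT x|lborel. norm (\<phi> x))"
    by (rule order_trans[OF integral_norm_bound]) (simp add: norm_mult)
  thus "norm (inverse_fourier \<phi> \<xi>) \<le> 1 / (2 * pi) ^ 3 * (LINT x|lborel. norm (\<phi> x))"
    unfolding eq norm_mult by (intro mult_mono) (auto simp: norm_power norm_divide)
qed

definition fourier_pairing :: "(real^3 \<Rightarrow> complex) \<Rightarrow> (real^3) distribution" where
  "fourier_pairing g \<phi> = (LINT \<xi>|lebesgue. g \<xi> * inverse_fourier \<phi> \<xi>)"

lemma
  fixes g :: "real^3 \<Rightarrow> complex"
  assumes g: "integrable lborel g" and \<phi>: "integrable lborel \<phi>"
  shows fourier_pairing_integrable: "integrable lborel (\<lambda>\<xi>. g \<xi> * inverse_fourier \<phi> \<xi>)"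
    and fourier_pairing_lborel: "fourier_pairing g \<phi> = (LINT \<xi>|lborel. g \<xi> * inverse_fourier \<phi> \<xi>)"
    and fourier_pairing_bound: "norm (fourier_pairing g \<phi>) \<le> (LINT \<xi>|lborel. norm (g \<xi>)) * (1 / (2 * pi) ^ 3 * (LINT x|lborel. norm (\<phi> x)))"
proof -
  note [measurable] = inverse_fourier_measurable[OF \<phi>]
  have [measurable]: "g \<in> borel_measurable borel" using borel_measurable_integrable[OF g] by simp
  define B where "B = 1 / (2 * pi) ^ 3 * (LINT x|lborel. norm (\<phi> x))"
  have b: "norm (g \<xi> * inverse_fourier \<phi> \<xi>) \<le> norm (g \<xi>) * B" for \<xi>
    unfolding norm_mult B_def by (intro mult_left_mono inverse_fourier_bound[OF \<phi>]) auto
  have gi: "integrable lborel (\<lambda>\<xi>. norm (g \<xi>) * B)" by (intro integrable_mult_left integrable_norm g)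
  show i: "integrable lborel (\<lambda>\<xi>. g \<xi> * inverse_fourier \<phi> \<xi>)"
    by (rule integrable_dominated[OF gi _ b]) measurable
  show eq: "fourier_pairing g \<phi> = (LINT \<xi>|lborel. g \<xi> * inverse_fourier \<phi> \<xi>)"
    unfolding fourier_pairing_def by (subst integral_completion) measurable
  have "norm (fourier_pairing g \<phi>) \<le> (LINT \<xi>|lborel. norm (g \<xi>) * B)"
    unfolding eq by (rule norm_integral_dominated[OF gi _ b]) measurable
  thus "norm (fourier_pairing g \<phi>) \<le> (LINT \<xi>|lborel. norm (g \<xi>)) * (1 / (2 * pi) ^ 3 * (LINT x|lborel. norm (\<phi> x)))"
    by (simp add: B_def)
qed

lemma fourier_pairing_tempered:
  assumes g: "integrable lborel g" shows "tempered (fourier_pairing g)"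
  unfolding tempered_def
proof (intro conjI ballI allI)
  fix \<phi> \<eta> :: "real^3 \<Rightarrow> complex" assume "\<phi> \<in> schwartz" "\<eta> \<in> schwartz"
  hence i: "integrable lborel \<phi>" "integrable lborel \<eta>" by (auto intro: schwartz_integrable)
  have s: "integrable lborel (\<lambda>x. \<phi> x + \<eta> x)" using i by simp
  have "inverse_fourier (\<lambda>x. \<phi> x + \<eta> x) \<xi> = inverse_fourier \<phi> \<xi> + inverse_fourier \<eta> \<xi>" for \<xi>
    using cis_integrable i by (simp add: inverse_fourier_lborel[OF s] inverse_fourier_lborel[OF i(1)] inverse_fourier_lborel[OF i(2)] distrib_left)
  thus "fourier_pairing g (\<lambda>x. \<phi> x + \<eta> x) = fourier_pairing g \<phi> + fourier_pairing g \<eta>"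
    using fourier_pairing_integrable[OF g] i
    by (simp add: fourier_pairing_lborel[OF g] s distrib_left)
next
  fix \<phi> :: "real^3 \<Rightarrow> complex" and c assume "\<phi> \<in> schwartz"
  hence i: "integrable lborel \<phi>" by (rule schwartz_integrable)
  have s: "integrable lborel (\<lambda>x. c * \<phi> x)" using i by simp
  have "inverse_fourier (\<lambda>x. c * \<phi> x) \<xi> = c * inverse_fourier \<phi> \<xi>" for \<xi>
  proof -
    have "(LINT x|lborel. cis (x \<bullet> \<xi>) * (c * \<phi> x)) = (LINT x|lborel. c * (cis (x \<bullet> \<xi>) * \<phi> x))" by (simp add: mult_ac)
    thus ?thesis by (simp add: inverse_fourier_lborel[OF s] inverse_fourier_lborel[OF i])
  qed
  hence "(\<lambda>\<xi>. g \<xi> * inverse_fourier (\<lambda>x. c * \<phi> x) \<xi>) = (\<lambda>\<xi>. c * (g \<xi> * inverse_fourier \<phi> \<xi>))" by (simp add: mult_ac)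
  thus "fourier_pairing g (\<lambda>x. c * \<phi> x) = c * fourier_pairing g \<phi>"
    by (simp add: fourier_pairing_lborel[OF g] s i)
next
  define G where "G = (LINT \<xi>|lborel. norm (g \<xi>)) * (1 / (2 * pi) ^ 3)"
  have G0: "G \<ge> 0" unfolding G_def by simp
  have "norm (fourier_pairing g \<phi>) \<le> (G * (LINT x|lborel. weight 0 4 x)) * schwartz_seminorm 4 \<phi>" if "\<phi> \<in> schwartz" for \<phi>
  proof -
    have "norm (fourier_pairing g \<phi>) \<le> G * (LINT x|lborel. norm (\<phi> x))"
      using fourier_pairing_bound[OF g schwartz_integrable[OF that]] by (simp add: G_def mult_ac)
    also have "(LINT x|lborel. norm (\<phi> x)) \<le> (LINT x|lborel. schwartz_seminorm 4 \<phi> * weight 0 4 x)"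
      by (intro integral_mono integrable_norm schwartz_integrable that integrable_mult_right weight4_integrable schwartz_bound)
    hence "G * (LINT x|lborel. norm (\<phi> x)) \<le> G * (LINT x|lborel. schwartz_seminorm 4 \<phi> * weight 0 4 x)" using G0 by (rule mult_left_mono)
    finally show ?thesis by (simp add: mult_ac)
  qed
  thus "\<exists>C N. \<forall>\<phi>\<in>schwartz. norm (fourier_pairing g \<phi>) \<le> C * schwartz_seminorm N \<phi>" by blast
qed

lemma fourier_pairing_transform:
  assumes g: "integrable lborel g" shows "has_fourier_transform (fourier_pairing g) g"
proof -
  have "integrable lebesgue g" using g borel_measurable_integrable[OF g] by (subst integrable_completion) auto
  hence "set_integrable lebesgue C g" if "compact C" for C
    using that unfolding set_integrable_def by (intro integrable_mult_indicator) (auto simp: lmeasurable_compact fmeasurableD)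
  thus ?thesis unfolding has_fourier_transform_def locally_integrable_def by (auto simp: fourier_pairing_def)
qed

lemma envelope_le_weight: "envelope \<xi> \<le> weight 0 4 \<xi> / norm \<xi>"
proof -
  have "weight 1 4 \<xi> \<le> weight 0 4 \<xi>" unfolding weight_def by (intro divide_right_mono) auto
  thus ?thesis unfolding envelope_def by (intro divide_right_mono) auto
qed

lemma envelope_integrable_bound:
  fixes g :: "real^3 \<Rightarrow> complex"
  assumes "g \<in> borel_measurable borel" and b: "\<And>\<xi>. norm (g \<xi>) \<le> C * envelope \<xi>" and C: "C \<ge> 0"
  shows "integrable lborel g"
proof (rule integrable_dominated[OF integrable_mult_right[OF weight_int]])
  show "norm (g \<xi>) \<le> C * (weight 0 4 \<xi> / norm \<xi>)" for \<xi>
    using b[of \<xi>] mult_left_mono[OF envelope_le_weight[of \<xi>] C] by linarith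
qed (use assms in auto)

lemma fourier_pairing_PM2:
  assumes m: "g \<in> borel_measurable borel" and b: "\<And>\<xi>. norm (g \<xi>) \<le> C * envelope \<xi>" and C: "C \<ge> 0"
  shows "fourier_pairing g \<in> PM2"
proof -
  have g: "integrable lborel g" by (rule envelope_integrable_bound[OF assms])
  have k: "(norm \<xi>)\<^sup>2 * envelope \<xi> \<le> 1" for \<xi>
  proof (cases "\<xi> = 0")
    case False
    have "norm \<xi> \<le> (1 + norm \<xi>)^1" by simp
    also have "\<dots> \<le> (1 + norm \<xi>)^4" by (intro power_increasing) auto
    finally have "norm \<xi> / (1 + norm \<xi>)^4 \<le> 1" by (simp add: divide_le_eq)
    moreover have "exp (- norm \<xi>) \<le> 1" by simp
    ultimately have "exp (- norm \<xi>) * (norm \<xi> / (1 + norm \<xi>)^4) \<le> 1 * 1" by (intro mult_mono) auto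
    moreover have "(norm \<xi>)\<^sup>2 * envelope \<xi> = exp (- norm \<xi>) * (norm \<xi> / (1 + norm \<xi>)^4)"
      using False by (simp add: envelope_def weight_def power2_eq_square)
    ultimately show ?thesis by simp
  qed simp
  have "esssup lebesgue (\<lambda>\<xi>. ennreal ((norm \<xi>)\<^sup>2 * norm (g \<xi>))) \<le> ennreal C"
  proof (rule esssup_I)
    have "(\<lambda>\<xi>. ennreal ((norm \<xi>)\<^sup>2 * norm (g \<xi>))) \<in> borel_measurable borel" using m by measurable
    thus "(\<lambda>\<xi>. ennreal ((norm \<xi>)\<^sup>2 * norm (g \<xi>))) \<in> borel_measurable lebesgue" by (intro measurable_completion) simp
    have "(norm \<xi>)\<^sup>2 * norm (g \<xi>) \<le> C" for \<xi>
    proof -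
      have "(norm \<xi>)\<^sup>2 * norm (g \<xi>) \<le> (norm \<xi>)\<^sup>2 * (C * envelope \<xi>)" by (intro mult_left_mono b) auto
      also have "\<dots> = C * ((norm \<xi>)\<^sup>2 * envelope \<xi>)" by simp
      also have "\<dots> \<le> C * 1" by (intro mult_left_mono k C)
      finally show ?thesis by simp
    qed
    thus "AE \<xi> in lebesgue. ennreal ((norm \<xi>)\<^sup>2 * norm (g \<xi>)) \<le> ennreal C" by (intro AE_I2 ennreal_leI)
  qed
  also have "\<dots> < \<infinity>" by simp
  finally show ?thesis unfolding PM2_def using fourier_pairing_tempered[OF g] fourier_pairing_transform[OF g] by blast
qed

lemma fourier_pairing_physical:
  fixes g :: "real^3 \<Rightarrow> complex"
  assumes g: "integrable lborel g" and \<phi>: "integrable lborel \<phi>"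
  shows "fourier_pairing g \<phi> = (LINT x|lebesgue. (LINT \<xi>|lborel. cis (x \<bullet> \<xi>) * (complex_of_real (1 / (2 * pi) ^ 3) * g \<xi>)) * \<phi> x)"
proof -
  define c where "c = complex_of_real (1 / (2 * pi) ^ 3)"
  have [measurable]: "g \<in> borel_measurable borel" "\<phi> \<in> borel_measurable borel"
    using borel_measurable_integrable[OF g] borel_measurable_integrable[OF \<phi>] by simp_all
  define F where "F x \<xi> = cis (x \<bullet> \<xi>) * (c * g \<xi>) * \<phi> x" for x \<xi>
  have Fm: "case_prod F \<in> borel_measurable (lborel \<Otimes>\<^sub>M lborel)" unfolding F_def by measurable
  have iF: "integrable (lborel \<Otimes>\<^sub>M lborel) (case_prod F)"
  proof (rule lborel_pair.Fubini_integrable[OF Fm])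
    have "(\<lambda>x. LINT \<xi>|lborel. norm (case_prod F (x, \<xi>))) = (\<lambda>x. (LINT \<xi>|lborel. norm (c * g \<xi>)) * norm (\<phi> x))"
      by (simp add: F_def norm_mult)
    thus "integrable lborel (\<lambda>x. LINT \<xi>|lborel. norm (case_prod F (x, \<xi>)))"
      using \<phi> by simp
    show "AE x in lborel. integrable lborel (\<lambda>\<xi>. case_prod F (x, \<xi>))"
    proof (rule AE_I2)
      fix x
      have "integrable lborel (\<lambda>\<xi>. cis (\<xi> \<bullet> x) * (c * g \<xi>))" by (intro cis_integrable integrable_mult_right g)
      thus "integrable lborel (\<lambda>\<xi>. case_prod F (x, \<xi>))" unfolding F_def by (simp add: inner_commute)
    qed
  qed
  have "fourier_pairing g \<phi> = (LINT \<xi>|lborel. g \<xi> * (c * (LINT x|lborel. cis (x \<bullet> \<xi>) * \<phi> x)))"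
    unfolding fourier_pairing_lborel[OF g \<phi>] inverse_fourier_lborel[OF \<phi>] c_def ..
  also have "\<dots> = (LINT \<xi>|lborel. LINT x|lborel. F x \<xi>)"
  proof (rule Bochner_Integration.integral_cong[OF refl])
    fix \<xi>
    have "(LINT x|lborel. F x \<xi>) = (LINT x|lborel. (c * g \<xi>) * (cis (x \<bullet> \<xi>) * \<phi> x))" unfolding F_def by (simp only: mult_ac)
    thus "g \<xi> * (c * (LINT x|lborel. cis (x \<bullet> \<xi>) * \<phi> x)) = (LINT x|lborel. F x \<xi>)" by simp
  qed
  also have "\<dots> = (LINT x|lborel. LINT \<xi>|lborel. F x \<xi>)" by (rule lborel_pair.Fubini_integral[OF iF])
  also have "\<dots> = (LINT x|lborel. (LINT \<xi>|lborel. cis (x \<bullet> \<xi>) * (c * g \<xi>)) * \<phi> x)" unfolding F_def by simp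
  also have "\<dots> = (LINT x|lebesgue. (LINT \<xi>|lborel. cis (x \<bullet> \<xi>) * (c * g \<xi>)) * \<phi> x)"
  proof (rule integral_completion[symmetric])
    have "(\<lambda>x. LINT \<xi>|lborel. cis (x \<bullet> \<xi>) * (c * g \<xi>)) \<in> borel_measurable lborel"
      by (rule lborel.borel_measurable_lebesgue_integral) measurable
    thus "(\<lambda>x. (LINT \<xi>|lborel. cis (x \<bullet> \<xi>) * (c * g \<xi>)) * \<phi> x) \<in> borel_measurable lborel" by measurable
  qed
  finally show ?thesis unfolding c_def .
qed

text \<open>Truncating a Borel version where it exceeds \<open>|\<xi>|\<close> keeps the bound everywhere and changes it only on
  a null set.\<close>

lemma borel_kernel_version:
  fixes M :: kernels
  assumes m: "\<And>k j l. M k j l \<in> borel_measurable lebesgue" and le: "\<And>k j l \<xi>. norm (M k j l \<xi>) \<le> norm \<xi>"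
  shows "\<exists>M'. borel_kernels M' \<and> (AE \<xi> in lebesgue. \<forall>k j l. M k j l \<xi> = M' k j l \<xi>)"
proof -
  have "\<exists>f\<in>borel_measurable lborel. AE \<xi> in lborel. M k j l \<xi> = f \<xi>" for k j l
  proof -
    have "(\<lambda>\<xi>. Re (M k j l \<xi>)) \<in> borel_measurable lebesgue" "(\<lambda>\<xi>. Im (M k j l \<xi>)) \<in> borel_measurable lebesgue" using m by measurable
    from this[THEN completion_ex_borel_measurable_real] obtain a b where
      ab: "a \<in> borel_measurable lborel" "b \<in> borel_measurable lborel" "AE \<xi> in lborel. Re (M k j l \<xi>) = a \<xi>" "AE \<xi> in lborel. Im (M k j l \<xi>) = b \<xi>" by blast
    have "AE \<xi> in lborel. M k j l \<xi> = Complex (a \<xi>) (b \<xi>)" using ab(3,4) by eventually_elim (simp add: complex_eq_iff)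
    moreover have "(\<lambda>\<xi>. Complex (a \<xi>) (b \<xi>)) \<in> borel_measurable lborel" using ab(1,2) unfolding Complex_eq by measurable
    ultimately show ?thesis by (intro bexI[of _ "\<lambda>\<xi>. Complex (a \<xi>) (b \<xi>)"])
  qed
  hence ex: "\<exists>f. f \<in> borel_measurable lborel \<and> (AE \<xi> in lborel. M k j l \<xi> = f \<xi>)" for k j l by blast
  define f where "f k j l = (SOME f. f \<in> borel_measurable lborel \<and> (AE \<xi> in lborel. M k j l \<xi> = f \<xi>))" for k j l
  have f: "f k j l \<in> borel_measurable lborel" "AE \<xi> in lborel. M k j l \<xi> = f k j l \<xi>" for k j l
    using someI_ex[OF ex[of k j l]] unfolding f_def by blast+
  define M' :: kernels where "M' k j l \<xi> = (if norm (f k j l \<xi>) \<le> norm \<xi> then f k j l \<xi> else 0)" for k j l \<xi>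
  have "borel_kernels M'"
  proof
    fix k j l
    have [measurable]: "f k j l \<in> borel_measurable borel" using f(1) by simp
    show "M' k j l \<in> borel_measurable borel" unfolding M'_def by measurable
    show "norm (M' k j l \<xi>) \<le> norm \<xi>" for \<xi> by (simp add: M'_def)
  qed
  moreover have "AE \<xi> in lborel. \<forall>k j l. M k j l \<xi> = M' k j l \<xi>"
  proof -
    have "AE \<xi> in lborel. M k j l \<xi> = M' k j l \<xi>" for k j l
      using f(2)[of k j l] by eventually_elim (metis M'_def le)
    thus ?thesis by (simp add: AE_all_countable)
  qed
  ultimately show ?thesis by (blast intro: AE_completion)
qed

text \<open>The distribution at time \<open>t\<close> is the inverse Fourier transform of \<open>u l t\<close>. The equation
  holds for \<open>M0\<close> at each \<open>\<xi>\<close> where its values agree with the Borel kernels.\<close>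

lemma (in borel_kernels) regular_solution:
  assumes ae: "AE \<xi> in lebesgue. \<forall>k j l. M0 k j l \<xi> = M k j l \<xi>"
    and u: "admissible u" and eq: "\<And>l t \<xi>. t \<ge> 0 \<Longrightarrow> u l t \<xi> = psi l \<xi> * complex_of_real (exp (- (norm \<xi>)\<^sup>2 * t)) + bilin u u l t \<xi>"
  shows "generates_regular_global_solution M0 psi"
proof -
  obtain C where C: "C \<ge> 0" "\<And>l t \<xi>. t \<ge> 0 \<Longrightarrow> norm (u l t \<xi>) \<le> C * envelope \<xi>" using u by (rule admissible_bound) auto
  have ui: "integrable lborel (u l t)" if "t \<ge> 0" for l t
    using envelope_integrable_bound[OF admissible_meas1[OF u] C(2)[OF that] C(1)] .
  define U where "U l t = fourier_pairing (u l t)" for l t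
  have reg: "field_regular u" by (rule solution_field_regular[OF u eq])
  have eqn: "gns_equation M0 psi u l \<xi> t" if M: "\<forall>k j l. M0 k j l \<xi> = M k j l \<xi>" and t: "t \<ge> 0" for l \<xi> t
  proof -
    have gi: "integrable lborel (gns_integrand M0 u l \<xi> s)" and gI: "(LINT q|lebesgue. gns_integrand M0 u l \<xi> s q) = nonlin u u l \<xi> s"
      and gL: "integrable lebesgue (gns_integrand M0 u l \<xi> s)" if s: "s \<ge> 0" for s
    proof -
      have i: "integrable lborel (\<lambda>q. M0 k j l \<xi> * u k s q * u j s (\<xi> - q))" for k j
        using admissible_conv_integrable[OF u u s, of k j \<xi>] by (simp add: mult.assoc)
      show gi: "integrable lborel (gns_integrand M0 u l \<xi> s)" unfolding gns_integrand_def[abs_def]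
        by (intro Bochner_Integration.integrable_sum i)
      have "(LINT q|lborel. gns_integrand M0 u l \<xi> s q) = nonlin u u l \<xi> s"
        unfolding gns_integrand_def nonlin_def conv_def using i
        by (simp add: Bochner_Integration.integral_sum M mult.assoc)
      thus "(LINT q|lebesgue. gns_integrand M0 u l \<xi> s q) = nonlin u u l \<xi> s"
        using borel_measurable_integrable[OF gi] by (subst integral_completion) auto
      show "integrable lebesgue (gns_integrand M0 u l \<xi> s)" using gi borel_measurable_integrable[OF gi] by (subst integrable_completion) auto
    qed
    define E where "E s = complex_of_real (exp (- (norm \<xi>)\<^sup>2 * (t - s))) * nonlin u u l \<xi> s" for s
    have Ei: "integrable lborel (\<lambda>s. indicator {0..t} s *\<^sub>R E s)"
      using duhamel_integrable[OF nonlin_cont[OF u u], of t "(norm \<xi>)\<^sup>2" l \<xi>] unfolding set_integrable_def E_def .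
    have cong: "indicator {0..t} s *\<^sub>R (complex_of_real (exp (- (norm \<xi>)\<^sup>2 * (t - s))) * (LINT q|lebesgue. gns_integrand M0 u l \<xi> s q)) = indicator {0..t} s *\<^sub>R E s" for s
      by (cases "s \<in> {0..t}") (auto simp: E_def gI)
    have "set_integrable lebesgue {0..t} (\<lambda>s. complex_of_real (exp (- (norm \<xi>)\<^sup>2 * (t - s))) * (LINT q|lebesgue. gns_integrand M0 u l \<xi> s q))"
      unfolding set_integrable_def cong using Ei borel_measurable_integrable[OF Ei] by (subst integrable_completion) auto
    moreover have "(LINT s:{0..t}|lebesgue. complex_of_real (exp (- (norm \<xi>)\<^sup>2 * (t - s))) * (LINT q|lebesgue. gns_integrand M0 u l \<xi> s q)) = bilin u u l t \<xi>"
      unfolding set_lebesgue_integral_def cong using borel_measurable_integrable[OF Ei]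
      by (subst integral_completion) (auto simp: bilin_def duhamel_def set_lebesgue_integral_def E_def)
    ultimately show ?thesis unfolding gns_equation_def using gL eq[OF t] by auto
  qed
  have "gns_solution M0 psi {0..} U"
    unfolding gns_solution_def
  proof (intro conjI exI[of _ u] allI ballI)
    show "U l t \<in> PM2" if "t \<in> {0..}" for l t
      unfolding U_def using that by (intro fourier_pairing_PM2[OF admissible_meas1[OF u] C(2) C(1)]) auto
    show "has_fourier_transform (U l t) (u l t)" if "t \<in> {0..}" for l t
      unfolding U_def using that by (intro fourier_pairing_transform ui) auto
    show "continuous_on {0..} (\<lambda>t. u l t \<xi>)" for l \<xi> by (rule admissible_cont[OF u])
    show "AE \<xi> in lebesgue. \<forall>t\<in>{0..}. gns_equation M0 psi u l \<xi> t" for l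
      using ae by eventually_elim (auto intro: eqn)
  qed
  moreover have "smooth_for_positive_times (U l)" for l
    unfolding smooth_for_positive_times_def
  proof (intro exI conjI allI impI ballI)
    define g where "g = (\<lambda>t \<xi>. complex_of_real (1 / (2 * pi) ^ 3) * u l t \<xi>)"
    have "g \<in> symbol_class u" unfolding g_def by (intro symbol_class.mult symbol_class.base poly_growth_const)
    thus "smooth_on (UNIV \<times> {0<..}) (physical g)" by (rule physical_smooth[OF reg])
    fix t :: real and \<phi> :: "real^3 \<Rightarrow> complex" assume t: "t > 0" "\<phi> \<in> test_functions"
    show "U l t \<phi> = (LINT x|lebesgue. physical g (x, t) * \<phi> x)"
      using fourier_pairing_physical[OF ui test_integrable[OF t(2)], of t l] t by (simp add: U_def physical_def g_def)
  qed
  ultimately show ?thesis unfolding generates_regular_global_solution_def by blast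
qed

section \<open>Cubes and initial data\<close>

lemma half_open_cube_borel [measurable]: "half_open_cube a h \<in> sets borel"
proof -
  have "half_open_cube a h = (\<Inter>i. {\<xi>. a $ i \<le> \<xi> $ i} \<inter> {\<xi>. \<xi> $ i < a $ i + h})" by (auto simp: half_open_cube_def)
  also have "\<dots> \<in> sets borel"
    by (intro sets.countable_INT'' sets.Int borel_closed borel_open closed_Collect_le open_Collect_less continuous_intros) auto
  finally show ?thesis .
qed

lemma cart_box_measure:
  assumes "h \<ge> 0"
  shows "emeasure lborel (cbox a (\<chi> i. a $ i + h) :: (real^3) set) = ennreal (h^3)"
    and "emeasure lborel (box a (\<chi> i. a $ i + h) :: (real^3) set) = ennreal (h^3)"
proof -
  have p: "(\<Prod>b\<in>Basis. ((\<chi> i. a $ i + h) - a) \<bullet> b) = h^3"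
    by (subst prod.reindex_cong[where l = "\<lambda>i. axis i 1" and B = "UNIV :: 3 set" and h = "\<lambda>_. h"])
       (auto simp: Basis_vec_def axis_eq_axis inj_on_def inner_axis)
  have l: "a \<bullet> b \<le> (\<chi> i. a $ i + h) \<bullet> b" if "b \<in> Basis" for b
    using that assms by (auto simp: Basis_vec_def inner_axis)
  show "emeasure lborel (cbox a (\<chi> i. a $ i + h) :: (real^3) set) = ennreal (h^3)"
    using emeasure_lborel_cbox[of a "\<chi> i. a $ i + h"] l p by simp
  show "emeasure lborel (box a (\<chi> i. a $ i + h) :: (real^3) set) = ennreal (h^3)"
    using emeasure_lborel_box[of a "\<chi> i. a $ i + h"] l p by simp
qed

lemma half_open_cube_emeasure:
  assumes "h > 0" shows "emeasure lborel (half_open_cube a h) = ennreal (h^3)"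
proof (rule antisym)
  have "half_open_cube a h \<subseteq> cbox a (\<chi> i. a $ i + h)" by (auto simp: half_open_cube_def mem_box_cart less_imp_le)
  hence "emeasure lborel (half_open_cube a h) \<le> emeasure lborel (cbox a (\<chi> i. a $ i + h))" by (rule emeasure_mono) simp
  thus "emeasure lborel (half_open_cube a h) \<le> ennreal (h^3)" using cart_box_measure(1)[of h a] assms by simp
  have "box a (\<chi> i. a $ i + h) \<subseteq> half_open_cube a h" by (auto simp: half_open_cube_def mem_box_cart less_imp_le)
  hence "emeasure lborel (box a (\<chi> i. a $ i + h)) \<le> emeasure lborel (half_open_cube a h)" by (rule emeasure_mono) simp
  thus "ennreal (h^3) \<le> emeasure lborel (half_open_cube a h)" using cart_box_measure(2)[of h a] assms by simp
qed

lemma partition_volume: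
  assumes "congruent_cube_partition n A S"
  obtains h where "h > 0" "\<And>s. s \<in> {1..n} \<Longrightarrow> \<exists>a. A s = half_open_cube a h" "emeasure lborel S = ennreal (n * h^3)"
proof -
  obtain h where h: "h > 0" "\<And>s. s \<in> {1..n} \<Longrightarrow> \<exists>a. A s = half_open_cube a h" and d: "disjoint_family_on A {1..n}" and U: "(\<Union>s\<in>{1..n}. A s) = S"
    using assms by (auto simp: congruent_cube_partition_def)
  have As: "A s \<in> sets lborel" if "s \<in> {1..n}" for s using h(2)[OF that] by auto
  have "emeasure lborel S = (\<Sum>s\<in>{1..n}. emeasure lborel (A s))"
    unfolding U[symmetric] by (rule sum_emeasure[symmetric]) (use As d in auto)
  also have "\<dots> = (\<Sum>s\<in>{1..n}. ennreal (h^3))"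
    by (intro sum.cong refl) (metis h half_open_cube_emeasure)
  also have "\<dots> = ennreal (n * h^3)" using h(1) by (simp add: ennreal_of_nat_eq_real_of_nat flip: ennreal_mult)
  finally show ?thesis using h that by blast
qed

lemma partition_subset: "congruent_cube_partition n A S \<Longrightarrow> s \<in> {1..n} \<Longrightarrow> A s \<subseteq> S"
  unfolding congruent_cube_partition_def by auto

lemma partition_disjoint: "congruent_cube_partition n A S \<Longrightarrow> disjoint_family_on A {1..n}"
  unfolding congruent_cube_partition_def by auto

definition sgn_of :: "(3 \<times> nat \<times> nat) set \<Rightarrow> 3 \<Rightarrow> nat \<Rightarrow> nat \<Rightarrow> real" where
  "sgn_of S j s p = (if (j, s, p) \<in> S then 1 else - 1)"

locale cells =
  fixes \<kappa> :: real and K :: nat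
    and H :: "nat \<Rightarrow> (real^3) set" and W :: "nat \<Rightarrow> nat \<Rightarrow> (real^3) set"
    and \<Theta> :: "3 \<Rightarrow> nat \<Rightarrow> nat \<Rightarrow> complex" and L :: real
  assumes kappa: "\<kappa> > 0" and K_pos: "K > 0" and L0: "L \<ge> 0"
    and blocks: "congruent_cube_partition K H (R12 \<inter> slab_complement \<kappa> \<inter> upper_half)"
    and subblocks: "\<And>s. s \<in> {1..K} \<Longrightarrow> congruent_cube_partition (K^2) (W s) (H s)"
    and Theta: "\<And>j s p. j \<in> {1, 2} \<Longrightarrow> s \<in> {1..K} \<Longrightarrow> p \<in> {1..K^2} \<Longrightarrow> norm (\<Theta> j s p) = L"
begin

abbreviation upper_region where "upper_region \<equiv> R12 \<inter> slab_complement \<kappa> \<inter> upper_half"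

lemma W_subset: assumes "s \<in> {1..K}" "p \<in> {1..K^2}" shows "W s p \<subseteq> upper_region"
proof -
  have "W s p \<subseteq> H s" by (rule partition_subset[OF subblocks[OF assms(1)] assms(2)])
  moreover have "H s \<subseteq> upper_region" by (rule partition_subset[OF blocks assms(1)])
  ultimately show ?thesis by blast
qed

lemma R12_norm: assumes "\<xi> \<in> R12" shows "1 \<le> norm \<xi>" "norm \<xi> \<le> 4" "\<And>i. \<bar>\<xi> $ i\<bar> \<le> 2"
proof -
  have le: "\<And>i. -2 \<le> \<xi> $ i \<and> \<xi> $ i < 2" and "\<exists>i. \<not> (-1 \<le> \<xi> $ i \<and> \<xi> $ i < 1)" using assms by (auto simp: R12_def)
  then obtain i where "\<not> (-1 \<le> \<xi> $ i \<and> \<xi> $ i < 1)" by blast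
  hence "1 \<le> \<bar>\<xi> $ i\<bar>" by linarith
  thus "1 \<le> norm \<xi>" using component_le_norm_cart[of \<xi> i] by linarith
  show a: "\<bar>\<xi> $ i\<bar> \<le> 2" for i using le[of i] by linarith
  have "(norm \<xi>)\<^sup>2 = (\<Sum>i\<in>UNIV. (\<xi> $ i)\<^sup>2)" by (simp add: norm_vec_def L2_set_def sum_nonneg)
  also have "\<dots> \<le> (\<Sum>i\<in>(UNIV::3 set). 4)" 
  proof (rule sum_mono)
    fix i show "(\<xi> $ i)\<^sup>2 \<le> 4" using power_mono[OF a[of i], of 2] by simp
  qed
  also have "\<dots> \<le> 4\<^sup>2" by simp
  finally show "norm \<xi> \<le> 4" by (rule power2_le_imp_le) simp
qed

text \<open>A comparison of volumes: \<open>K\<close> blocks of side \<open>h\<close> fill a region inside a cube of side 4, and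
  \<open>K\<^sup>2\<close> subblocks of side \<open>g\<close> fill a block, so
  \<open>(K g)^3 = K h^3 \<le> 64\<close>.\<close>

lemma cell_cube: assumes "s \<in> {1..K}" "p \<in> {1..K^2}"
  obtains a h where "W s p = half_open_cube a h" "h > 0" "h \<le> 4 / K"
proof -
  obtain h :: real where h: "h > 0" "\<And>s. s \<in> {1..K} \<Longrightarrow> \<exists>a. H s = half_open_cube a h" "emeasure lborel upper_region = ennreal (real K * h^3)"
    using blocks by (rule partition_volume) (rule that)
  obtain g :: real where g: "g > 0" "\<And>p. p \<in> {1..K^2} \<Longrightarrow> \<exists>a. W s p = half_open_cube a g" "emeasure lborel (H s) = ennreal (real (K^2) * g^3)"
    using subblocks[OF assms(1)] by (rule partition_volume) (rule that)
  define lo :: "real^3" where "lo = (\<chi> i. -2)"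
  have "upper_region \<subseteq> cbox lo (\<chi> i. lo $ i + 4)"
  proof
    fix \<xi> assume "\<xi> \<in> upper_region"
    hence "\<bar>\<xi> $ i\<bar> \<le> 2" for i using R12_norm(3) by blast
    hence "-2 \<le> \<xi> $ i \<and> \<xi> $ i \<le> 2" for i by (simp add: abs_le_iff) (metis minus_le_iff)
    thus "\<xi> \<in> cbox lo (\<chi> i. lo $ i + 4)" by (simp add: mem_box_cart lo_def)
  qed
  hence "emeasure lborel upper_region \<le> emeasure lborel (cbox lo (\<chi> i. lo $ i + 4))"
    by (rule emeasure_mono) simp
  hence "ennreal (K * h^3) \<le> ennreal (4^3)" using cart_box_measure(1)[of 4 lo] h(3) by simp
  hence "K * h^3 \<le> 4^3" by (subst (asm) ennreal_le_iff) auto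
  hence Kh: "K * h^3 \<le> 64" by simp
  obtain a where "H s = half_open_cube a h" using h(2) assms by blast
  hence "ennreal (h^3) = ennreal (real (K^2) * g^3)" using g(3) half_open_cube_emeasure[OF h(1)] by simp
  hence "h^3 = (real K)^2 * g^3" using h(1) g(1) by (subst (asm) ennreal_inj) auto
  hence "(K * g)^3 \<le> 4^3" using Kh by (simp add: power_mult_distrib power2_eq_square power3_eq_cube mult_ac)
  hence "K * g \<le> 4" using g(1) by (subst (asm) power_mono_iff) auto
  hence "g \<le> 4 / K" using K_pos by (simp add: field_simps)
  moreover obtain b where "W s p = half_open_cube b g" using g(2)[OF assms(2)] by blast
  ultimately show ?thesis using g(1) by (intro that)
qed

lemma W_borel [measurable]: assumes "s \<in> {1..K}" "p \<in> {1..K^2}" shows "W s p \<in> sets borel"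
proof -
  obtain a h where "W s p = half_open_cube a h" using assms by (rule cell_cube)
  thus ?thesis by simp
qed

lemma W_emeasure: assumes "s \<in> {1..K}" "p \<in> {1..K^2}" shows "emeasure lborel (W s p) \<le> ennreal (64 / K^3)"
proof -
  obtain a h where h: "W s p = half_open_cube a h" "h > 0" "h \<le> 4 / K" using assms by (rule cell_cube)
  have "h^3 \<le> (4/K)^3" using h by (intro power_mono) auto
  also have "\<dots> = 64 / K^3" by (simp add: power_divide)
  finally show ?thesis using h half_open_cube_emeasure[OF h(2)] by (simp add: ennreal_leI)
qed

lemma W_diff: assumes "s \<in> {1..K}" "p \<in> {1..K^2}" "x \<in> W s p" "y \<in> W s p" shows "\<bar>x $ i - y $ i\<bar> < 4 / K"
proof -
  obtain a h where h: "W s p = half_open_cube a h" "h > 0" "h \<le> 4 / K" using assms(1,2) by (rule cell_cube)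
  have "a $ i \<le> x $ i \<and> x $ i < a $ i + h" "a $ i \<le> y $ i \<and> y $ i < a $ i + h"
    using assms(3,4) by (auto simp: h(1) half_open_cube_def)
  thus ?thesis using h(3) by linarith
qed

lemma W_disjoint:
  assumes "s \<in> {1..K}" "p \<in> {1..K^2}" "s' \<in> {1..K}" "p' \<in> {1..K^2}" "x \<in> W s p" "x \<in> W s' p'"
  shows "s = s' \<and> p = p'"
proof -
  have "W s p \<subseteq> H s" "W s' p' \<subseteq> H s'"
    by (rule partition_subset[OF subblocks[OF assms(1)] assms(2)], rule partition_subset[OF subblocks[OF assms(3)] assms(4)])
  hence x: "x \<in> H s \<inter> H s'" using assms(5,6) by auto
  have s: "s = s'" using disjoint_family_onD[OF partition_disjoint[OF blocks] assms(1,3)] x by blast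
  from disjoint_family_onD[OF partition_disjoint[OF subblocks[OF assms(1)]] assms(2,4)] show ?thesis using s assms(5,6) by auto
qed

lemma upper_part_in:
  assumes "s \<in> {1..K}" "p \<in> {1..K^2}" "\<xi> \<in> W s p"
  shows "upper_part K W \<Theta> \<rho> j \<xi> = complex_of_real (\<rho> j s p) * \<Theta> j s p / complex_of_real ((norm \<xi>)\<^sup>2)"
proof -
  define c where "c = complex_of_real (\<rho> j s p) * \<Theta> j s p / complex_of_real ((norm \<xi>)\<^sup>2)"
  have "upper_part K W \<Theta> \<rho> j \<xi> = (\<Sum>s'\<in>{1..K}. \<Sum>p'\<in>{1..K^2}. if s' = s then (if p' = p then c else 0) else 0)"
    unfolding upper_part_def
  proof (intro sum.cong refl)
    fix s' p' assume sp: "s' \<in> {1..K}" "p' \<in> {1..K^2}"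
    show "(if \<xi> \<in> W s' p' then complex_of_real (\<rho> j s' p') * \<Theta> j s' p' / complex_of_real ((norm \<xi>)\<^sup>2) else 0)
        = (if s' = s then (if p' = p then c else 0) else 0)"
    proof (cases "s' = s \<and> p' = p")
      case False
      hence "\<xi> \<notin> W s' p'" using W_disjoint[OF assms(1,2) sp assms(3)] by blast
      thus ?thesis using False by auto
    qed (use assms in \<open>simp add: c_def\<close>)
  qed
  also have "\<dots> = (\<Sum>s'\<in>{1..K}. if s' = s then c else 0)"
    by (intro sum.cong refl) (use assms in auto)
  also have "\<dots> = c" using assms by simp
  finally show ?thesis unfolding c_def .
qed

lemma upper_part_out:
  assumes "\<And>s p. s \<in> {1..K} \<Longrightarrow> p \<in> {1..K^2} \<Longrightarrow> \<xi> \<notin> W s p"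
  shows "upper_part K W \<Theta> \<rho> j \<xi> = 0"
  unfolding upper_part_def by (intro sum.neutral ballI) (use assms in auto)

lemma upper_part_bound:
  assumes j: "j \<in> {1, 2}" and \<rho>: "\<And>j s p. \<bar>\<rho> j s p\<bar> \<le> 1"
  shows "norm (upper_part K W \<Theta> \<rho> j \<xi>) \<le> L" and "upper_part K W \<Theta> \<rho> j \<xi> \<noteq> 0 \<Longrightarrow> \<xi> \<in> R12"
proof -
  have "norm (upper_part K W \<Theta> \<rho> j \<xi>) \<le> L \<and> (upper_part K W \<Theta> \<rho> j \<xi> \<noteq> 0 \<longrightarrow> \<xi> \<in> R12)"
  proof (cases "\<exists>s p. s \<in> {1..K} \<and> p \<in> {1..K^2} \<and> \<xi> \<in> W s p")
    case True
    then obtain s p where sp: "s \<in> {1..K}" "p \<in> {1..K^2}" "\<xi> \<in> W s p" by blast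
    have R: "\<xi> \<in> R12" using W_subset[OF sp(1,2)] sp(3) by blast
    have "1 \<le> (norm \<xi>)\<^sup>2" using R12_norm(1)[OF R] by (simp add: one_le_power)
    moreover have "\<bar>\<rho> j s p\<bar> * L \<le> 1 * L" using \<rho> L0 by (intro mult_right_mono)
    ultimately have "\<bar>\<rho> j s p\<bar> * L / (norm \<xi>)\<^sup>2 \<le> L / 1" using L0 by (intro frac_le) auto
    thus ?thesis using R by (simp add: upper_part_in[OF sp] norm_mult norm_divide norm_power Theta[OF j sp(1,2)])
  next
    case False
    thus ?thesis using upper_part_out[of \<xi> \<rho> j] L0 by auto
  qed
  thus "norm (upper_part K W \<Theta> \<rho> j \<xi>) \<le> L" "upper_part K W \<Theta> \<rho> j \<xi> \<noteq> 0 \<Longrightarrow> \<xi> \<in> R12" by auto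
qed

text \<open>A bound for all components of the Fourier transform of the datum. The summand 1 only serves to have
  \<open>amp \<ge> 1\<close>, so that powers of \<open>amp\<close> can be compared.\<close>

definition amp :: real where "amp = 1 + (2 + 8 / \<kappa>) * L"

lemma amp_ge1: "amp \<ge> 1" unfolding amp_def using kappa L0 by simp

text \<open>In the third component the division by \<open>\<xi> $ 3\<close> costs \<open>1/\<kappa>\<close>, which is where
  the slab around the plane \<open>\<xi> $ 3 = 0\<close> has to be removed.\<close>

lemma psi_hat_bound:
  assumes \<rho>: "\<And>j s p. \<bar>\<rho> j s p\<bar> \<le> 1"
  shows "norm (psi_hat \<kappa> K W \<Theta> \<rho> l \<xi>) \<le> amp"
    and "psi_hat \<kappa> K W \<Theta> \<rho> l \<xi> \<noteq> 0 \<Longrightarrow> 1 \<le> norm \<xi> \<and> norm \<xi> \<le> 4"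
proof -
  have p12: "norm (psi_hat12 K W \<Theta> \<rho> j \<xi>) \<le> 2 * L" if "j \<in> {1, 2}" for j
    unfolding psi_hat12_def using upper_part_bound(1)[of j \<rho> \<xi>, OF that \<rho>] upper_part_bound(1)[of j \<rho> "- \<xi>", OF that \<rho>]
      norm_triangle_ineq[of "upper_part K W \<Theta> \<rho> j \<xi>" "cnj (upper_part K W \<Theta> \<rho> j (- \<xi>))"] by simp
  have s12: "1 \<le> norm \<xi> \<and> norm \<xi> \<le> 4" if "j \<in> {1, 2}" "psi_hat12 K W \<Theta> \<rho> j \<xi> \<noteq> 0" for j
  proof -
    have "upper_part K W \<Theta> \<rho> j \<xi> \<noteq> 0 \<or> upper_part K W \<Theta> \<rho> j (- \<xi>) \<noteq> 0" using that(2) by (auto simp: psi_hat12_def)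
    hence "\<xi> \<in> R12 \<or> - \<xi> \<in> R12" using upper_part_bound(2)[of j \<rho> \<xi>, OF that(1) \<rho>] upper_part_bound(2)[of j \<rho> "- \<xi>", OF that(1) \<rho>] by blast
    thus ?thesis using R12_norm(1,2)[of \<xi>] R12_norm(1,2)[of "- \<xi>"] by auto
  qed
  have l12: "l \<in> {1, 2}" if "l \<noteq> 3" using that exhaust_3[of l] by auto
  have a2: "2 * L \<le> amp" unfolding amp_def using kappa L0 by (simp add: distrib_right)
  show "norm (psi_hat \<kappa> K W \<Theta> \<rho> l \<xi>) \<le> amp"
  proof (cases "l = 3")
    case False
    thus ?thesis using p12[OF l12[OF False]] a2 by (simp add: psi_hat_def)
  next
    case True
    show ?thesis
    proof (cases "\<xi> \<in> R12 \<inter> slab_complement \<kappa>")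
      case R: True
      have k3: "\<bar>\<xi> $ 3\<bar> \<ge> \<kappa>" using R by (simp add: slab_complement_def)
      define z where "z = complex_of_real (\<xi> $ 1) * psi_hat12 K W \<Theta> \<rho> 1 \<xi> + complex_of_real (\<xi> $ 2) * psi_hat12 K W \<Theta> \<rho> 2 \<xi>"
      have "norm z \<le> \<bar>\<xi> $ 1\<bar> * norm (psi_hat12 K W \<Theta> \<rho> 1 \<xi>) + \<bar>\<xi> $ 2\<bar> * norm (psi_hat12 K W \<Theta> \<rho> 2 \<xi>)"
        unfolding z_def by (rule order_trans[OF norm_triangle_ineq]) (simp add: norm_mult)
      also have "\<dots> \<le> 2 * (2 * L) + 2 * (2 * L)"
        using R R12_norm(3)[of \<xi>] p12 by (intro add_mono mult_mono) auto
      finally have z: "norm z \<le> 8 * L" by simp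
      have "norm (psi_hat \<kappa> K W \<Theta> \<rho> l \<xi>) = norm z / \<bar>\<xi> $ 3\<bar>"
        using R True by (simp add: psi_hat_def z_def norm_mult norm_divide)
      also have "\<dots> \<le> (8 * L) / \<kappa>" using z k3 kappa L0 by (intro frac_le) auto
      also have "\<dots> \<le> amp" unfolding amp_def using L0 by (simp add: distrib_right)
      finally show ?thesis .
    next
      case False
      have "psi_hat \<kappa> K W \<Theta> \<rho> l \<xi> = 0" using True False by (auto simp: psi_hat_def)
      thus ?thesis using amp_ge1 by simp
    qed
  qed
  assume nz: "psi_hat \<kappa> K W \<Theta> \<rho> l \<xi> \<noteq> 0"
  show "1 \<le> norm \<xi> \<and> norm \<xi> \<le> 4"
  proof (cases "l = 3")
    case True
    hence "\<xi> \<in> R12" using nz by (auto simp: psi_hat_def split: if_splits)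
    thus ?thesis using R12_norm by blast
  next
    case False
    thus ?thesis using nz s12[OF l12[OF False]] by (simp add: psi_hat_def)
  qed
qed

lemma R12_borel [measurable]: "R12 \<in> sets borel"
proof -
  have "R12 = half_open_cube (\<chi> i. -2) 4 - half_open_cube (\<chi> i. -1) 2" by (auto simp: R12_def half_open_cube_def)
  also have "\<dots> \<in> sets borel" by (intro sets.Diff half_open_cube_borel)
  finally show ?thesis .
qed

lemma psi_hat_measurable: "psi_hat \<kappa> K W \<Theta> \<rho> l \<in> borel_measurable borel"
proof -
  have u: "(\<lambda>\<xi>. upper_part K W \<Theta> \<rho> j (f \<xi>)) \<in> borel_measurable borel" if [measurable]: "f \<in> borel_measurable borel" for j and f :: "real^3 \<Rightarrow> real^3"
    unfolding upper_part_def
  proof (intro borel_measurable_sum)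
    fix s p assume "s \<in> {1..K}" "p \<in> {1..K^2}"
    hence [measurable]: "W s p \<in> sets borel" by (rule W_borel)
    show "(\<lambda>\<xi>. if f \<xi> \<in> W s p then complex_of_real (\<rho> j s p) * \<Theta> j s p / complex_of_real ((norm (f \<xi>))\<^sup>2) else 0) \<in> borel_measurable borel"
      by measurable
  qed
  have c: "cnj \<in> borel_measurable borel" by (intro borel_measurable_continuous_onI continuous_intros)
  have p12: "psi_hat12 K W \<Theta> \<rho> j \<in> borel_measurable borel" for j
    unfolding psi_hat12_def[abs_def] by (intro borel_measurable_add u measurable_compose[OF u c]) auto
  note [measurable] = p12
  have [measurable]: "slab_complement \<kappa> \<in> sets borel" unfolding slab_complement_def by measurable
  have "(\<lambda>\<xi>::real^3. \<xi> $ i) \<in> borel_measurable borel" for i by (intro borel_measurable_continuous_onI continuous_intros)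
  note [measurable] = this
  have e: "psi_hat \<kappa> K W \<Theta> \<rho> l = (\<lambda>\<xi>. if l = 3 then
        if \<xi> \<in> R12 \<and> \<xi> \<in> slab_complement \<kappa>
        then - (1 / complex_of_real (\<xi> $ 3)) *
               (complex_of_real (\<xi> $ 1) * psi_hat12 K W \<Theta> \<rho> 1 \<xi> +
                complex_of_real (\<xi> $ 2) * psi_hat12 K W \<Theta> \<rho> 2 \<xi>)
        else 0
      else psi_hat12 K W \<Theta> \<rho> l \<xi>)" by (auto simp: psi_hat_def fun_eq_iff)
  show ?thesis unfolding e by measurable
qed

text \<open>The value at \<open>\<xi>\<close> is linear in the signs of the subblock containing \<open>\<xi>\<close> or
  \<open>-\<xi>\<close> and depends on no others. With \<open>c = 1\<close> this is locality, with
  \<open>c = -1\<close> oddness.\<close>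

lemma psi_hat_scale:
  assumes "\<And>j s p. j \<in> {1, 2} \<Longrightarrow> s \<in> {1..K} \<Longrightarrow> p \<in> {1..K^2} \<Longrightarrow> \<xi> \<in> W s p \<or> - \<xi> \<in> W s p \<Longrightarrow> \<rho>' j s p = c * \<rho> j s p"
  shows "psi_hat \<kappa> K W \<Theta> \<rho>' l \<xi> = complex_of_real c * psi_hat \<kappa> K W \<Theta> \<rho> l \<xi>"
proof -
  have u: "upper_part K W \<Theta> \<rho>' j x = complex_of_real c * upper_part K W \<Theta> \<rho> j x" if "j \<in> {1, 2}" "x = \<xi> \<or> x = - \<xi>" for j x
    unfolding upper_part_def sum_distrib_left
    by (intro sum.cong refl) (use assms[OF that(1)] that(2) in auto)
  have p: "psi_hat12 K W \<Theta> \<rho>' j \<xi> = complex_of_real c * psi_hat12 K W \<Theta> \<rho> j \<xi>" if "j \<in> {1, 2}" for j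
    using u[OF that] by (simp add: psi_hat12_def distrib_left)
  have l12: "l \<in> {1, 2}" if "l \<noteq> 3" using that exhaust_3[of l] by auto
  show ?thesis
    by (cases "l = 3") (auto simp: psi_hat_def p[OF l12] p algebra_simps)
qed

end

section \<open>The self-convolution as a quadratic form in the signs\<close>

lemma emeasure_reflect:
  fixes X :: "'a::euclidean_space set"
  assumes "X \<in> sets borel" shows "emeasure lborel ((\<lambda>q. \<xi> - q) -` X) = emeasure lborel X"
proof -
  have "emeasure lborel X = emeasure (distr lborel borel (\<lambda>q. \<xi> - q)) X" by (simp add: lborel_distr_reflect)
  also have "\<dots> = emeasure lborel ((\<lambda>q. \<xi> - q) -` X)" using assms by (subst emeasure_distr) auto
  finally show ?thesis ..
qed

lemma indicator_integrable:
  assumes "X \<in> sets borel" "emeasure lborel X \<le> ennreal c" "c \<ge> 0"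
  shows "integrable lborel (indicator X :: 'a::euclidean_space \<Rightarrow> real)" "(LINT x|lborel. (indicator X x :: real)) \<le> c"
proof -
  have "emeasure lborel X < \<infinity>" using assms(2) by (rule le_less_trans) simp
  thus "integrable lborel (indicator X :: 'a \<Rightarrow> real)" using assms(1) by (intro integrable_real_indicator) auto
  have "measure lborel X \<le> c" unfolding measure_def using assms by (intro enn2real_leI) auto
  thus "(LINT x|lborel. (indicator X x :: real)) \<le> c" by simp
qed

lemma indicator_reflect_integrable:
  assumes "X \<in> sets borel" "emeasure lborel X \<le> ennreal c" "c \<ge> 0"
  shows "integrable lborel (\<lambda>q. indicator X (\<xi> - q) :: real)" "(LINT q|lborel. (indicator X (\<xi> - q :: 'a::euclidean_space) :: real)) \<le> c"
proof -
  show "integrable lborel (\<lambda>q. indicator X (\<xi> - q) :: real)"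
    by (rule integrable_reflect[OF indicator_integrable(1)[OF assms]])
  show "(LINT q|lborel. (indicator X (\<xi> - q) :: real)) \<le> c"
    using indicator_integrable(2)[OF assms] assms(1) by (subst integral_reflect) auto
qed

lemma
  fixes f g :: "real^3 \<Rightarrow> complex"
  assumes [measurable]: "f \<in> borel_measurable borel" "g \<in> borel_measurable borel"
    and B: "\<And>q. norm (f q) \<le> B" "\<And>q. norm (g q) \<le> B" "B \<ge> 0"
    and supp: "\<And>q. f q \<noteq> 0 \<Longrightarrow> norm q \<le> 4" "\<And>q. g q \<noteq> 0 \<Longrightarrow> norm q \<le> 4"
  shows conv_integrable_supp: "integrable lborel (\<lambda>q. f q * g (\<xi> - q))"
    and conv_bound_supp: "norm (conv f g \<xi>) \<le> 512 * B\<^sup>2"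
    and conv_supp: "norm \<xi> > 8 \<Longrightarrow> conv f g \<xi> = 0"
proof -
  have e: "emeasure lborel (cball (0::real^3) 4) \<le> ennreal 512" using emeasure_cball_le[of 4] by simp
  note ind = indicator_integrable[OF _ e]
  have bd: "norm (f q * g (\<xi> - q)) \<le> B\<^sup>2 * indicator (cball 0 4) q" for q
  proof (cases "f q = 0")
    case False
    thus ?thesis using supp(1) B unfolding norm_mult by (auto simp: power2_eq_square intro!: mult_mono)
  qed auto
  have i2: "integrable lborel (\<lambda>q::real^3. B\<^sup>2 * indicator (cball 0 4) q)" by (intro integrable_mult_right ind) auto
  show i: "integrable lborel (\<lambda>q. f q * g (\<xi> - q))"
    by (rule integrable_dominated[OF i2 _ bd]) measurable
  have "norm (conv f g \<xi>) \<le> (LINT q|lborel. B\<^sup>2 * indicator (cball (0::real^3) 4) q)" unfolding conv_def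
    by (rule norm_integral_dominated[OF i2 _ bd]) measurable
  also have "\<dots> = B\<^sup>2 * (LINT q|lborel. indicator (cball (0::real^3) 4) q)" by (rule integral_mult_right_zero)
  also have "\<dots> \<le> B\<^sup>2 * 512" by (intro mult_left_mono ind) auto
  finally show "norm (conv f g \<xi>) \<le> 512 * B\<^sup>2" by simp
  assume "norm \<xi> > 8"
  hence z: "f q * g (\<xi> - q) = 0" for q
    using supp(1)[of q] supp(2)[of "\<xi> - q"] norm_triangle_ineq[of q "\<xi> - q"] by (cases "f q = 0"; cases "g (\<xi> - q) = 0") auto
  show "conv f g \<xi> = 0" unfolding conv_def z by simp
qed

text \<open>Changing both factors on a set \<open>T\<close> affects the integrand only where \<open>q\<close> or
  \<open>\<xi> - q\<close> lies in \<open>T\<close>.\<close>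

lemma conv_diff_bound:
  fixes f g f' g' :: "real^3 \<Rightarrow> complex"
  assumes m: "f \<in> borel_measurable borel" "g \<in> borel_measurable borel" "f' \<in> borel_measurable borel" "g' \<in> borel_measurable borel"
    and B: "\<And>q. norm (f q) \<le> B" "\<And>q. norm (g q) \<le> B" "\<And>q. norm (f' q) \<le> B" "\<And>q. norm (g' q) \<le> B" "B \<ge> 0"
    and supp: "\<And>q. f q \<noteq> 0 \<Longrightarrow> norm q \<le> 4" "\<And>q. g q \<noteq> 0 \<Longrightarrow> norm q \<le> 4"
      "\<And>q. f' q \<noteq> 0 \<Longrightarrow> norm q \<le> 4" "\<And>q. g' q \<noteq> 0 \<Longrightarrow> norm q \<le> 4"
    and T: "T \<in> sets borel" "emeasure lborel T \<le> ennreal c" "c \<ge> 0"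
    and eq: "\<And>q. q \<notin> T \<Longrightarrow> f' q = f q" "\<And>q. q \<notin> T \<Longrightarrow> g' q = g q"
  shows "norm (conv f' g' \<xi> - conv f g \<xi>) \<le> 4 * B\<^sup>2 * c"
proof -
  note i = conv_integrable_supp[OF m(1,2) B(1,2,5) supp(1,2), of \<xi>] conv_integrable_supp[OF m(3,4) B(3,4,5) supp(3,4), of \<xi>]
  define D where "D q = 2 * B\<^sup>2 * (indicator T q + indicator T (\<xi> - q))" for q
  have Di: "integrable lborel D" unfolding D_def
    by (intro integrable_mult_right Bochner_Integration.integrable_add indicator_integrable[OF T] indicator_reflect_integrable[OF T])
  have bd: "norm (f' q * g' (\<xi> - q) - f q * g (\<xi> - q)) \<le> D q" for q
  proof (cases "q \<in> T \<or> \<xi> - q \<in> T")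
    case True
    have "norm (f' q * g' (\<xi> - q) - f q * g (\<xi> - q)) \<le> norm (f' q * g' (\<xi> - q)) + norm (f q * g (\<xi> - q))" by (rule norm_triangle_ineq4)
    also have "\<dots> \<le> B * B + B * B" unfolding norm_mult by (intro add_mono mult_mono B) auto
    also have "\<dots> = 2 * B\<^sup>2 * 1" by (simp add: power2_eq_square)
    also have "\<dots> \<le> D q" unfolding D_def using True by (intro mult_left_mono) (auto simp: indicator_def)
    finally show ?thesis .
  qed (auto simp: eq D_def)
  have "conv f' g' \<xi> - conv f g \<xi> = (LINT q|lborel. f' q * g' (\<xi> - q) - f q * g (\<xi> - q))"
    unfolding conv_def using i by simp
  also have "norm \<dots> \<le> (LINT q|lborel. D q)"
    by (rule norm_integral_dominated[OF Di _ bd]) (use i in auto)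
  also have "\<dots> = 2 * B\<^sup>2 * ((LINT q|lborel. indicator T q) + (LINT q|lborel. indicator T (\<xi> - q)))"
    unfolding D_def integral_mult_right_zero
    by (subst Bochner_Integration.integral_add[OF indicator_integrable(1)[OF T] indicator_reflect_integrable(1)[OF T]]) simp
  also have "\<dots> \<le> 2 * B\<^sup>2 * (c + c)"
    by (intro mult_left_mono add_mono indicator_integrable(2)[OF T] indicator_reflect_integrable(2)[OF T]) auto
  finally show ?thesis by simp
qed

text \<open>The bounds on the heat flow hold for any kernels; the zero kernels make them available where no kernels are given.\<close>

lemma zero_kernels: "borel_kernels (\<lambda>_ _ _ _. 0)" by unfold_locales auto

context cells begin

definition idx :: "(3 \<times> nat \<times> nat) set" where "idx = {1, 2} \<times> {1..K} \<times> {1..K^2}"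

lemma finite_idx: "finite idx" by (simp add: idx_def)

lemma card_idx: "card idx = 2 * K^3"
  by (simp add: idx_def card_cartesian_product power3_eq_cube power2_eq_square)

definition psi :: "(3 \<times> nat \<times> nat) set \<Rightarrow> 3 \<Rightarrow> real^3 \<Rightarrow> complex" where
  "psi S = psi_hat \<kappa> K W \<Theta> (sgn_of S)"

lemma shell: "borel_kernels M \<Longrightarrow> shell_datum M (psi S) amp"
proof -
  assume "borel_kernels M"
  then interpret borel_kernels M .
  have s: "\<bar>sgn_of S j s p\<bar> \<le> 1" for j s p by (simp add: sgn_of_def)
  show ?thesis
    by unfold_locales (auto simp: psi_def psi_hat_measurable amp_ge1 intro!: psi_hat_bound(1) s dest: psi_hat_bound(2)[OF s])
qed

abbreviation flow where "flow S \<equiv> heat (psi S)"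

lemmas shell0 = shell[OF zero_kernels]

lemma flow_facts:
  assumes "t \<ge> 0"
  shows "flow S l t \<in> borel_measurable borel" "norm (flow S l t q) \<le> amp * exp (- t)" "flow S l t q \<noteq> 0 \<Longrightarrow> norm q \<le> 4"
proof -
  interpret Z: shell_datum "\<lambda>_ _ _ _. 0" "psi S" amp by (rule shell0)
  show "flow S l t \<in> borel_measurable borel" by (rule admissible_meas1[OF Z.admissible_heat])
  show "norm (flow S l t q) \<le> amp * exp (- t)" by (rule Z.heat_le[OF assms])
  show "flow S l t q \<noteq> 0 \<Longrightarrow> norm q \<le> 4" using Z.heat_supp by blast
qed

lemma flow_admissible: "admissible (flow S)"
proof -
  interpret Z: shell_datum "\<lambda>_ _ _ _. 0" "psi S" amp by (rule shell0)
  show ?thesis by (rule Z.admissible_heat)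
qed

lemma amp_exp: "amp * exp (- t) \<ge> 0" using amp_ge1 by simp

text \<open>The factor \<open>exp s\<close> compensates half of the decay of the convolution. The other half makes bounds
  uniform in \<open>s\<close>, and integrating against the exponential density removes the factor again.\<close>

definition chaos :: "(3 \<times> nat \<times> nat) set \<Rightarrow> 3 \<Rightarrow> 3 \<Rightarrow> real \<Rightarrow> real^3 \<Rightarrow> complex" where
  "chaos S k j s \<xi> = complex_of_real (exp s) * conv (flow S k s) (flow S j s) \<xi>"

lemma exp_sq: "exp s * (amp * exp (- s))\<^sup>2 = amp\<^sup>2 * exp (- s)" for s :: real
proof -
  have "exp s * (amp * exp (- s))\<^sup>2 = amp\<^sup>2 * (exp s * exp (-s) * exp (- s))" by (simp add: power2_eq_square)
  also have "exp s * exp (-s) = 1" by (simp add: mult_exp_exp)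
  finally show ?thesis by simp
qed

lemma chaos_bound: assumes "s \<ge> 0" shows "norm (chaos S k j s \<xi>) \<le> 512 * amp\<^sup>2"
proof -
  have "norm (conv (flow S k s) (flow S j s) \<xi>) \<le> 512 * (amp * exp (- s))\<^sup>2"
    using flow_facts[OF assms] amp_exp by (intro conv_bound_supp) auto
  hence "norm (chaos S k j s \<xi>) \<le> exp s * (512 * (amp * exp (- s))\<^sup>2)" unfolding chaos_def norm_mult by (intro mult_mono) auto
  also have "\<dots> = 512 * (exp s * (amp * exp (- s))\<^sup>2)" by simp
  also have "\<dots> = 512 * (amp\<^sup>2 * exp (- s))" by (simp only: exp_sq)
  also have "\<dots> \<le> 512 * (amp\<^sup>2 * 1)" using assms by (intro mult_left_mono) auto
  finally show ?thesis by simp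
qed

lemma chaos_supp: assumes "s \<ge> 0" "norm \<xi> > 8" shows "conv (flow S k s) (flow S j s) \<xi> = 0"
  using flow_facts[OF assms(1)] amp_exp assms(2) by (intro conv_supp[where B = "amp * exp (- s)"]) auto

lemma chaos_measurable:
  "(\<lambda>x. chaos S k j (fst x) (snd x)) \<in> borel_measurable (lborel \<Otimes>\<^sub>M lborel)"
  unfolding chaos_def by (intro borel_measurable_times admissible_conv_measurable flow_admissible) measurable

lemma psi_insert:
  assumes "q \<notin> W s0 p0" "- q \<notin> W s0 p0"
  shows "psi (insert (j0, s0, p0) S) l q = psi S l q"
proof -
  have "psi (insert (j0, s0, p0) S) l q = complex_of_real 1 * psi S l q"
    unfolding psi_def by (rule psi_hat_scale) (use assms in \<open>auto simp: sgn_of_def\<close>)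
  thus ?thesis by simp
qed

lemma chaos_diff:
  assumes i: "i \<in> idx" and s: "s \<ge> 0"
  shows "norm (chaos (insert i S) k j s \<xi> - chaos S k j s \<xi>) \<le> 512 * amp\<^sup>2 / K^3"
proof -
  obtain j0 s0 p0 where i0: "i = (j0, s0, p0)" and sp: "s0 \<in> {1..K}" "p0 \<in> {1..K^2}" using i by (auto simp: idx_def)
  note Wb = W_borel[OF sp] and We = W_emeasure[OF sp]
  define T where "T = W s0 p0 \<union> (\<lambda>q. 0 - q) -` W s0 p0"
  have Rb: "(\<lambda>q. 0 - q) -` W s0 p0 \<in> sets borel" using measurable_sets[of "\<lambda>q. 0 - q" "borel" borel "W s0 p0"] Wb by simp
  have Tb: "T \<in> sets borel" unfolding T_def by (intro sets.Un Wb Rb)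
  have "emeasure lborel T \<le> emeasure lborel (W s0 p0) + emeasure lborel ((\<lambda>q. 0 - q) -` W s0 p0)"
    unfolding T_def by (intro emeasure_subadditive) (simp_all only: sets_lborel Wb Rb)
  also have "\<dots> \<le> ennreal (64 / K^3) + ennreal (64 / K^3)"
    unfolding emeasure_reflect[OF Wb] by (intro add_mono We)
  also have "\<dots> = ennreal (128 / K^3)" by (simp flip: ennreal_plus)
  finally have Te: "emeasure lborel T \<le> ennreal (128 / K^3)" .
  have eq: "flow (insert i S) l s q = flow S l s q" if "q \<notin> T" for l q
  proof -
    have "q \<notin> W s0 p0" "- q \<notin> W s0 p0" using that by (auto simp: T_def)
    from psi_insert[OF this] show ?thesis by (simp add: heat_def i0)
  qed
  have "norm (conv (flow (insert i S) k s) (flow (insert i S) j s) \<xi> - conv (flow S k s) (flow S j s) \<xi>) \<le> 4 * (amp * exp (- s))\<^sup>2 * (128 / K^3)"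
    using flow_facts[OF s] amp_exp eq by (intro conv_diff_bound[OF _ _ _ _ _ _ _ _ _ _ _ _ _ Tb Te]) auto
  hence "norm (chaos (insert i S) k j s \<xi> - chaos S k j s \<xi>) \<le> exp s * (4 * (amp * exp (- s))\<^sup>2 * (128 / K^3))"
    unfolding chaos_def right_diff_distrib[symmetric] norm_mult by (intro mult_mono) auto
  also have "\<dots> = 512 / K^3 * (exp s * (amp * exp (- s))\<^sup>2)" by simp
  also have "\<dots> = 512 / K^3 * (amp\<^sup>2 * exp (- s))" by (simp only: exp_sq)
  also have "\<dots> \<le> 512 / K^3 * (amp\<^sup>2 * 1)" using s by (intro mult_left_mono) auto
  finally show ?thesis by simp
qed

text \<open>Flipping all signs attached to the subblocks that contain \<open>q\<close> or \<open>-q\<close> reverses the first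
  factor. If \<open>\<xi> - q\<close> or its reflection lay in one of these subblocks, then \<open>\<xi>\<close> or
  \<open>2 q - \<xi>\<close> would be a difference of two points of a cube of side at most \<open>4/K\<close>,
  contrary to the hypotheses. So the second factor is unchanged and the sum equals its negative.\<close>

lemma product_mean_zero:
  assumes \<xi>: "\<exists>i. \<bar>\<xi> $ i\<bar> \<ge> 4 / K" and q: "\<exists>i. \<bar>2 * q $ i - \<xi> $ i\<bar> \<ge> 4 / K"
  shows "(\<Sum>S\<in>Pow idx. flow S k s q * flow S j s (\<xi> - q)) = 0"
proof -
  define T where "T = {(j, s, p) \<in> idx. q \<in> W s p \<or> - q \<in> W s p}"
  \<comment> \<open>The flip is symmetric difference with the indices whose subblock contains \<open>q\<close> or \<open>-q\<close>.\<close>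
  define fl where "fl S = (S - T) \<union> (T - S)" for S
  have Ti: "T \<subseteq> idx" by (auto simp: T_def)
  have ff: "fl (fl S) = S" for S by (auto simp: fl_def)
  have fP: "fl S \<in> Pow idx" if "S \<in> Pow idx" for S using that Ti by (auto simp: fl_def)
  have bij: "bij_betw fl (Pow idx) (Pow idx)"
    by (rule bij_betw_byWitness[where f' = fl]) (use ff fP in auto)
  have 1: "psi (fl S) l q = - psi S l q" for S l
  proof -
    have "psi (fl S) l q = complex_of_real (-1) * psi S l q"
      unfolding psi_def by (rule psi_hat_scale) (auto simp: sgn_of_def fl_def T_def idx_def)
    thus ?thesis by simp
  qed
  have 2: "psi (fl S) l (\<xi> - q) = psi S l (\<xi> - q)" for S l
  proof -
    have no: "(j, s, p) \<notin> T" if sp: "s \<in> {1..K}" "p \<in> {1..K^2}" and w: "\<xi> - q \<in> W s p \<or> - (\<xi> - q) \<in> W s p" for j s p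
    proof
      assume "(j, s, p) \<in> T"
      hence w': "q \<in> W s p \<or> - q \<in> W s p" by (auto simp: T_def)
      obtain i where i: "\<bar>\<xi> $ i\<bar> \<ge> 4 / K" using \<xi> by blast
      obtain i' where i': "\<bar>2 * q $ i' - \<xi> $ i'\<bar> \<ge> 4 / K" using q by blast
      have W: "\<bar>x $ i - y $ i\<bar> < 4 / K" "\<bar>x $ i' - y $ i'\<bar> < 4 / K" if "x \<in> W s p" "y \<in> W s p" for x y
        using W_diff[OF sp that] by blast+
      from w w' show False
      proof (elim disjE)
        assume "\<xi> - q \<in> W s p" "q \<in> W s p" thus False using W(2)[of q "\<xi> - q"] i' by simp
      next
        assume "\<xi> - q \<in> W s p" "- q \<in> W s p" thus False using W(1)[of "\<xi> - q" "- q"] i by simp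
      next
        assume "- (\<xi> - q) \<in> W s p" "q \<in> W s p" thus False using W(1)[of q "- (\<xi> - q)"] i by simp
      next
        assume "- (\<xi> - q) \<in> W s p" "- q \<in> W s p" thus False using W(2)[of "- (\<xi> - q)" "- q"] i' by simp
      qed
    qed
    have "psi (fl S) l (\<xi> - q) = complex_of_real 1 * psi S l (\<xi> - q)"
      unfolding psi_def
    proof (rule psi_hat_scale)
      fix j s p assume "j \<in> {1, 2::3}" "s \<in> {1..K}" "p \<in> {1..K^2}" "\<xi> - q \<in> W s p \<or> - (\<xi> - q) \<in> W s p"
      from no[OF this(2-4), of j] show "sgn_of (fl S) j s p = 1 * sgn_of S j s p" by (auto simp: sgn_of_def fl_def)
    qed
    thus ?thesis by simp
  qed
  have "(\<Sum>S\<in>Pow idx. flow S k s q * flow S j s (\<xi> - q)) = (\<Sum>S\<in>Pow idx. flow (fl S) k s q * flow (fl S) j s (\<xi> - q))"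
    by (rule sum.reindex_bij_betw[OF bij, symmetric])
  also have "\<dots> = (\<Sum>S\<in>Pow idx. - (flow S k s q * flow S j s (\<xi> - q)))"
    by (simp add: heat_def 1 2)
  also have "\<dots> = - (\<Sum>S\<in>Pow idx. flow S k s q * flow S j s (\<xi> - q))" by (rule sum_negf)
  finally show ?thesis by (simp add: equal_neg_zero)
qed

text \<open>By \<open>product_mean_zero\<close> the mean of the integrand vanishes outside a cube of side \<open>4/K\<close>
  around \<open>\<xi>/2\<close>.\<close>

lemma chaos_mean:
  assumes \<xi>: "\<exists>i. \<bar>\<xi> $ i\<bar> \<ge> 4 / K" and s: "s \<ge> 0"
  shows "norm (\<Sum>S\<in>Pow idx. chaos S k j s \<xi>) \<le> 64 * amp\<^sup>2 / K^3 * 2 ^ card idx"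
proof -
  define G where "G q = (\<Sum>S\<in>Pow idx. flow S k s q * flow S j s (\<xi> - q))" for q
  define B where "B = amp * exp (- s)"
  \<comment> \<open>\<open>Q\<close> is the closed cube of side \<open>4/K\<close> centred at \<open>\<xi>/2\<close>.\<close>
  define lo :: "real^3" where "lo = (\<chi> i. \<xi> $ i / 2 - 2 / K)"
  define Q where "Q = cbox lo (\<chi> i. lo $ i + 4 / K)"
  have Qe: "emeasure lborel Q \<le> ennreal (64 / K^3)" unfolding Q_def
    by (subst cart_box_measure(1)) (auto simp: power_divide)
  have Qb: "Q \<in> sets borel" by (simp add: Q_def)
  have i: "integrable lborel (\<lambda>q. flow S k s q * flow S j s (\<xi> - q))" for S
    using flow_facts[OF s] amp_exp by (intro conv_integrable_supp[where B = B]) (auto simp: B_def)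
  have Gi: "integrable lborel G" unfolding G_def by (intro Bochner_Integration.integrable_sum i)
  have Gb: "norm (G q) \<le> 2 ^ card idx * B\<^sup>2 * indicator Q q" for q
  proof (cases "q \<in> Q")
    case True
    have "norm (G q) \<le> (\<Sum>S\<in>Pow idx. B * B)" unfolding G_def
      by (rule sum_norm_le) (use flow_facts[OF s] amp_exp in \<open>auto simp: norm_mult B_def intro!: mult_mono\<close>)
    also have "\<dots> = 2 ^ card idx * B\<^sup>2" by (simp add: card_Pow finite_idx power2_eq_square)
    finally show ?thesis using True by simp
  next
    case False
    then obtain i where "q $ i < lo $ i \<or> q $ i > lo $ i + 4 / K" by (auto simp: Q_def mem_box_cart not_le)
    hence "\<bar>2 * q $ i - \<xi> $ i\<bar> \<ge> 4 / K" by (auto simp: lo_def)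
    hence "G q = 0" unfolding G_def using product_mean_zero[OF \<xi>] by blast
    thus ?thesis by simp
  qed
  have i2: "integrable lborel (\<lambda>q. 2 ^ card idx * B\<^sup>2 * indicator Q q)"
    by (intro integrable_mult_right indicator_integrable[OF Qb Qe]) simp
  have "(\<Sum>S\<in>Pow idx. chaos S k j s \<xi>) = complex_of_real (exp s) * (LINT q|lborel. G q)"
    unfolding chaos_def conv_def G_def sum_distrib_left[symmetric] using i by (simp add: Bochner_Integration.integral_sum)
  hence "norm (\<Sum>S\<in>Pow idx. chaos S k j s \<xi>) = exp s * norm (LINT q|lborel. G q)" by (simp add: norm_mult)
  also have "norm (LINT q|lborel. G q) \<le> (LINT q|lborel. 2 ^ card idx * B\<^sup>2 * indicator Q q)"
    by (rule norm_integral_dominated[OF i2 borel_measurable_integrable[OF Gi] Gb])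
  also have "\<dots> = 2 ^ card idx * B\<^sup>2 * (LINT q|lborel. indicator Q q)" by (rule integral_mult_right_zero)
  also have "\<dots> \<le> 2 ^ card idx * B\<^sup>2 * (64 / K^3)"
    by (intro mult_left_mono indicator_integrable[OF Qb Qe]) auto
  finally have "norm (\<Sum>S\<in>Pow idx. chaos S k j s \<xi>) \<le> exp s * (2 ^ card idx * B\<^sup>2 * (64 / K^3))" by simp
  also have "\<dots> = 2 ^ card idx * (64 / K^3) * (exp s * (amp * exp (- s))\<^sup>2)" by (simp add: B_def)
  also have "\<dots> = 2 ^ card idx * (64 / K^3) * (amp\<^sup>2 * exp (- s))" by (simp only: exp_sq)
  also have "\<dots> \<le> 2 ^ card idx * (64 / K^3) * (amp\<^sup>2 * 1)" using s by (intro mult_left_mono) auto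
  finally show ?thesis by (simp add: mult_ac)
qed

end

section \<open>The self-convolution is small for most sign patterns\<close>

definition st_density :: "real \<times> (real^3) \<Rightarrow> real" where
  "st_density x = exponential_density 1 (fst x) * indicator (cball 0 8) (snd x)"

lemma st_density_nonneg: "st_density x \<ge> 0"
  by (simp add: st_density_def exponential_density_def)

lemma st_density_measurable [measurable]: "st_density \<in> borel_measurable (lborel \<Otimes>\<^sub>M lborel)"
proof -
  have [measurable]: "cball (0::real^3) 8 \<in> sets borel" by simp
  show ?thesis unfolding st_density_def exponential_density_def by measurable
qed

lemma exp_density_nn: "(\<integral>\<^sup>+s. ennreal (exponential_density 1 s) \<partial>lborel) = 1"
proof -
  interpret prob_space "density lborel (exponential_density 1)" by (rule prob_space_exponential_density) simp
  have "emeasure (density lborel (exponential_density 1)) UNIV = 1" using emeasure_space_1 by simp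
  thus ?thesis by (simp add: emeasure_density)
qed

lemma exp_density_nonneg: "exponential_density 1 s \<ge> 0"
  by (simp add: exponential_density_def)

lemma exp_density_integrable: "integrable lborel (exponential_density 1)"
  by (rule integrableI_nonneg) (auto simp: exp_density_nn exp_density_nonneg)

lemma exp_density_integral: "(LINT s|lborel. exponential_density 1 s) = 1"
  by (subst integral_eq_nn_integral) (auto simp: exp_density_nn exp_density_nonneg)

lemma st_density_nn:
  assumes X: "X \<in> sets borel" "emeasure lborel X \<le> ennreal c"
  shows "(\<integral>\<^sup>+x. ennreal (st_density x * indicator X (snd x)) \<partial>(lborel \<Otimes>\<^sub>M lborel)) \<le> ennreal c"
proof -
  have [measurable]: "X \<in> sets borel" by (fact X)
  have "(\<integral>\<^sup>+x. ennreal (st_density x * indicator X (snd x)) \<partial>(lborel \<Otimes>\<^sub>M lborel))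
      \<le> (\<integral>\<^sup>+x. ennreal (exponential_density 1 (fst x)) * indicator X (snd x) \<partial>(lborel \<Otimes>\<^sub>M lborel))"
    by (intro nn_integral_mono) (auto simp: st_density_def indicator_def exponential_density_def)
  also have "\<dots> = (\<integral>\<^sup>+s. \<integral>\<^sup>+\<xi>. ennreal (exponential_density 1 s) * indicator X \<xi> \<partial>lborel \<partial>lborel)"
    by (subst lborel.nn_integral_fst[symmetric]) (auto simp: exponential_density_def)
  also have "\<dots> = (\<integral>\<^sup>+s. ennreal (exponential_density 1 s) * emeasure lborel X \<partial>lborel)"
    by (subst nn_integral_cmult_indicator) (auto simp: X)
  also have "\<dots> = emeasure lborel X"
    by (subst nn_integral_multc) (auto simp: exp_density_nn exp_density_nonneg)
  finally show ?thesis using X(2) by (rule order_trans)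
qed

definition st_measure :: "(real \<times> (real^3)) measure" where
  "st_measure = density (lborel \<Otimes>\<^sub>M lborel) (\<lambda>x. ennreal (st_density x))"

lemma st_measure_space: "emeasure st_measure (space st_measure) \<le> ennreal 4096"
proof -
  have e: "emeasure lborel (cball (0::real^3) 8) \<le> ennreal 4096" using emeasure_cball_le[of 8] by simp
  have "emeasure st_measure (space st_measure) = (\<integral>\<^sup>+x. ennreal (st_density x) * indicator (space (lborel \<Otimes>\<^sub>M lborel)) x \<partial>(lborel \<Otimes>\<^sub>M lborel))"
    unfolding st_measure_def space_density by (rule emeasure_density[OF _ sets.top]) measurable
  also have "\<dots> = (\<integral>\<^sup>+x. ennreal (st_density x) \<partial>(lborel \<Otimes>\<^sub>M lborel))"
    by (intro nn_integral_cong) auto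
  also have "\<dots> = (\<integral>\<^sup>+x. ennreal (st_density x * indicator (cball 0 8) (snd x)) \<partial>(lborel \<Otimes>\<^sub>M lborel))"
    by (intro nn_integral_cong) (auto simp: st_density_def indicator_def)
  also have "\<dots> \<le> ennreal 4096" by (rule st_density_nn[OF _ e]) simp
  finally show ?thesis .
qed

lemma st_measure_finite: "finite_measure st_measure"
  by (rule finite_measureI) (use st_measure_space in \<open>metis ennreal_less_top infinity_ennreal_def less_irrefl order_le_less_trans\<close>)

lemma st_measure_total: "measure st_measure (space st_measure) \<le> 4096"
  unfolding measure_def using st_measure_space by (intro enn2real_leI) auto

lemma st_measure_measurable: "f \<in> borel_measurable (lborel \<Otimes>\<^sub>M lborel) \<Longrightarrow> f \<in> borel_measurable st_measure"
  by (simp add: st_measure_def)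

lemma st_measure_integral:
  fixes f :: "real \<times> (real^3) \<Rightarrow> real"
  assumes [measurable]: "f \<in> borel_measurable (lborel \<Otimes>\<^sub>M lborel)"
  shows "(LINT x|st_measure. f x) = (LINT x|(lborel \<Otimes>\<^sub>M lborel). st_density x * f x)"
  unfolding st_measure_def by (subst integral_density) (auto simp: st_density_nonneg)

lemma st_measure_strip:
  assumes "X \<in> sets borel" "emeasure lborel X \<le> ennreal c" "c \<ge> 0"
  shows "(LINT x|st_measure. indicator X (snd x)) \<le> c"
proof -
  have [measurable]: "X \<in> sets borel" by (fact assms)
  have "(LINT x|st_measure. indicator X (snd x)) = (LINT x|(lborel \<Otimes>\<^sub>M lborel). st_density x * indicator X (snd x))"
    by (rule st_measure_integral) measurable
  also have "\<dots> = enn2real (\<integral>\<^sup>+x. ennreal (st_density x * indicator X (snd x)) \<partial>(lborel \<Otimes>\<^sub>M lborel))"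
    by (rule integral_eq_nn_integral) (auto simp: st_density_nonneg)
  also have "\<dots> \<le> c" by (rule enn2real_leI[OF assms(3) st_density_nn[OF assms(1,2)]])
  finally show ?thesis .
qed

context cells begin

definition far :: "(real^3) set" where "far = {\<xi>. \<exists>i. \<bar>\<xi> $ i\<bar> \<ge> 4 / K}"

lemma near_emeasure: "emeasure lborel (- far) \<le> ennreal (512 / K^3)" and far_borel: "far \<in> sets borel"
proof -
  have "far = (\<Union>i. {\<xi>. \<bar>\<xi> $ i\<bar> \<ge> 4 / K})" by (auto simp: far_def)
  also have "\<dots> \<in> sets borel" by (intro sets.countable_UN'' borel_closed closed_Collect_le continuous_intros) auto
  finally show "far \<in> sets borel" .
  define lo :: "real^3" where "lo = (\<chi> i. - 4 / K)"
  have "- far \<subseteq> cbox lo (\<chi> i. lo $ i + 8 / K)"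
  proof
    fix \<xi> assume "\<xi> \<in> - far"
    hence "\<bar>\<xi> $ i\<bar> < 4 / K" for i by (auto simp: far_def not_le)
    hence "- (4 / K) \<le> \<xi> $ i \<and> \<xi> $ i \<le> 4 / K" for i by (meson abs_le_iff less_imp_le minus_le_iff)
    thus "\<xi> \<in> cbox lo (\<chi> i. lo $ i + 8 / K)" by (simp add: mem_box_cart lo_def)
  qed
  hence "emeasure lborel (- far) \<le> emeasure lborel (cbox lo (\<chi> i. lo $ i + 8 / K))" by (rule emeasure_mono) simp
  also have "\<dots> = ennreal (512 / K^3)" by (subst cart_box_measure(1)) (auto simp: power_divide)
  finally show "emeasure lborel (- far) \<le> ennreal (512 / K^3)" .
qed

text \<open>The concentration lemma with \<open>lam = K powr (3/2)\<close>. This balances the term linear in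
  \<open>K\<close>, which the exceptional probability \<open>exp (-K)\<close> forces, against the variance term
  \<open>lam\<^sup>2 card idx c\<^sup>2\<close>, which is then of order \<open>amp^4\<close>.\<close>

lemma chaos_component_concentration:
  fixes pr :: "complex \<Rightarrow> real" and k j :: 3
  assumes pr: "pr = Re \<or> pr = Im"
  defines "Y \<equiv> \<lambda>S x. if fst x \<ge> 0 \<and> snd x \<in> far then pr (chaos S k j (fst x) (snd x)) else 0"
  shows "real (card {S \<in> Pow idx. (LINT x|st_measure. \<bar>Y S x\<bar>) > 4096 * 131200 * amp^4 / sqrt K}) \<le> exp (- (real K + 5)) * 2 ^ card idx"
proof -
  have pd: "\<bar>pr a - pr b\<bar> \<le> norm (a - b)" "\<bar>pr a\<bar> \<le> norm a" for a b
    using pr abs_Re_le_cmod[of "a - b"] abs_Im_le_cmod[of "a - b"] abs_Re_le_cmod[of a] abs_Im_le_cmod[of a] by auto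
  have prs: "pr (\<Sum>S\<in>A. f S) = (\<Sum>S\<in>A. pr (f S))" for A and f :: "(3 \<times> nat \<times> nat) set \<Rightarrow> complex" using pr by auto
  have prm: "pr \<in> borel_measurable borel" using pr by auto
  define c where "c = 256 * amp\<^sup>2 / K^3"
  define m where "m = 64 * amp\<^sup>2 / K^3"
  define lam where "lam = real K * sqrt K"
  have K1: "real K \<ge> 1" using K_pos by simp
  have lam: "lam > 0" unfolding lam_def using K_pos by simp
  have conc: "real (card {S \<in> Pow idx. (LINT x|st_measure. \<bar>Y S x\<bar>) > 4096 / lam * (2 + (real K + 5) + lam * m + lam\<^sup>2 * card idx * c\<^sup>2)})
           \<le> exp (- (real K + 5)) * 2 ^ card idx"
  proof (rule signs_L1_concentration[OF finite_idx st_measure_finite])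
    have [measurable]: "far \<in> sets borel" by (rule far_borel)
    note [measurable] = measurable_compose[OF chaos_measurable prm]
    show "Y S \<in> borel_measurable st_measure" for S unfolding Y_def by (rule st_measure_measurable) measurable
    show "\<bar>Y S x\<bar> \<le> 512 * amp\<^sup>2" for S x
      using order_trans[OF pd(2) chaos_bound[of "fst x" S k j "snd x"]] by (simp add: Y_def)
    show "\<bar>Y (insert i S) x - Y S x\<bar> \<le> 2 * c" if "i \<in> idx - S" for S i x
    proof (cases "fst x \<ge> 0 \<and> snd x \<in> far")
      case True
      thus ?thesis using that order_trans[OF pd(1) chaos_diff[of i "fst x" S k j "snd x"]] by (simp add: Y_def c_def)
    next
      case False
      have "Y (insert i S) x = 0" "Y S x = 0" using False by (auto simp: Y_def)
      thus ?thesis by (simp add: c_def)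
    qed
    show "\<bar>\<Sum>S\<in>Pow idx. Y S x\<bar> \<le> m * 2 ^ card idx" for x
    proof (cases "fst x \<ge> 0 \<and> snd x \<in> far")
      case True
      hence "(\<Sum>S\<in>Pow idx. Y S x) = pr (\<Sum>S\<in>Pow idx. chaos S k j (fst x) (snd x))" by (simp add: Y_def prs)
      thus ?thesis using True order_trans[OF pd(2) chaos_mean[of "snd x" "fst x" k j]] by (simp add: far_def m_def)
    qed (auto simp: Y_def m_def)
  qed (use lam st_measure_total in \<open>auto simp: m_def\<close>)
  have "4096 / lam * (2 + (real K + 5) + lam * m + lam\<^sup>2 * card idx * c\<^sup>2) \<le> 4096 * 131200 * amp^4 / sqrt K"
  proof -
    have a1: "1 \<le> amp^4" "amp\<^sup>2 \<le> amp^4" using amp_ge1 by (auto intro: one_le_power power_increasing)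
    have sK: "sqrt K \<ge> 1" "sqrt K \<le> K" using K1 by (auto intro: real_le_lsqrt simp: power2_eq_square)
    have "lam * m \<le> K * K * m" unfolding lam_def using sK by (intro mult_right_mono mult_left_mono) (auto simp: m_def)
    also have "\<dots> = 64 * amp\<^sup>2 / K" using K_pos by (simp add: m_def power3_eq_cube field_simps)
    also have "\<dots> \<le> 64 * amp\<^sup>2 / 1" using K1 by (intro divide_left_mono) auto
    also have "\<dots> \<le> 64 * amp^4" using a1 by simp
    finally have 1: "lam * m \<le> 64 * amp^4" .
    have 2: "lam\<^sup>2 * card idx * c\<^sup>2 = 131072 * amp^4"
    proof -
      have "lam\<^sup>2 = real K^3" unfolding lam_def by (simp add: power_mult_distrib power2_eq_square power3_eq_cube)
      thus ?thesis unfolding c_def card_idx using K_pos by (simp add: power2_eq_square power3_eq_cube power4_eq_xxxx field_simps)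
    qed
    have "2 + (real K + 5) + lam * m + lam\<^sup>2 * card idx * c\<^sup>2 \<le> 8 * K + 64 * amp^4 + 131072 * amp^4"
      using 1 2 K1 by simp
    also have "\<dots> \<le> 8 * K * amp^4 + 64 * amp^4 * K + 131072 * amp^4 * K"
      using a1 K1 by (intro add_mono) (auto simp: mult_le_cancel_left1)
    also have "\<dots> \<le> 131200 * amp^4 * K" using a1 K1 by simp
    finally have "4096 / lam * (2 + (real K + 5) + lam * m + lam\<^sup>2 * card idx * c\<^sup>2) \<le> 4096 / lam * (131200 * amp^4 * K)"
      using lam by (intro mult_left_mono) auto
    also have "\<dots> = 4096 * 131200 * amp^4 / sqrt K" unfolding lam_def using K_pos by simp
    finally show ?thesis .
  qed
  hence "card {S \<in> Pow idx. (LINT x|st_measure. \<bar>Y S x\<bar>) > 4096 * 131200 * amp^4 / sqrt K}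
      \<le> card {S \<in> Pow idx. (LINT x|st_measure. \<bar>Y S x\<bar>) > 4096 / lam * (2 + (real K + 5) + lam * m + lam\<^sup>2 * card idx * c\<^sup>2)}"
    by (intro card_mono) (auto simp: finite_idx)
  thus ?thesis using conc by linarith
qed

text \<open>Eighteen real quantities are controlled at once, the real and imaginary parts for nine pairs of components; the
  summand 5 in the exponent pays for the union bound since \<open>18 \<le> exp 5\<close>. On the cube around the
  origin excluded from \<open>far\<close> the trivial bound suffices, as its volume is \<open>512/K^3\<close>.\<close>

lemma chaos_L1_small:
  "\<exists>Bad \<subseteq> Pow idx. real (card Bad) \<le> exp (- real K) * 2 ^ card idx \<and>
     (\<forall>S\<in>Pow idx - Bad. \<forall>k j. (LINT x|st_measure. indicator {0..} (fst x) * norm (chaos S k j (fst x) (snd x))) \<le> 2 * 10^9 * amp^4 / sqrt K)"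
proof -
  define Y where "Y pr S k j x = (if fst x \<ge> 0 \<and> snd x \<in> far then pr (chaos S k j (fst x) (snd x)) else 0)"
    for pr :: "complex \<Rightarrow> real" and S k j and x :: "real \<times> (real^3)"
  define E where "E = 4096 * 131200 * amp^4 / sqrt K"
  define bad where "bad pr k j = {S \<in> Pow idx. (LINT x|st_measure. \<bar>Y pr S k j x\<bar>) > E}" for pr k j
  define Bad where "Bad = (\<Union>k\<in>UNIV. \<Union>j\<in>UNIV. bad Re k j \<union> bad Im k j)"
  have K1: "real K \<ge> 1" using K_pos by simp
  have b: "real (card (bad pr k j)) \<le> exp (- (real K + 5)) * 2 ^ card idx" if "pr = Re \<or> pr = Im" for pr k j
    unfolding bad_def Y_def E_def by (rule chaos_component_concentration[OF that])
  have fin: "finite (bad pr k j)" for pr k j unfolding bad_def using finite_idx by simp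
  have "card Bad \<le> (\<Sum>k\<in>UNIV. card (\<Union>j\<in>UNIV. bad Re k j \<union> bad Im k j))" unfolding Bad_def by (intro card_UN_le) simp
  also have "\<dots> \<le> (\<Sum>k\<in>UNIV. \<Sum>j\<in>UNIV. card (bad Re k j \<union> bad Im k j))" by (intro sum_mono card_UN_le) simp
  also have "\<dots> \<le> (\<Sum>k\<in>UNIV. \<Sum>j\<in>UNIV. card (bad Re k j) + card (bad Im k j))" by (intro sum_mono card_Un_le)
  finally have "real (card Bad) \<le> real (\<Sum>k\<in>(UNIV::3 set). \<Sum>j\<in>(UNIV::3 set). card (bad Re k j) + card (bad Im k j))" by (rule of_nat_mono)
  also have "\<dots> = (\<Sum>k\<in>(UNIV::3 set). \<Sum>j\<in>(UNIV::3 set). real (card (bad Re k j)) + real (card (bad Im k j)))" by simp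
  also have "\<dots> \<le> (\<Sum>k\<in>(UNIV::3 set). \<Sum>j\<in>(UNIV::3 set). exp (- (real K + 5)) * 2 ^ card idx + exp (- (real K + 5)) * 2 ^ card idx)"
    by (intro sum_mono add_mono b) auto
  also have "\<dots> = 18 * exp (- 5) * (exp (- real K) * 2 ^ card idx)" by (simp add: exp_diff exp_minus field_simps exp_add)
  also have "\<dots> \<le> 1 * (exp (- real K) * 2 ^ card idx)"
  proof (rule mult_right_mono)
    have "(2::real)^5 \<le> exp 1 ^ 5" using exp_ge_add_one_self[of 1] by (intro power_mono) auto
    also have "\<dots> = exp 5" using exp_of_nat_mult[of 5 "1::real"] by simp
    finally show "18 * exp (- 5) \<le> (1::real)" by (simp add: exp_minus field_simps)
  qed simp
  finally have card: "real (card Bad) \<le> exp (- real K) * 2 ^ card idx" by simp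
  have main: "(LINT x|st_measure. indicator {0..} (fst x) * norm (chaos S k j (fst x) (snd x))) \<le> 2 * 10^9 * amp^4 / sqrt K"
    if S: "S \<in> Pow idx - Bad" for S k j
  proof -
    interpret finite_measure st_measure by (rule st_measure_finite)
    have [measurable]: "far \<in> sets borel" by (rule far_borel)
    have nb: "- far \<in> sets borel" using far_borel by simp
    note [measurable] = chaos_measurable nb
    have prm: "Re \<in> borel_measurable borel" "Im \<in> borel_measurable borel" by auto
    note [measurable] = measurable_compose[OF chaos_measurable prm(1)] measurable_compose[OF chaos_measurable prm(2)]
    have Ym: "Y Re S k j \<in> borel_measurable st_measure" "Y Im S k j \<in> borel_measurable st_measure"
      unfolding Y_def by (intro st_measure_measurable; measurable)+
    have Yb: "\<bar>Y pr S k j x\<bar> \<le> 512 * amp\<^sup>2" if "pr = Re \<or> pr = Im" for pr x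
      using that order_trans[OF abs_Re_le_cmod chaos_bound[of "fst x" S k j "snd x"]]
        order_trans[OF abs_Im_le_cmod chaos_bound[of "fst x" S k j "snd x"]] by (auto simp: Y_def)
    have Yi: "integrable st_measure (\<lambda>x. \<bar>Y Re S k j x\<bar>)" "integrable st_measure (\<lambda>x. \<bar>Y Im S k j x\<bar>)"
      by (intro integrable_abs integrable_const_bound[of _ "512 * amp\<^sup>2"]; use Ym Yb in simp)+
    have Ii: "integrable st_measure (\<lambda>x. 512 * amp\<^sup>2 * indicator (- far) (snd x))"
      by (intro integrable_const_bound[of _ "512 * amp\<^sup>2"] st_measure_measurable) (auto simp: indicator_def)
    have pt: "indicator {0..} (fst x) * norm (chaos S k j (fst x) (snd x)) \<le> \<bar>Y Re S k j x\<bar> + \<bar>Y Im S k j x\<bar> + 512 * amp\<^sup>2 * indicator (- far) (snd x)" for x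
    proof (cases "fst x \<ge> 0")
      case True
      thus ?thesis using chaos_bound[of "fst x" S k j "snd x"] cmod_le[of "chaos S k j (fst x) (snd x)"]
        by (cases "snd x \<in> far") (auto simp: Y_def)
    qed (auto simp: Y_def)
    have Zi: "integrable st_measure (\<lambda>x. indicator {0..} (fst x) * norm (chaos S k j (fst x) (snd x)))"
      by (intro integrable_const_bound[of _ "512 * amp\<^sup>2"] st_measure_measurable)
         (use chaos_bound in \<open>auto simp: indicator_def\<close>)
    have "(LINT x|st_measure. indicator {0..} (fst x) * norm (chaos S k j (fst x) (snd x)))
        \<le> (LINT x|st_measure. \<bar>Y Re S k j x\<bar> + \<bar>Y Im S k j x\<bar> + 512 * amp\<^sup>2 * indicator (- far) (snd x))"
      by (intro integral_mono Zi Bochner_Integration.integrable_add Yi Ii pt)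
    also have "\<dots> = (LINT x|st_measure. \<bar>Y Re S k j x\<bar>) + (LINT x|st_measure. \<bar>Y Im S k j x\<bar>) + 512 * amp\<^sup>2 * (LINT x|st_measure. indicator (- far) (snd x))"
      using Yi Ii by (simp add: Bochner_Integration.integral_add)
    also have "\<dots> \<le> E + E + 512 * amp\<^sup>2 * (512 / K^3)"
    proof (intro add_mono mult_left_mono)
      have "S \<notin> bad Re k j" "S \<notin> bad Im k j" using S by (auto simp: Bad_def)
      thus "(LINT x|st_measure. \<bar>Y Re S k j x\<bar>) \<le> E" "(LINT x|st_measure. \<bar>Y Im S k j x\<bar>) \<le> E" using S by (auto simp: bad_def not_less)
      show "(LINT x|st_measure. indicator (- far) (snd x)) \<le> 512 / K^3"
        by (rule st_measure_strip[OF nb near_emeasure]) simp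
    qed simp
    also have "\<dots> \<le> 2 * 10^9 * amp^4 / sqrt K"
    proof -
      have a: "amp\<^sup>2 \<le> amp^4" using amp_ge1 by (intro power_increasing) auto
      have "sqrt K \<le> K" using K1 by (auto intro: real_le_lsqrt simp: power2_eq_square)
      also have "real K \<le> K^3" using K1 by (metis of_nat_1 of_nat_le_iff of_nat_power power_increasing power_one_right one_le_numeral)
      finally have "amp\<^sup>2 / K^3 \<le> amp^4 / sqrt K" using K1 a by (intro frac_le) auto
      hence "512 * amp\<^sup>2 * (512 / K^3) \<le> 262144 * (amp^4 / sqrt K)" (is "?a \<le> 262144 * ?z") by simp
      moreover have "E = 537395200 * ?z" by (simp add: E_def)
      moreover have "amp^4 / sqrt K \<ge> 0" using amp_ge1 by simp
      ultimately have "E + E + ?a \<le> 2000000000 * ?z" by linarith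
      thus ?thesis by simp
    qed
    finally show ?thesis .
  qed
  show ?thesis
    by (rule exI[of _ Bad]) (use card main in \<open>auto simp: Bad_def bad_def\<close>)
qed

end

section \<open>Regular solutions for most sign patterns\<close>

context cells begin

definition slice :: "(3 \<times> nat \<times> nat) set \<Rightarrow> 3 \<Rightarrow> 3 \<Rightarrow> real \<Rightarrow> real^3 \<Rightarrow> real" where
  "slice S k j s \<xi> = st_density (s, \<xi>) * (indicator {0..} s * norm (chaos S k j s \<xi>))"

lemma slice_measurable: "(\<lambda>x. slice S k j (fst x) (snd x)) \<in> borel_measurable (lborel \<Otimes>\<^sub>M lborel)"
proof -
  note [measurable] = chaos_measurable
  show ?thesis unfolding slice_def prod.collapse by measurable
qed

lemma slice_nonneg: "slice S k j s \<xi> \<ge> 0"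
  by (simp add: slice_def st_density_nonneg)

lemma slice_le: "slice S k j s \<xi> \<le> 512 * amp\<^sup>2 * exponential_density 1 s"
proof -
  have b: "indicator {0..} s * norm (chaos S k j s \<xi>) \<le> 512 * amp\<^sup>2" using chaos_bound[of s S k j \<xi>] by (auto simp: indicator_def)
  have w: "st_density (s, \<xi>) \<le> exponential_density 1 s" by (auto simp: st_density_def indicator_def exp_density_nonneg)
  have "slice S k j s \<xi> \<le> exponential_density 1 s * (512 * amp\<^sup>2)"
    unfolding slice_def by (rule mult_mono[OF w b]) (auto simp: exp_density_nonneg)
  thus ?thesis by (simp add: mult.commute)
qed

lemma slice_integrable: "integrable lborel (\<lambda>s. slice S k j s \<xi>)"
proof (rule integrable_dominated[OF integrable_mult_right[OF exp_density_integrable]])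
  have "(\<lambda>s. slice S k j (fst (s, \<xi>)) (snd (s, \<xi>))) \<in> borel_measurable borel"
    by (rule measurable_compose[OF _ slice_measurable]) measurable
  thus "(\<lambda>s. slice S k j s \<xi>) \<in> borel_measurable lborel" by simp
  show "norm (slice S k j s \<xi>) \<le> 512 * amp\<^sup>2 * exponential_density 1 s" for s
    using slice_le slice_nonneg by simp
qed

lemma slice_integral_le: "(LINT s|lborel. slice S k j s \<xi>) \<le> 512 * amp\<^sup>2"
proof -
  have "(LINT s|lborel. slice S k j s \<xi>) \<le> (LINT s|lborel. 512 * amp\<^sup>2 * exponential_density 1 s)"
    by (intro integral_mono slice_integrable integrable_mult_right exp_density_integrable slice_le)
  thus ?thesis by (simp add: exp_density_integral)
qed

lemma slice_integral_nonneg: "(LINT s|lborel. slice S k j s \<xi>) \<ge> 0"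
  by (intro Bochner_Integration.integral_nonneg slice_nonneg)

lemma slice_far: "norm \<xi> > 8 \<Longrightarrow> slice S k j s \<xi> = 0" by (simp add: slice_def st_density_def)

text \<open>A bound for the first iterate at all times. The factor \<open>norm \<xi>\<close> bounds the kernels, and each slice
  is the modulus of a convolution at a nonnegative time, as its two exponential factors cancel.\<close>

definition majorant :: "(3 \<times> nat \<times> nat) set \<Rightarrow> real^3 \<Rightarrow> real" where
  "majorant S \<xi> = norm \<xi> * (\<Sum>k\<in>UNIV. \<Sum>j\<in>UNIV. LINT s|lborel. slice S k j s \<xi>)"

lemma majorant_measurable: "majorant S \<in> borel_measurable borel"
proof -
  have "(\<lambda>\<xi>. LINT s|lborel. slice S k j s \<xi>) \<in> borel_measurable borel" for k j
  proof (rule lborel.borel_measurable_lebesgue_integral)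
    have "(\<lambda>x. slice S k j (fst (snd x, fst x)) (snd (snd x, fst x))) \<in> borel_measurable (borel \<Otimes>\<^sub>M lborel)"
      by (rule measurable_compose[OF _ slice_measurable]) measurable
    thus "(\<lambda>(\<xi>, s). slice S k j s \<xi>) \<in> borel_measurable (borel \<Otimes>\<^sub>M lborel)" by (simp add: case_prod_beta)
  qed
  thus ?thesis unfolding majorant_def[abs_def] by (intro borel_measurable_times borel_measurable_sum) auto
qed

lemma majorant_supp: "norm \<xi> > 8 \<Longrightarrow> majorant S \<xi> = 0"
  by (simp add: majorant_def slice_far)

lemma majorant_bound: "majorant S \<xi> \<le> 36864 * amp\<^sup>2"
proof (cases "norm \<xi> \<le> 8")
  case True
  have "(\<Sum>k\<in>UNIV. \<Sum>j\<in>UNIV. LINT s|lborel. slice S k j s \<xi>) \<le> (\<Sum>k\<in>(UNIV::3 set). \<Sum>j\<in>(UNIV::3 set). 512 * amp\<^sup>2)"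
    by (intro sum_mono slice_integral_le)
  hence "majorant S \<xi> \<le> 8 * (\<Sum>k\<in>(UNIV::3 set). \<Sum>j\<in>(UNIV::3 set). 512 * amp\<^sup>2)"
    unfolding majorant_def using True by (intro mult_mono) (auto intro!: sum_nonneg slice_integral_nonneg)
  thus ?thesis by simp
qed (use majorant_supp in auto)

lemma majorant_mass:
  assumes "\<And>k j. (LINT x|st_measure. indicator {0..} (fst x) * norm (chaos S k j (fst x) (snd x))) \<le> E"
  shows "(LINT \<xi>|lborel. majorant S \<xi>) \<le> 72 * E"
proof -
  interpret finite_measure st_measure by (rule st_measure_finite)
  note [measurable] = chaos_measurable
  have m: "(\<lambda>x. indicator {0..} (fst x) * norm (chaos S k j (fst x) (snd x))) \<in> borel_measurable (lborel \<Otimes>\<^sub>M lborel)" for k j by measurable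
  have Zi: "integrable st_measure (\<lambda>x. indicator {0..} (fst x) * norm (chaos S k j (fst x) (snd x)))" for k j
    by (intro integrable_const_bound[of _ "512 * amp\<^sup>2"] st_measure_measurable m)
       (use chaos_bound in \<open>auto simp: indicator_def\<close>)
  have si: "integrable (lborel \<Otimes>\<^sub>M lborel) (\<lambda>(s, \<xi>). slice S k j s \<xi>)" for k j
  proof -
    have "integrable (lborel \<Otimes>\<^sub>M lborel) (\<lambda>x. st_density x *\<^sub>R (indicator {0..} (fst x) * norm (chaos S k j (fst x) (snd x))))"
      using Zi[of k j] unfolding st_measure_def by (rule iffD1[OF integrable_density, rotated 3]) (use m st_density_nonneg in auto)
    thus ?thesis by (simp add: slice_def case_prod_unfold)
  qed
  have inner: "integrable lborel (\<lambda>\<xi>. LINT s|lborel. slice S k j s \<xi>)" for k j by (rule lborel_pair.integrable_snd[OF si])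
  have val: "(LINT \<xi>|lborel. LINT s|lborel. slice S k j s \<xi>) \<le> E" for k j
  proof -
    have "(LINT \<xi>|lborel. LINT s|lborel. slice S k j s \<xi>) = (LINT x|(lborel \<Otimes>\<^sub>M lborel). (case x of (s, \<xi>) \<Rightarrow> slice S k j s \<xi>))"
      by (rule lborel_pair.integral_snd[OF si])
    also have "\<dots> = (LINT x|st_measure. indicator {0..} (fst x) * norm (chaos S k j (fst x) (snd x)))"
      by (subst st_measure_integral[OF m], intro Bochner_Integration.integral_cong refl) (simp add: slice_def case_prod_unfold)
    finally show ?thesis using assms by simp
  qed
  have in0: "(LINT s|lborel. slice S k j s \<xi>) \<ge> 0" for k j \<xi> by (rule slice_integral_nonneg)
  have pt: "majorant S \<xi> \<le> 8 * (\<Sum>k\<in>UNIV. \<Sum>j\<in>UNIV. LINT s|lborel. slice S k j s \<xi>)" for \<xi>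
  proof (cases "norm \<xi> \<le> 8")
    case True
    thus ?thesis unfolding majorant_def using in0 by (intro mult_right_mono sum_nonneg) auto
  next
    case False
    have "0 \<le> 8 * (\<Sum>k\<in>UNIV. \<Sum>j\<in>UNIV. LINT s|lborel. slice S k j s \<xi>)" using in0 by (intro mult_nonneg_nonneg sum_nonneg) auto
    thus ?thesis using majorant_supp[of \<xi> S] False by simp
  qed
  have i8: "integrable lborel (\<lambda>\<xi>. 8 * (\<Sum>k\<in>UNIV. \<Sum>j\<in>UNIV. LINT s|lborel. slice S k j s \<xi>))"
    by (intro integrable_mult_right Bochner_Integration.integrable_sum inner)
  have mnn: "majorant S \<xi> \<ge> 0" for \<xi> unfolding majorant_def using in0 by (intro mult_nonneg_nonneg sum_nonneg) auto
  have mi: "integrable lborel (majorant S)"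
    by (rule integrable_dominated[OF i8]) (use majorant_measurable mnn pt in auto)
  have "(LINT \<xi>|lborel. majorant S \<xi>) \<le> (LINT \<xi>|lborel. 8 * (\<Sum>k\<in>UNIV. \<Sum>j\<in>UNIV. LINT s|lborel. slice S k j s \<xi>))"
    by (rule integral_mono[OF mi i8 pt])
  also have "\<dots> = 8 * (\<Sum>k\<in>UNIV. \<Sum>j\<in>UNIV. LINT \<xi>|lborel. LINT s|lborel. slice S k j s \<xi>)"
    by (simp only: integral_mult_right_zero) (simp add: Bochner_Integration.integral_sum Bochner_Integration.integrable_sum inner)
  also have "\<dots> \<le> 8 * (\<Sum>k\<in>(UNIV::3 set). \<Sum>j\<in>(UNIV::3 set). E)" by (intro mult_left_mono sum_mono val) auto
  finally show ?thesis by simp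
qed

text \<open>The heat kernel is at most one, so the first iterate is bounded uniformly in time by the time integral of the
  convolutions.\<close>

lemma majorant_first_iterate:
  assumes M: "borel_kernels M" and t: "t \<ge> 0"
  shows "norm (borel_kernels.bilin M (flow S) (flow S) l t \<xi>) \<le> majorant S \<xi>"
proof -
  interpret borel_kernels M by (rule M)
  define N where "N = nonlin (flow S) (flow S) l \<xi>"
  define c where "c = (norm \<xi>)\<^sup>2"
  have Nb: "norm (N s) \<le> norm \<xi> * (\<Sum>k\<in>UNIV. \<Sum>j\<in>UNIV. slice S k j s \<xi>)" if s: "s \<ge> 0" for s
  proof -
    have sl: "norm (conv (flow S k s) (flow S j s) \<xi>) \<le> slice S k j s \<xi>" for k j
    proof (cases "norm \<xi> \<le> 8")
      case True
      have "slice S k j s \<xi> = (exp (-s) * exp s) * norm (conv (flow S k s) (flow S j s) \<xi>)"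
        using True s by (simp add: slice_def st_density_def exponential_density_def chaos_def norm_mult)
      thus ?thesis by (simp add: mult_exp_exp)
    next
      case False
      thus ?thesis using chaos_supp[OF s, of \<xi> S k j] slice_nonneg by simp
    qed
    have "norm (N s) \<le> (\<Sum>k\<in>UNIV. \<Sum>j\<in>UNIV. norm \<xi> * slice S k j s \<xi>)"
      unfolding N_def nonlin_def by (intro sum_norm_le) (auto simp: norm_mult intro!: mult_mono M_le sl)
    thus ?thesis by (simp add: sum_distrib_left)
  qed
  have Nc: "continuous_on {0..} N" unfolding N_def by (intro nonlin_cont flow_admissible)
  have i: "integrable lborel (\<lambda>s. indicator {0..t} s *\<^sub>R (complex_of_real (exp (- c * (t - s))) * N s))"
    using duhamel_integrable[OF Nc] unfolding set_integrable_def .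
  have i2: "integrable lborel (\<lambda>s. norm \<xi> * (\<Sum>k\<in>UNIV. \<Sum>j\<in>UNIV. slice S k j s \<xi>))"
    by (intro integrable_mult_right Bochner_Integration.integrable_sum slice_integrable)
  have pt: "norm (indicator {0..t} s *\<^sub>R (complex_of_real (exp (- c * (t - s))) * N s)) \<le> norm \<xi> * (\<Sum>k\<in>UNIV. \<Sum>j\<in>UNIV. slice S k j s \<xi>)" for s
  proof (cases "s \<in> {0..t}")
    case True
    have "exp (- c * (t - s)) \<le> 1" using True by (simp add: c_def)
    hence "exp (- c * (t - s)) * norm (N s) \<le> 1 * norm (N s)" by (intro mult_right_mono) auto
    thus ?thesis using True Nb[of s] by (simp add: norm_mult)
  next
    case False
    have "0 \<le> norm \<xi> * (\<Sum>k\<in>UNIV. \<Sum>j\<in>UNIV. slice S k j s \<xi>)" by (intro mult_nonneg_nonneg sum_nonneg slice_nonneg) auto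
    thus ?thesis using False by simp
  qed
  have "norm (bilin (flow S) (flow S) l t \<xi>) \<le> (LINT s|lborel. norm \<xi> * (\<Sum>k\<in>UNIV. \<Sum>j\<in>UNIV. slice S k j s \<xi>))"
    unfolding bilin_def duhamel_def set_lebesgue_integral_def N_def[symmetric] c_def[symmetric]
    by (rule norm_integral_dominated[OF i2 borel_measurable_integrable[OF i] pt])
  also have "\<dots> = majorant S \<xi>" unfolding majorant_def
    by (simp only: integral_mult_right_zero) (simp add: Bochner_Integration.integral_sum Bochner_Integration.integrable_sum slice_integrable)
  finally show ?thesis .
qed

text \<open>The constants of \<open>global_field\<close> in terms of \<open>amp\<close> and \<open>K\<close>: the value of
  \<open>lam\<close> is chosen such that the heat part of the linearization is bounded by \<open>1/16\<close>.\<close>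

lemma regular_if_small:
  assumes M: "borel_kernels M" and ae: "AE \<xi> in lebesgue. \<forall>k j l. M0 k j l \<xi> = M k j l \<xi>"
    and E: "\<And>k j. (LINT x|st_measure. indicator {0..} (fst x) * norm (chaos S k j (fst x) (snd x))) \<le> 2 * 10^9 * amp^4 / sqrt K"
    and C1: "C1 = 9 * shift_const * 400000 * (1 + 36864 * pot_const)"
    and C2: "C2 = shell_const + 9 * conv_const 4 * shell_const\<^sup>2"
    and C3: "C3 = (144 * shift_const * (17 * pot_const))\<^sup>2"
    and small: "(16 * C1 + 288 * conv_const 4 * C1 * C2) * amp^6 * exp (C3 * amp\<^sup>2) / sqrt (sqrt K) \<le> 1"
  shows "generates_regular_global_solution M0 (psi S)"
proof -
  interpret shell_datum M "psi S" amp by (rule shell[OF M])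
  note pos = consts_pos conv_const_nonneg[of 4]
  have C10: "C1 \<ge> 0" unfolding C1 using pos by simp
  have C20: "C2 \<ge> 0" unfolding C2 using pos by simp
  define g where "g = 1 / sqrt (sqrt K)"
  have g0: "g \<ge> 0" by (simp add: g_def)
  define X where "X = amp^6 * exp (C3 * amp\<^sup>2) * g"
  have X0: "X \<ge> 0" unfolding X_def using A_ge1 g0 by simp
  have sm: "(16 * C1 + 288 * conv_const 4 * C1 * C2) * X \<le> 1" using small by (simp add: X_def g_def mult_ac)
  define \<delta> where "\<delta> = 72 * (2 * 10^9 * amp^4 / sqrt K)"
  have \<delta>: "\<delta> > 0" unfolding \<delta>_def using A_ge1 K_pos by simp
  have sq\<delta>: "sqrt \<delta> \<le> 400000 * amp\<^sup>2 * g"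
  proof (rule real_le_lsqrt)
    have "(400000 * amp\<^sup>2 * g)\<^sup>2 = 160000000000 * amp^4 / sqrt K"
      by (simp add: g_def power_mult_distrib power_divide power4_eq_xxxx power2_eq_square[of amp] mult_ac) 
    thus "\<delta> \<le> (400000 * amp\<^sup>2 * g)\<^sup>2" unfolding \<delta>_def using A_ge1 K_pos by (simp add: divide_right_mono)
  qed (use g0 A_ge1 in auto)
  \<comment> \<open>With this choice \<open>sqrt lam\<close> is 144 times the constant of \<open>bilin_heat_le\<close>, and \<open>9 / 144 = 1 / 16\<close>.\<close>
  define lam where "lam = C3 * amp\<^sup>2"
  have sl: "sqrt lam = 144 * shift_const * (17 * pot_const) * amp"
    unfolding lam_def C3 power_mult_distrib[symmetric] using pos A_ge1 by (intro real_sqrt_unique) auto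
  have lam0: "lam > 0" unfolding lam_def C3 using pos A_ge1 by simp
  define \<sigma> where "\<sigma> = 9 * (shift_const * sqrt \<delta> * (1 + 36864 * amp\<^sup>2 * pot_const))"
  define \<beta> where "\<beta> = amp * shell_const + 9 * conv_const 4 * (amp * shell_const) * (amp * shell_const)"
  have a2: "1 \<le> amp\<^sup>2" using A_ge1 by (simp add: one_le_power)
  have \<sigma>le: "\<sigma> \<le> C1 * (amp^4 * g)"
  proof -
    have "1 + 36864 * amp\<^sup>2 * pot_const \<le> amp\<^sup>2 * (1 + 36864 * pot_const)" using a2 by (simp add: algebra_simps)
    hence "\<sigma> \<le> 9 * (shift_const * (400000 * amp\<^sup>2 * g) * (amp\<^sup>2 * (1 + 36864 * pot_const)))"
      unfolding \<sigma>_def using pos g0 sq\<delta> \<delta> by (intro mult_left_mono mult_mono) (auto intro!: add_nonneg_nonneg)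
    also have "\<dots> = C1 * (amp^4 * g)" unfolding C1 by (simp add: power4_eq_xxxx power2_eq_square mult_ac)
    finally show ?thesis .
  qed
  have \<sigma>0: "\<sigma> \<ge> 0" unfolding \<sigma>_def using pos \<delta> by simp
  have \<beta>le: "\<beta> \<le> C2 * amp\<^sup>2"
  proof -
    have "amp * shell_const \<le> amp\<^sup>2 * shell_const" using A_ge1 pos by (intro mult_right_mono) (auto simp: power2_eq_square mult_le_cancel_left1)
    thus ?thesis unfolding \<beta>_def C2 by (simp add: algebra_simps power2_eq_square)
  qed
  have \<beta>0: "\<beta> \<ge> 0" unfolding \<beta>_def using pos A_ge1 by simp
  have aX: "amp^4 * g \<le> X"
  proof -
    have "amp^4 * 1 \<le> amp^6 * exp (C3 * amp\<^sup>2)" using A_ge1 by (intro mult_mono power_increasing) (auto simp: C3)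
    thus ?thesis unfolding X_def using g0 by (intro mult_right_mono) auto
  qed
  have \<sigma>16: "\<sigma> \<le> 1/16"
  proof -
    have "\<sigma> \<le> C1 * X" using \<sigma>le mult_left_mono[OF aX C10] by linarith
    moreover have "288 * conv_const 4 * C1 * C2 * X \<ge> 0" using pos C10 C20 X0 by simp
    moreover have "16 * (C1 * X) + 288 * conv_const 4 * C1 * C2 * X \<le> 1" using sm by (simp add: distrib_right)
    ultimately show ?thesis by linarith
  qed
  have "\<exists>u. admissible u \<and> (\<forall>l t \<xi>. t \<ge> 0 \<longrightarrow> u l t \<xi> = heat (psi S) l t \<xi> + bilin u u l t \<xi>)"
  proof (rule global_field[OF majorant_measurable majorant_bound majorant_supp _ \<delta> _ lam0 _ \<sigma>_def \<sigma>16 \<beta>_def])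
    show "(LINT q|lborel. majorant S q) \<le> \<delta>" unfolding \<delta>_def by (rule majorant_mass[OF E])
    show "norm (bilin (heat (psi S)) (heat (psi S)) l s q) \<le> majorant S q" if "s \<ge> 0" for l s q
      by (rule majorant_first_iterate[OF M that])
    show "9 * (amp * shift_const * (17 * pot_const)) / sqrt lam \<le> 1/16"
      unfolding sl using pos A_ge1 by (simp add: field_simps)
    have "\<sigma> * \<beta> \<le> (C1 * (amp^4 * g)) * (C2 * amp\<^sup>2)" using \<sigma>le \<beta>le \<sigma>0 \<beta>0 C10 g0 A_ge1 by (intro mult_mono) auto
    also have "\<dots> = C1 * C2 * (amp^6 * g)" by (simp add: power_add[symmetric])
    finally have "\<sigma> * \<beta> * exp lam \<le> C1 * C2 * (amp^6 * g) * exp lam" by (intro mult_right_mono) auto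
    also have "\<dots> = C1 * C2 * X" by (simp add: X_def lam_def)
    finally have "36 * conv_const 4 * (\<sigma> * \<beta> * exp lam) \<le> 36 * conv_const 4 * (C1 * C2 * X)" using pos by (intro mult_left_mono) auto
    moreover have "16 * C1 * X \<ge> 0" using C10 X0 by simp
    ultimately show "9 * conv_const 4 * (2 * (2 * \<sigma> * \<beta>) * exp lam) \<le> 1/8" using sm by (simp add: algebra_simps)
  qed
  then obtain u where u: "admissible u" "\<And>l t \<xi>. t \<ge> 0 \<Longrightarrow> u l t \<xi> = heat (psi S) l t \<xi> + bilin u u l t \<xi>" by blast
  show ?thesis
    by (rule regular_solution[OF ae u(1)]) (simp add: u(2) heat_def)
qed

end

text \<open>For \<open>K\<close> large the exponent is of order \<open>sqrt (ln (ln K))\<close>, so the exponential grows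
  more slowly than any power of \<open>K\<close>.\<close>

lemma smallness_eventually:
  fixes C D d :: real
  assumes "D > 0" "d > 0"
  shows "\<exists>K0. \<forall>K\<ge>K0. C * (1 + d * ln (ln (real K)) powr (1/4))^6 * exp (D * (1 + d * ln (ln (real K)) powr (1/4))\<^sup>2) / sqrt (sqrt (real K)) \<le> 1"
proof -
  define Q where "Q x = (1 + d * ln (ln x) powr (1/4))^6 * exp (D * (1 + d * ln (ln x) powr (1/4))\<^sup>2) / sqrt (sqrt x)" for x :: real
  have "(Q \<longlongrightarrow> 0) at_top" unfolding Q_def[abs_def] using assms by real_asymp
  hence "((\<lambda>K. Q (real K)) \<longlongrightarrow> 0) sequentially" by (rule filterlim_compose) (rule filterlim_real_sequentially)
  hence "((\<lambda>K. C * Q (real K)) \<longlongrightarrow> C * 0) sequentially" by (rule tendsto_mult_left)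
  hence "\<forall>\<^sub>F K in sequentially. C * Q (real K) < 1" by (rule order_tendstoD) simp
  then obtain K0 where "\<And>K. K \<ge> K0 \<Longrightarrow> C * Q (real K) < 1" unfolding eventually_sequentially by blast
  thus ?thesis by (intro exI[of _ K0]) (auto simp: Q_def mult.assoc intro: less_imp_le)
qed

context gns_random_data begin

definition all_indices :: "(3 \<times> nat \<times> nat) set" where "all_indices = {1, 2} \<times> {1..K} \<times> {1..K^2}"

definition pattern :: "'g \<Rightarrow> (3 \<times> nat \<times> nat) set" where
  "pattern \<gamma> = {i \<in> all_indices. (case i of (j, s, p) \<Rightarrow> r j s p \<gamma>) = 1}"

lemma pattern_prob:
  assumes "S \<subseteq> all_indices"
  shows "{\<gamma> \<in> space P. pattern \<gamma> = S} \<in> events" and "prob {\<gamma> \<in> space P. pattern \<gamma> = S} = 1 / 2 ^ card all_indices"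
proof -
  define X where "X = (\<lambda>(j, s, p). r j s p)"
  define A where "A i = {if i \<in> S then 1 else - 1 :: real}" for i
  have fin: "finite all_indices" by (simp add: all_indices_def)
  have ne: "all_indices \<noteq> {}" using K_pos by (auto simp: all_indices_def)
  have ind: "indep_vars (\<lambda>_. borel) X all_indices" using indep unfolding X_def all_indices_def .
  have Xs: "X i \<gamma> = 1 \<or> X i \<gamma> = - 1" if i0: "i \<in> all_indices" and g: "\<gamma> \<in> space P" for i \<gamma>
  proof -
    obtain j s p where i: "i = (j, s, p)" "j \<in> {1, 2}" "s \<in> {1..K}" "p \<in> {1..K^2}" using i0 by (auto simp: all_indices_def)
    show ?thesis using signs[OF i(2-4) g] by (auto simp: i(1) X_def)
  qed
  have pX: "pattern \<gamma> = {i \<in> all_indices. X i \<gamma> = 1}" for \<gamma> unfolding pattern_def X_def by (simp add: case_prod_unfold)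
  have eq: "{\<gamma> \<in> space P. pattern \<gamma> = S} = (\<Inter>i\<in>all_indices. X i -` A i \<inter> space P)"
  proof (intro set_eqI iffI)
    fix \<gamma> assume g: "\<gamma> \<in> {\<gamma> \<in> space P. pattern \<gamma> = S}"
    hence "X i \<gamma> = (if i \<in> S then 1 else - 1)" if "i \<in> all_indices" for i
      using Xs[OF that, of \<gamma>] that by (auto simp: pX)
    thus "\<gamma> \<in> (\<Inter>i\<in>all_indices. X i -` A i \<inter> space P)" using g by (auto simp: A_def)
  next
    fix \<gamma> assume g: "\<gamma> \<in> (\<Inter>i\<in>all_indices. X i -` A i \<inter> space P)"
    hence "\<gamma> \<in> space P" using ne by auto
    moreover have "X i \<gamma> = (if i \<in> S then 1 else - 1)" if i0: "i \<in> all_indices" for i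
    proof -
      have "\<gamma> \<in> X i -` A i" using g i0 by blast
      thus ?thesis by (simp add: A_def)
    qed
    hence "pattern \<gamma> = S" using assms by (auto simp: pX split: if_splits)
    ultimately show "\<gamma> \<in> {\<gamma> \<in> space P. pattern \<gamma> = S}" by simp
  qed
  have rv: "random_variable borel (X i)" if "i \<in> all_indices" for i using ind that unfolding indep_vars_def by auto
  have Ae: "X i -` A i \<inter> space P \<in> events" if "i \<in> all_indices" for i
    by (rule measurable_sets[OF rv[OF that]]) (simp add: A_def)
  show "{\<gamma> \<in> space P. pattern \<gamma> = S} \<in> events" unfolding eq
    using fin ne Ae by (intro sets.finite_INT) auto
  have one: "prob (X i -` A i \<inter> space P) = 1 / 2" if i0: "i \<in> all_indices" for i
  proof -
    obtain j s p where i: "i = (j, s, p)" "j \<in> {1, 2}" "s \<in> {1..K}" "p \<in> {1..K^2}" using i0 by (auto simp: all_indices_def)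
    have "X i -` A i \<inter> space P = {\<gamma> \<in> space P. r j s p \<gamma> = (if i \<in> S then 1 else - 1)}" by (auto simp: A_def X_def i(1))
    thus ?thesis using fair[OF i(2-4), of "if i \<in> S then 1 else - 1"] by simp
  qed
  have "prob (\<Inter>i\<in>all_indices. X i -` A i \<inter> space P) = (\<Prod>i\<in>all_indices. prob (X i -` A i \<inter> space P))"
    by (rule indep_varsD[OF ind ne fin]) (auto simp: A_def)
  also have "\<dots> = (\<Prod>i\<in>all_indices. 1 / 2)" by (rule prod.cong[OF refl one])
  also have "\<dots> = (1 / 2) ^ card all_indices" by simp
  finally show "prob {\<gamma> \<in> space P. pattern \<gamma> = S} = 1 / 2 ^ card all_indices" unfolding eq by (simp add: power_divide)
qed

lemma pattern_event_prob:
  "prob {\<gamma> \<in> space P. G (pattern \<gamma>)} = real (card {S \<in> Pow all_indices. G S}) / 2 ^ card all_indices"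
proof -
  have fin: "finite {S \<in> Pow all_indices. G S}" by (simp add: all_indices_def)
  have "{\<gamma> \<in> space P. G (pattern \<gamma>)} = (\<Union>S\<in>{S \<in> Pow all_indices. G S}. {\<gamma> \<in> space P. pattern \<gamma> = S})"
    by (auto simp: pattern_def)
  also have "prob \<dots> = (\<Sum>S\<in>{S \<in> Pow all_indices. G S}. prob {\<gamma> \<in> space P. pattern \<gamma> = S})"
    by (intro finite_measure_finite_Union fin) (auto simp: disjoint_family_on_def intro: pattern_prob(1))
  also have "\<dots> = (\<Sum>S\<in>{S \<in> Pow all_indices. G S}. 1 / 2 ^ card all_indices)"
    by (intro sum.cong refl pattern_prob(2)) auto
  finally show ?thesis by simp
qed

lemma cells: "\<kappa> > 0 \<Longrightarrow> cells \<kappa> K H W \<Theta> (ln (ln (real K)) powr (1/4))"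
  by unfold_locales (use K_pos blocks subblocks Theta in auto)

end

theorem theorem1p1:
  fixes \<kappa> :: real and M :: kernels
  assumes "\<kappa> > 0"
    and "\<And>k j l. M k j l \<in> borel_measurable lebesgue"
    and "\<And>k j l \<xi>. norm (M k j l \<xi>) \<le> norm \<xi>"
  shows "\<exists>K0. \<forall>K\<ge>K0. \<forall>(P :: 'g measure) H W \<Theta> r.
           gns_random_data P \<kappa> K H W \<Theta> r \<longrightarrow>
           measure P {\<gamma> \<in> space P. generates_regular_global_solution M
             (psi_hat \<kappa> K W \<Theta> (\<lambda>j s p. r j s p \<gamma>))} \<ge> 1 - exp (- real K)"
proof -
  obtain M' where M': "borel_kernels M'" and ae: "AE \<xi> in lebesgue. \<forall>k j l. M k j l \<xi> = M' k j l \<xi>"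
    using borel_kernel_version[of M] assms(2,3) by blast
  define C1 where "C1 = 9 * shift_const * 400000 * (1 + 36864 * pot_const)"
  define C2 where "C2 = shell_const + 9 * conv_const 4 * shell_const\<^sup>2"
  define C3 where "C3 = (144 * shift_const * (17 * pot_const))\<^sup>2"
  define d where "d = 2 + 8 / \<kappa>"
  have "C3 > 0" unfolding C3_def using consts_pos by simp
  moreover have "d > 0" unfolding d_def using assms(1) by (intro add_pos_pos) auto
  ultimately obtain K0 where K0: "\<And>K. K \<ge> K0 \<Longrightarrow> (16 * C1 + 288 * conv_const 4 * C1 * C2) * (1 + d * ln (ln (real K)) powr (1/4))^6 * exp (C3 * (1 + d * ln (ln (real K)) powr (1/4))\<^sup>2) / sqrt (sqrt (real K)) \<le> 1"
    using smallness_eventually by blast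
  show ?thesis
  proof (intro exI[of _ K0] allI impI)
    fix K :: nat and P :: "'g measure" and H W \<Theta> r
    assume K: "K \<ge> K0" and data: "gns_random_data P \<kappa> K H W \<Theta> r"
    interpret gns_random_data P \<kappa> K H W \<Theta> r by (rule data)
    interpret C: cells \<kappa> K H W \<Theta> "ln (ln (real K)) powr (1/4)" by (rule cells[OF assms(1)])
    have idx: "C.idx = all_indices" by (simp add: C.idx_def all_indices_def)
    have amp: "C.amp = 1 + d * ln (ln (real K)) powr (1/4)" by (simp add: C.amp_def d_def)
    define G where "G S = generates_regular_global_solution M (C.psi S)" for S
    obtain Bad where Bad: "Bad \<subseteq> Pow C.idx" "real (card Bad) \<le> exp (- real K) * 2 ^ card C.idx"
      and good: "\<And>S k j. S \<in> Pow C.idx - Bad \<Longrightarrow> (LINT x|st_measure. indicator {0..} (fst x) * norm (C.chaos S k j (fst x) (snd x))) \<le> 2 * 10^9 * C.amp^4 / sqrt K"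
      using C.chaos_L1_small by blast
    have GS: "G S" if "S \<in> Pow C.idx - Bad" for S
      unfolding G_def by (rule C.regular_if_small[OF M' ae good[OF that] C1_def C2_def C3_def]) (use K0[OF K] in \<open>simp add: amp\<close>)
    have "psi_hat \<kappa> K W \<Theta> (\<lambda>j s p. r j s p \<gamma>) = C.psi (pattern \<gamma>)" if g: "\<gamma> \<in> space P" for \<gamma>
    proof (intro ext)
      fix l \<xi>
      have "psi_hat \<kappa> K W \<Theta> (\<lambda>j s p. r j s p \<gamma>) l \<xi> = complex_of_real 1 * psi_hat \<kappa> K W \<Theta> (sgn_of (pattern \<gamma>)) l \<xi>"
      proof (rule C.psi_hat_scale)
        fix j :: 3 and s p assume jsp: "j \<in> {1, 2}" "s \<in> {1..K}" "p \<in> {1..K^2}"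
        show "r j s p \<gamma> = 1 * sgn_of (pattern \<gamma>) j s p"
          using signs[OF jsp g] jsp by (auto simp: sgn_of_def pattern_def all_indices_def)
      qed
      thus "psi_hat \<kappa> K W \<Theta> (\<lambda>j s p. r j s p \<gamma>) l \<xi> = C.psi (pattern \<gamma>) l \<xi>" by (simp add: C.psi_def)
    qed
    hence "{\<gamma> \<in> space P. generates_regular_global_solution M (psi_hat \<kappa> K W \<Theta> (\<lambda>j s p. r j s p \<gamma>))} = {\<gamma> \<in> space P. G (pattern \<gamma>)}"
      by (auto simp: G_def)
    moreover have "prob {\<gamma> \<in> space P. G (pattern \<gamma>)} \<ge> 1 - exp (- real K)"
    proof -
      have fin: "finite (Pow C.idx)" using C.finite_idx by simp
      have cm: "card (Pow C.idx - Bad) \<le> card {S \<in> Pow all_indices. G S}"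
        using GS C.finite_idx by (intro card_mono) (auto simp: idx[symmetric])
      have "card (Pow C.idx - Bad) + card Bad = card (Pow C.idx)"
        using card_Diff_subset[OF finite_subset[OF Bad(1) fin] Bad(1)] card_mono[OF fin Bad(1)] by linarith
      hence "card (Pow C.idx - Bad) + card Bad = 2 ^ card C.idx" by (simp only: card_Pow[OF C.finite_idx])
      hence "real (card (Pow C.idx - Bad)) + real (card Bad) = 2 ^ card C.idx"
        by (metis of_nat_add of_nat_numeral of_nat_power)
      moreover have "real (card (Pow C.idx - Bad)) \<le> real (card {S \<in> Pow all_indices. G S})" using cm by simp
      ultimately have "real (card {S \<in> Pow all_indices. G S}) \<ge> 2 ^ card C.idx - real (card Bad)" by linarith
      hence "real (card {S \<in> Pow all_indices. G S}) \<ge> (1 - exp (- real K)) * 2 ^ card C.idx" using Bad(2) by (simp add: left_diff_distrib)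
      thus ?thesis unfolding pattern_event_prob idx[symmetric] by (simp add: le_divide_eq)
    qed
    ultimately show "measure P {\<gamma> \<in> space P. generates_regular_global_solution M (psi_hat \<kappa> K W \<Theta> (\<lambda>j s p. r j s p \<gamma>))} \<ge> 1 - exp (- real K)"
      by simp
  qed
qed

end
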